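(* Assume that the linear system $$x'(t)=A(t)x(t),\qquad y'(t)=B(t)y(t)$$ has an $\alpha$-exponential dichotomy with constants $K\ge1$ and $\alpha>0$. If $|f(t,x)|\le\lambda|x|$, $|g(t,x)|\le\lambda|x|$, $|\phi(t,y)|\le\delta$, $|\psi(t,y)|\le\delta$ for all $t\in\mathbb{R}$, $x\in\mathbb{R}^{n_1}$, $y\in\mathbb{R}^{n_2}$, and if further $$8K\omega\alpha^{-1}<1,\qquad 8K\lambda\alpha^{-1}<1,$$ then the system $$\begin{cases}x'(t)=A(t)x(t)+f(t,x(t))+\phi(t,y(t)),\\ y'(t)=B(t)y(t)+g(t,x(t))+\psi(t,y(t))\end{cases}$$ is topologically conjugated to the linear system.
   Context: $|\cdot|$ denotes a vector norm or matrix norm. $n_1+n_2=n$; $A(t)$ is an $n_1\times n_1$ and $B(t)$ an $n_2\times n_2$ matrix function of $t\in\mathbb{R}$, both bounded on $\mathbb{R}$; $f:\mathbb{R}\times\mathbb{R}^{n_1}\to\mathbb{R}^{n_1}$, $g:\mathbb{R}\times\mathbb{R}^{n_1}\to\mathbb{R}^{n_2}$, $\phi:\mathbb{R}\times\mathbb{R}^{n_2}\to\mathbb{R}^{n_1}$, $\psi:\mathbb{R}\times\mathbb{R}^{n_2}\to\mathbb{R}^{n_2}$; coefficients and nonlinear terms are locally integrable in $t$. $\lambda>0$ and $\delta>0$ are constants, and $\omega>0$ is a constant such that $f,g,\phi,\psi$ are Lipschitz in their second variable with constant $\omega$, uniformly in $t$. $\alpha$-exponential dichotomy: let $Z(t,s)$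 be the ($n\times n$, block diagonal) transition matrix of the linear system $x'=A(t)x$, $y'=B(t)y$. The linear system has an $\alpha$-exponential dichotomy on $\mathbb{R}$ if there are a projection $P$ and constants $K\ge1$, $\alpha>0$ such that $|Z_P(t,s)|\le Ke^{-\alpha|t-s|}$ for all $t,s\in\mathbb{R}$, where $Z_P(t,s)=Z(t,0)PZ(0,s)$ if $t\ge s$ and $Z_P(t,s)=-Z(t,0)(I-P)Z(0,s)$ if $s>t$. Topological conjugacy of systems (I) and (II) on $\mathbb{R}^n$: there is a continuous $H:\mathbb{R}\times\mathbb{R}^n\to\mathbb{R}^n$ such that (i) for each $t$, $H(t,\cdot)$ is a homeomorphism of $\mathbb{R}^n$; (ii) $H(t,z)\to\infty$ as $z\to\infty$ uniformly with respect to $t$; (iii) if $z(t)$ is a solution of (I) then $H(t,z(t))$ is a solution of (II); and the inverse $L(t,\cdot)=H(t,\cdot)^{-1}$ also has properties (i)–(iii), with the roles of (I) and (II) exchanged. *)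

theory Defs
  imports "HOL-Analysis.Analysis"
begin

text \<open>
  The space of pairs \<open>z = (x, y)\<close> is \<open>real^('n1 + 'n2)\<close>, so that the dimensions add up and
  operators on it are genuine \<open>n \<times> n\<close> matrices, where \<open>n = n1 + n2\<close>.
\<close>

definition join :: "real^'n1 \<Rightarrow> real^'n2 \<Rightarrow> real^('n1::finite + 'n2::finite)" where
  "join x y = (\<chi> i. case i of Inl a \<Rightarrow> x $ a | Inr b \<Rightarrow> y $ b)"

definition xpart :: "real^('n1::finite + 'n2::finite) \<Rightarrow> real^'n1" where
  "xpart z = (\<chi> a. z $ Inl a)"

definition ypart :: "real^('n1::finite + 'n2::finite) \<Rightarrow> real^'n2" where
  "ypart z = (\<chi> b. z $ Inr b)"

lemma xpart_join [simp]: "xpart (join x y) = x"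
  and ypart_join [simp]: "ypart (join x y) = y"
  and join_parts [simp]: "join (xpart z) (ypart z) = z"
  by (auto simp: join_def xpart_def ypart_def vec_eq_iff split: sum.split)

definition is_norm :: "('a::real_vector \<Rightarrow> real) \<Rightarrow> bool" where
  "is_norm N \<longleftrightarrow>
     (\<forall>v. N v \<ge> 0) \<and> (\<forall>v. N v = 0 \<longleftrightarrow> v = 0) \<and>
     (\<forall>c v. N (c *\<^sub>R v) = \<bar>c\<bar> * N v) \<and> (\<forall>v w. N (v + w) \<le> N v + N w)"

text \<open>
  The vector norms are arbitrary, not necessarily Euclidean. Those of the two component spaces
  are the restrictions of the norm of the whole space, and the matrix norm is consistent with
  the latter, as the induced operator norm is.
\<close>

definition compatible_norms ::
  "(real^'n1 \<Rightarrow> real) \<Rightarrow> (real^'n2 \<Rightarrow> real) \<Rightarrow> (real^('n1::finite + 'n2::finite) \<Rightarrow> real) \<Rightarrow>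
   (real^('n1 + 'n2)^('n1 + 'n2) \<Rightarrow> real) \<Rightarrow> bool" where
  "compatible_norms Nx Ny N M \<longleftrightarrow>
     is_norm Nx \<and> is_norm Ny \<and> is_norm N \<and> is_norm M \<and>
     (\<forall>x. N (join x 0) = Nx x) \<and> (\<forall>y. N (join 0 y) = Ny y) \<and>
     (\<forall>T z. N (T *v z) \<le> M T * N z)"

definition locally_integrable :: "(real \<Rightarrow> 'a::euclidean_space) \<Rightarrow> bool" where
  "locally_integrable u \<longleftrightarrow> (\<forall>a b. u absolutely_integrable_on {a..b})"

text \<open>
  As the right-hand sides are only locally integrable in time, solutions of \<open>z' = F(t, z)\<close> are
  understood in the Caratheodory sense, i.e. they solve the Lebesgue integral equation.
\<close>

definition solution :: "(real \<Rightarrow> 'a \<Rightarrow> 'a) \<Rightarrow> (real \<Rightarrow> 'a::euclidean_space) \<Rightarrow> bool" where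
  "solution F z \<longleftrightarrow>
     locally_integrable (\<lambda>s. F s (z s)) \<and>
     (\<forall>a b. a \<le> b \<longrightarrow> z b = z a + integral {a..b} (\<lambda>s. F s (z s)))"

definition linear_system ::
  "(real \<Rightarrow> real^'n1^'n1) \<Rightarrow> (real \<Rightarrow> real^'n2^'n2) \<Rightarrow>
   real \<Rightarrow> real^('n1::finite + 'n2::finite) \<Rightarrow> real^('n1 + 'n2)" where
  "linear_system A B t z = join (A t *v xpart z) (B t *v ypart z)"

definition perturbed_system ::
  "(real \<Rightarrow> real^'n1^'n1) \<Rightarrow> (real \<Rightarrow> real^'n2^'n2) \<Rightarrow>
   (real \<Rightarrow> real^'n1 \<Rightarrow> real^'n1) \<Rightarrow> (real \<Rightarrow> real^'n1 \<Rightarrow> real^'n2) \<Rightarrow>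
   (real \<Rightarrow> real^'n2 \<Rightarrow> real^'n1) \<Rightarrow> (real \<Rightarrow> real^'n2 \<Rightarrow> real^'n2) \<Rightarrow>
   real \<Rightarrow> real^('n1::finite + 'n2::finite) \<Rightarrow> real^('n1 + 'n2)" where
  "perturbed_system A B f g \<phi> \<psi> t z =
     join (A t *v xpart z + f t (xpart z) + \<phi> t (ypart z))
          (B t *v ypart z + g t (xpart z) + \<psi> t (ypart z))"

definition transition_matrix ::
  "(real \<Rightarrow> real^'n \<Rightarrow> real^'n) \<Rightarrow> (real \<Rightarrow> real \<Rightarrow> real^'n^'n::finite) \<Rightarrow> bool" where
  "transition_matrix F Z \<longleftrightarrow>
     (\<forall>s. Z s s = mat 1 \<and> (\<forall>v. solution F (\<lambda>t. Z t s *v v)))"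

definition dichotomy_kernel ::
  "(real \<Rightarrow> real \<Rightarrow> real^'n^'n::finite) \<Rightarrow> real^'n^'n \<Rightarrow> real \<Rightarrow> real \<Rightarrow> real^'n^'n" where
  "dichotomy_kernel Z P t s =
     (if t \<ge> s then Z t 0 ** P ** Z 0 s else - (Z t 0 ** (mat 1 - P) ** Z 0 s))"

text \<open>The argument \<open>M\<close> is the matrix norm, and \<open>F\<close> the right-hand side of a linear system.\<close>

definition exponential_dichotomy ::
  "(real^'n^'n \<Rightarrow> real) \<Rightarrow> (real \<Rightarrow> real^'n \<Rightarrow> real^'n::finite) \<Rightarrow> real \<Rightarrow> real \<Rightarrow> bool" where
  "exponential_dichotomy M F K \<alpha> \<longleftrightarrow>
     K \<ge> 1 \<and> \<alpha> > 0 \<and>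
     (\<exists>Z P. transition_matrix F Z \<and> P ** P = P \<and>
        (\<forall>t s. M (dichotomy_kernel Z P t s) \<le> K * exp (- \<alpha> * \<bar>t - s\<bar>)))"

definition uniformly_proper :: "(real \<Rightarrow> 'a \<Rightarrow> 'a::euclidean_space) \<Rightarrow> bool" where
  "uniformly_proper H \<longleftrightarrow> (\<forall>R. \<exists>r. \<forall>t z. norm z \<ge> r \<longrightarrow> norm (H t z) \<ge> R)"

definition maps_solutions ::
  "(real \<Rightarrow> 'a \<Rightarrow> 'a) \<Rightarrow> (real \<Rightarrow> 'a \<Rightarrow> 'a) \<Rightarrow> (real \<Rightarrow> 'a \<Rightarrow> 'a::euclidean_space) \<Rightarrow> bool" where
  "maps_solutions F G H \<longleftrightarrow> (\<forall>z. solution F z \<longrightarrow> solution G (\<lambda>t. H t (z t)))"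

text \<open>
  \<open>homeomorphism\<close> says that \<open>H t\<close> and \<open>L t\<close> are mutually inverse and both continuous, which
  makes each of them a homeomorphism of the whole space.
\<close>

definition topologically_conjugate ::
  "(real \<Rightarrow> 'a \<Rightarrow> 'a) \<Rightarrow> (real \<Rightarrow> 'a \<Rightarrow> 'a::euclidean_space) \<Rightarrow> bool" where
  "topologically_conjugate F G \<longleftrightarrow>
     (\<exists>H L. continuous_on UNIV (\<lambda>(t, z). H t z) \<and>
        (\<forall>t. homeomorphism UNIV UNIV (H t) (L t)) \<and>
        uniformly_proper H \<and> maps_solutions F G H \<and>
        uniformly_proper L \<and> maps_solutions G F L)"

end

theory Submission
  imports Defs
begin

text \<open>
  Solutions are mapped to solutions by any homeomorphism of the initial values at time 0, transported
  along the two flows; the point is to choose it so that it is proper uniformly in time. As \<open>f\<close> and \<open>g\<close> grow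
  linearly, solutions of the two systems cannot in general be matched at bounded distance. This
  can be done whenever the difference of two nonlinear terms is bounded, and the proof reduces the
  problem to such cases.

  The main tool is a bound for solutions of \<open>w' = C(t) w + r(t)\<close> that are bounded on the whole line, with
  exponential weights and possibly a jump (\<open>a_priori\<close>), and the existence of bounded
  solutions for small Lipschitz nonlinearities (\<open>nonlinear_bounded_exists\<close>). They yield a shadowing
  principle: for a solution \<open>p\<close> in the future and a solution \<open>m\<close> in the past, there is exactly one solution
  \<open>q\<close> at bounded distance from both, even if the three belong to different equations with bounded difference
  (\<open>shadow_exists\<close>, \<open>shadow_estimate\<close>, \<open>shadow_tendsto\<close>).

  With \<open>\<phi>\<close> and \<open>\<psi>\<close> omitted, zero is an equilibrium. By shadowing, each solution of the full system is encoded
  by a pair of solutions of this reduced system, one bounded in the future and one bounded in the past. In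
  the same way, each solution of the linear system is encoded by such a pair for the reduced system with its
  nonlinearity retracted to the unit ball, for the retraction makes the nonlinearity bounded.
  The reduced and the retracted system agree in the unit ball, and there the half-bounded solutions arrive
  after a time that depends only on their size (\<open>glue_decay\<close>). So pairs for one system
  correspond to pairs for the other by eventual equality. The composition of these correspondences
  is the conjugacy (\<open>topologically_conjugate_fields\<close>).

  All Lipschitz constants are measured in the sum of the norms of the two components. The dichotomy
  keeps its constants in this norm because its projection is block diagonal (\<open>projection_commutes\<close>).
\<close>

section \<open>Arbitrary norms on a Euclidean space\<close>

context
  fixes S :: "'a::euclidean_space \<Rightarrow> real"
  assumes S: "is_norm S"
begin

lemma is_norm_nonneg: "S v \<ge> 0"
  and is_norm_eq_0: "S v = 0 \<longleftrightarrow> v = 0"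
  and is_norm_scaleR: "S (c *\<^sub>R v) = \<bar>c\<bar> * S v"
  and is_norm_triangle: "S (v + w) \<le> S v + S w"
  using S unfolding is_norm_def by auto

lemma is_norm_zero: "S 0 = 0"
  by (simp add: is_norm_eq_0)

lemma is_norm_minus: "S (- v) = S v"
  using is_norm_scaleR[of "-1" v] by simp

lemma is_norm_commute: "S (v - w) = S (w - v)"
  using is_norm_minus[of "v - w"] by simp

lemma is_norm_diff: "S (v - w) \<le> S v + S w"
  using is_norm_triangle[of v "- w"] by (simp add: is_norm_minus)

lemma is_norm_le_norm: "\<exists>c > 0. \<forall>v. S v \<le> c * norm v"
proof (intro exI conjI allI)
  show "0 < 1 + (\<Sum>b\<in>Basis. S b)"
    using sum_nonneg[of Basis S] is_norm_nonneg by (simp add: add_pos_nonneg)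
  fix v
  have sum_le: "S (\<Sum>b\<in>A. g b) \<le> (\<Sum>b\<in>A. S (g b))" if "finite A" for A and g :: "'a \<Rightarrow> 'a"
    using that
    by (induction A) (auto simp: is_norm_zero intro: order_trans[OF is_norm_triangle])
  have "S v = S (\<Sum>b\<in>Basis. (v \<bullet> b) *\<^sub>R b)"
    by (simp add: euclidean_representation)
  also have "\<dots> \<le> (\<Sum>b\<in>Basis. \<bar>v \<bullet> b\<bar> * S b)"
    using sum_le[of Basis "\<lambda>b. (v \<bullet> b) *\<^sub>R b"] by (simp add: is_norm_scaleR)
  also have "\<dots> \<le> (\<Sum>b\<in>Basis. norm v * S b)"
    by (intro sum_mono mult_right_mono) (auto simp: Basis_le_norm is_norm_nonneg)
  also have "\<dots> \<le> (1 + (\<Sum>b\<in>Basis. S b)) * norm v"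
    by (simp add: sum_distrib_left[symmetric] algebra_simps)
  finally show "S v \<le> (1 + (\<Sum>b\<in>Basis. S b)) * norm v" .
qed

lemma is_norm_continuous: "continuous_on A S"
proof -
  obtain c where c: "c > 0" "\<And>v. S v \<le> c * norm v"
    using is_norm_le_norm by blast
  have "\<bar>S v - S w\<bar> \<le> c * norm (v - w)" for v w
    using is_norm_triangle[of "v - w" w] is_norm_triangle[of "w - v" v] c(2)[of "v - w"]
      is_norm_commute[of v w]
    by (auto simp: abs_le_iff)
  then have "c-lipschitz_on A S"
    using c(1) by (intro lipschitz_onI) (auto simp: dist_norm)
  then show ?thesis
    by (rule lipschitz_on_continuous_on)
qed

lemma norm_le_is_norm: "\<exists>c > 0. \<forall>v. norm v \<le> c * S v"
proof -
  obtain u :: 'a where u: "norm u = 1"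
    using vector_choose_size[of 1] by auto
  have "\<exists>x\<in>sphere 0 1. \<forall>y\<in>sphere 0 1. S x \<le> S y"
    using u by (intro continuous_attains_inf is_norm_continuous) (auto simp: compact_sphere)
  then obtain x where x: "norm x = 1" "\<And>y. norm y = 1 \<Longrightarrow> S x \<le> S y"
    by auto
  have pos: "S x > 0"
    using x(1) is_norm_nonneg[of x] is_norm_eq_0[of x] by fastforce
  have "norm v \<le> (1 / S x) * S v" for v
  proof (cases "v = 0")
    case False
    have "S x \<le> S ((1 / norm v) *\<^sub>R v)"
      using False by (intro x(2)) simp
    also have "\<dots> = S v / norm v"
      by (simp add: is_norm_scaleR)
    finally show ?thesis
      using False pos by (simp add: field_simps)
  qed (simp add: is_norm_zero)
  then show ?thesis
    using pos by (intro exI[of _ "1 / S x"]) auto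
qed

text \<open>
  A vector outside a ball is separated from it by a linear functional, and linear functionals
  pass under the integral. Going through an equivalent Euclidean norm instead would cost a
  constant factor, which the smallness condition on the Lipschitz constants does not afford.
\<close>

lemma is_norm_integral_le:
  fixes v :: "'b::euclidean_space \<Rightarrow> 'a"
  assumes v: "v integrable_on A" and e: "e integrable_on A"
    and le: "\<And>s. s \<in> A \<Longrightarrow> S (v s) \<le> e s"
  shows "S (integral A v) \<le> integral A e"
proof (rule ccontr)
  define I J where "I = integral A v" and "J = integral A e"
  assume "\<not> ?thesis"
  then have lt: "J < S I"
    by (simp add: I_def J_def)
  have J0: "J \<ge> 0"
    unfolding J_def using le is_norm_nonneg by (intro integral_nonneg e) (meson order_trans)
  \<comment> \<open>a radius strictly between, so that the ball is a neighbourhood of 0 even if the integral of e vanishes\<close>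
  define J' where "J' = (J + S I) / 2"
  have J': "J' > 0" "J < J'" "J' < S I"
    using lt J0 by (auto simp: J'_def)
  define B where "B = {z. S z \<le> J'}"
  have "convex B"
    unfolding B_def convex_def
  proof (intro ballI allI impI CollectI)
    fix x y and a b :: real
    assume xy: "x \<in> {z. S z \<le> J'}" "y \<in> {z. S z \<le> J'}" and ab: "a \<ge> 0" "b \<ge> 0" "a + b = 1"
    have "S (a *\<^sub>R x + b *\<^sub>R y) \<le> a * S x + b * S y"
      using is_norm_triangle[of "a *\<^sub>R x" "b *\<^sub>R y"] ab by (simp add: is_norm_scaleR)
    also have "\<dots> \<le> a * J' + b * J'"
      using xy ab by (intro add_mono mult_left_mono) auto
    finally show "S (a *\<^sub>R x + b *\<^sub>R y) \<le> J'"
      using ab by (simp add: distrib_right[symmetric])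
  qed
  moreover have "closed B"
    unfolding B_def by (intro closed_Collect_le is_norm_continuous continuous_on_const)
  moreover have zero: "0 \<in> B"
    using J' by (simp add: B_def is_norm_zero)
  moreover have "I \<notin> B"
    using J' by (simp add: B_def)
  ultimately obtain a b where ab: "a \<bullet> I < b" "\<And>x. x \<in> B \<Longrightarrow> a \<bullet> x \<ge> b"
    using supporting_hyperplane_closed_point[of B I] by blast
  have b0: "b \<le> 0"
    using ab(2)[OF zero] by simp
  have lower: "a \<bullet> z \<ge> b / J' * S z" for z
  proof (cases "z = 0")
    case False
    then have "S z > 0"
      using is_norm_nonneg[of z] is_norm_eq_0[of z] by linarith
    moreover have "(J' / S z) *\<^sub>R z \<in> B"
      using \<open>S z > 0\<close> J' by (simp add: B_def is_norm_scaleR)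
    then have "b \<le> (J' / S z) * (a \<bullet> z)"
      using ab(2) by fastforce
    ultimately show ?thesis
      using J' by (simp add: field_simps)
  qed (simp add: is_norm_zero)
  have "b / J' * J = integral A (\<lambda>s. b / J' * e s)"
    using e by (simp add: J_def)
  also have "\<dots> \<le> integral A (\<lambda>s. a \<bullet> v s)"
  proof (rule integral_le)
    show "(\<lambda>s. b / J' * e s) integrable_on A"
      using e by (rule integrable_on_mult_right)
    show "(\<lambda>s. a \<bullet> v s) integrable_on A"
      using integrable_linear[OF v bounded_linear_inner_right[of a]] by (simp add: o_def)
    fix s assume "s \<in> A"
    then have "b / J' * e s \<le> b / J' * S (v s)"
      using le b0 J' by (intro mult_left_mono_neg) (auto simp: divide_nonpos_pos)
    also have "\<dots> \<le> a \<bullet> v s"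
      by (rule lower)
    finally show "b / J' * e s \<le> a \<bullet> v s" .
  qed
  also have "\<dots> = a \<bullet> I"
    using integral_linear[OF v bounded_linear_inner_right[of a]] by (simp add: o_def I_def)
  also have "\<dots> < b"
    by (rule ab(1))
  finally have "b / J' * J < b" .
  moreover have "b / J' * J \<ge> b"
    using b0 J' J0 mult_left_mono_neg[of J J' b] by (simp add: field_simps)
  ultimately show False
    by simp
qed

end

section \<open>Caratheodory equations with a Lipschitz right-hand side\<close>

text \<open>
  Along a simple function the composition is piecewise a section \<open>F t z\<close> with fixed \<open>z\<close>; the
  general case is a pointwise limit of this one, by continuity in \<open>z\<close>.
\<close>

lemma borel_measurable_Caratheodory:
  fixes F :: "'c \<Rightarrow> 'a::{metric_space,second_countable_topology} \<Rightarrow> 'b::metric_space"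
  assumes meas: "\<And>z. (\<lambda>t. F t z) \<in> borel_measurable M"
    and cont: "\<And>t. continuous_on UNIV (F t)"
    and b: "b \<in> borel_measurable M"
  shows "(\<lambda>t. F t (b t)) \<in> borel_measurable M"
proof -
  obtain u where u: "\<And>i. simple_function M (u i)" "\<And>x. x \<in> space M \<Longrightarrow> (\<lambda>i. u i x) \<longlonglongrightarrow> b x"
    using borel_measurable_implies_sequence_metric[OF b] by blast
  show ?thesis
  proof (rule borel_measurable_LIMSEQ_metric)
    show "(\<lambda>t. F t (u i t)) \<in> borel_measurable M" for i
    proof (rule measurable_compose_countable'[where I = "u i ` space M" and f = "\<lambda>z t. F t z"])
      show "u i \<in> measurable M (count_space (u i ` space M))"
        using u(1)[of i]
        by (subst measurable_count_space_eq2) (auto simp: simple_function_def)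
      show "countable (u i ` space M)"
        using u(1)[of i] by (simp add: simple_function_def countable_finite)
    qed (rule meas)
    fix x assume "x \<in> space M"
    then show "(\<lambda>i. F x (u i x)) \<longlonglongrightarrow> F x (b x)"
      using cont[of x] u(2)[of x] continuous_on_tendsto_compose[of UNIV "F x"] by auto
  qed
qed

text \<open>
  Local boundedness is stronger than local integrability. It holds for all inhomogeneities that
  occur below, and makes their primitives locally Lipschitz.
\<close>

definition forcing :: "(real \<Rightarrow> 'a::euclidean_space) \<Rightarrow> bool" where
  "forcing r \<longleftrightarrow> r \<in> borel_measurable lebesgue \<and> (\<forall>R. \<exists>M. \<forall>s. \<bar>s\<bar> \<le> R \<longrightarrow> norm (r s) \<le> M)"

lemma forcing_bound:
  assumes "forcing r"
  obtains M where "M \<ge> 0" "\<And>s. \<bar>s\<bar> \<le> R \<Longrightarrow> norm (r s) \<le> M"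
proof -
  obtain M where M: "\<And>s. \<bar>s\<bar> \<le> R \<Longrightarrow> norm (r s) \<le> M"
    using assms unfolding forcing_def by blast
  show ?thesis
    using M by (intro that[of "max M 0"]) (auto intro: le_max_iff_disj[THEN iffD2])
qed

lemma forcing_locally_integrable:
  assumes "forcing r"
  shows "locally_integrable r"
  unfolding locally_integrable_def
proof (intro allI)
  fix a b :: real
  obtain M where M: "\<And>s. \<bar>s\<bar> \<le> max \<bar>a\<bar> \<bar>b\<bar> \<Longrightarrow> norm (r s) \<le> M"
    using forcing_bound[OF assms] by blast
  show "r absolutely_integrable_on {a..b}"
  proof (rule measurable_bounded_by_integrable_imp_absolutely_integrable[where g = "\<lambda>_. M"])
    show "r \<in> borel_measurable (lebesgue_on {a..b})"
      using assms by (simp add: forcing_def measurable_restrict_space1)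
    show "norm (r x) \<le> M" if "x \<in> {a..b}" for x
      using that by (intro M) auto
  qed (simp_all add: integrable_on_const)
qed

lemma locally_integrable_imp_integrable:
  "locally_integrable r \<Longrightarrow> r integrable_on {a..b}"
  unfolding locally_integrable_def using absolutely_integrable_on_def by blast

lemma forcing_integrable: "forcing r \<Longrightarrow> r integrable_on {a..b}"
  by (intro locally_integrable_imp_integrable forcing_locally_integrable)

lemma locally_integrable_imp_borel_measurable:
  assumes "locally_integrable r"
  shows "r \<in> borel_measurable lebesgue"
proof (rule borel_measurable_LIMSEQ_metric)
  show "(\<lambda>x. indicator {- real n..real n} x *\<^sub>R r x) \<in> borel_measurable lebesgue" for n
    using assms unfolding locally_integrable_def set_integrable_def
    by (meson borel_measurable_integrable)
  fix x :: real
  have "\<forall>\<^sub>F n in sequentially. real n \<ge> \<bar>x\<bar>"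
    by (meson eventually_sequentiallyI of_nat_le_iff order_trans real_nat_ceiling_ge)
  then have "\<forall>\<^sub>F n in sequentially. indicator {- real n..real n} x *\<^sub>R r x = r x"
    by eventually_elim (auto simp: indicator_def)
  then show "(\<lambda>n. indicator {- real n..real n} x *\<^sub>R r x) \<longlonglongrightarrow> r x"
    by (rule tendsto_eventually)
qed

lemma forcing_add: "forcing p \<Longrightarrow> forcing q \<Longrightarrow> forcing (\<lambda>s. p s + q s)"
  unfolding forcing_def
proof (intro conjI allI; (elim conjE)?)
  fix R
  assume "\<forall>R. \<exists>M. \<forall>s. \<bar>s\<bar> \<le> R \<longrightarrow> norm (p s) \<le> M" "\<forall>R. \<exists>M. \<forall>s. \<bar>s\<bar> \<le> R \<longrightarrow> norm (q s) \<le> M"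
  then obtain M N where "\<forall>s. \<bar>s\<bar> \<le> R \<longrightarrow> norm (p s) \<le> M" "\<forall>s. \<bar>s\<bar> \<le> R \<longrightarrow> norm (q s) \<le> N"
    by meson
  then show "\<exists>M. \<forall>s. \<bar>s\<bar> \<le> R \<longrightarrow> norm (p s + q s) \<le> M"
    by (intro exI[of _ "M + N"]) (meson add_mono norm_triangle_le)
qed simp

lemma forcing_minus: "forcing p \<Longrightarrow> forcing (\<lambda>s. - p s)"
  unfolding forcing_def by simp

lemma forcing_diff: "forcing p \<Longrightarrow> forcing q \<Longrightarrow> forcing (\<lambda>s. p s - q s)"
  using forcing_add[of p "\<lambda>s. - q s"] forcing_minus[of q] by simp

lemma forcing_continuous:
  assumes "continuous_on UNIV z"
  shows "forcing z"
  unfolding forcing_def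
proof (intro conjI allI)
  show "z \<in> borel_measurable lebesgue"
    using assms by (simp add: borel_measurable_continuous_onI measurable_completion)
  fix R :: real
  have "compact (z ` {-R..R})"
    using assms by (intro compact_continuous_image) (auto intro: continuous_on_subset)
  then obtain M where "\<forall>x\<in>z ` {-R..R}. norm x \<le> M"
    using compact_imp_bounded bounded_iff by metis
  then show "\<exists>M. \<forall>s. \<bar>s\<bar> \<le> R \<longrightarrow> norm (z s) \<le> M"
    by (intro exI[of _ M]) (auto simp: abs_le_iff)
qed

lemma forcing_if:
  assumes "forcing p" "forcing q"
  shows "forcing (\<lambda>s. if s \<ge> (\<tau>::real) then p s else q s)"
  unfolding forcing_def
proof (intro conjI allI)
  show "(\<lambda>s. if s \<ge> \<tau> then p s else q s) \<in> borel_measurable lebesgue"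
  proof (rule measurable_If)
    have "{\<tau>..} \<in> sets lebesgue"
      by simp
    then show "{x \<in> space lebesgue. \<tau> \<le> x} \<in> sets lebesgue"
      by (simp add: atLeast_def)
    show "p \<in> borel_measurable lebesgue" "q \<in> borel_measurable lebesgue"
      using assms by (simp_all add: forcing_def)
  qed
  fix R
  obtain M where "\<And>s. \<bar>s\<bar> \<le> R \<Longrightarrow> norm (p s) \<le> M"
    using forcing_bound[OF assms(1)] by blast
  moreover obtain N where "\<And>s. \<bar>s\<bar> \<le> R \<Longrightarrow> norm (q s) \<le> N"
    using forcing_bound[OF assms(2)] by blast
  ultimately show "\<exists>M. \<forall>s. \<bar>s\<bar> \<le> R \<longrightarrow> norm (if s \<ge> \<tau> then p s else q s) \<le> M"
    by (intro exI[of _ "max M N"]) (auto simp: le_max_iff_disj)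
qed

text \<open>
  The uniform Lipschitz constant makes all solutions global, with at most exponential growth. The
  bound on the zero section serves the contraction argument for existence, which takes place in
  an exponentially weighted space.
\<close>

definition caratheodory :: "(real \<Rightarrow> 'a \<Rightarrow> 'a::euclidean_space) \<Rightarrow> real \<Rightarrow> bool" where
  "caratheodory F \<Lambda> \<longleftrightarrow>
     \<Lambda> > 0 \<and> (\<forall>z. (\<lambda>t. F t z) \<in> borel_measurable lebesgue) \<and>
     (\<forall>t z z'. norm (F t z - F t z') \<le> \<Lambda> * norm (z - z')) \<and>
     (\<exists>c. \<forall>t. norm (F t 0) \<le> c)"

lemma caratheodory_forcing:
  assumes F: "caratheodory F \<Lambda>" and b: "forcing b"
  shows "forcing (\<lambda>t. F t (b t))"
  unfolding forcing_def
proof (intro conjI allI)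
  have lip: "\<And>t z z'. norm (F t z - F t z') \<le> \<Lambda> * norm (z - z')" and "\<Lambda> > 0"
    and meas: "\<And>z. (\<lambda>t. F t z) \<in> borel_measurable lebesgue"
    using F by (auto simp: caratheodory_def)
  obtain c where c: "\<And>t. norm (F t 0) \<le> c"
    using F unfolding caratheodory_def by blast
  have "\<Lambda>-lipschitz_on UNIV (F t)" for t
    using lip \<open>\<Lambda> > 0\<close> by (intro lipschitz_onI) (auto simp: dist_norm)
  then show "(\<lambda>t. F t (b t)) \<in> borel_measurable lebesgue"
    using b meas by (intro borel_measurable_Caratheodory[where F = F and b = b])
      (auto simp: forcing_def intro: lipschitz_on_continuous_on)
  fix R
  obtain M where M: "\<And>s. \<bar>s\<bar> \<le> R \<Longrightarrow> norm (b s) \<le> M"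
    using forcing_bound[OF b] by blast
  have "norm (F s (b s)) \<le> \<Lambda> * M + c" if "\<bar>s\<bar> \<le> R" for s
  proof -
    have "norm (F s (b s)) \<le> norm (F s (b s) - F s 0) + norm (F s 0)"
      using norm_triangle_ineq[of "F s (b s) - F s 0" "F s 0"] by simp
    also have "\<dots> \<le> \<Lambda> * norm (b s) + c"
      using lip[of s "b s" 0] c[of s] by simp
    also have "\<dots> \<le> \<Lambda> * M + c"
      using M[OF that] \<open>\<Lambda> > 0\<close> by simp
    finally show ?thesis .
  qed
  then show "\<exists>M. \<forall>s. \<bar>s\<bar> \<le> R \<longrightarrow> norm (F s (b s)) \<le> M"
    by blast
qed

lemma continuous_on_UNIV_if_intervals:
  fixes z :: "real \<Rightarrow> 'a::topological_space"
  assumes "\<And>n::nat. continuous_on {- real n..real n} z"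
  shows "continuous_on UNIV z"
proof -
  have "continuous_on (\<Union>n::nat. {- real n<..<real n}) z"
  proof (intro continuous_on_open_UN ballI open_greaterThanLessThan)
    show "continuous_on {- real n<..<real n} z" for n
      by (rule continuous_on_subset[OF assms[of n]]) auto
  qed
  moreover have "(\<Union>n::nat. {- real n<..<real n}) = UNIV"
  proof -
    have "\<exists>n::nat. - real n < x \<and> x < real n" for x :: real
      using reals_Archimedean2[of "\<bar>x\<bar>"] by (metis abs_less_iff minus_less_iff)
    then show ?thesis by auto
  qed
  ultimately show ?thesis by simp
qed

lemma integral_equation_continuous:
  fixes z :: "real \<Rightarrow> 'a::euclidean_space"
  assumes int: "\<And>a b. r integrable_on {a..b}"
    and eq: "\<And>a b. a \<le> b \<Longrightarrow> z b = z a + integral {a..b} r"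
  shows "continuous_on UNIV z"
proof (rule continuous_on_UNIV_if_intervals)
  fix n :: nat
  have "continuous_on {- real n..real n} (\<lambda>x. z (- real n) + integral {- real n..x} r)"
    by (intro continuous_intros indefinite_integral_continuous_1 int)
  then show "continuous_on {- real n..real n} z"
    using eq by (subst continuous_on_cong[OF refl, where g = "\<lambda>x. z (- real n) + integral {- real n..x} r"]) auto
qed

lemma solution_continuous: "solution F z \<Longrightarrow> continuous_on UNIV z"
  unfolding solution_def
  by (rule integral_equation_continuous[where r = "\<lambda>s. F s (z s)"])
    (auto intro: locally_integrable_imp_integrable)

lemma caratheodory_solution_iff:
  assumes "caratheodory F \<Lambda>"
  shows "solution F z \<longleftrightarrow>
    continuous_on UNIV z \<and> (\<forall>a b. a \<le> b \<longrightarrow> z b = z a + integral {a..b} (\<lambda>s. F s (z s)))"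
  using caratheodory_forcing[OF assms forcing_continuous] forcing_locally_integrable
    solution_continuous
  unfolding solution_def by blast

lemma continuous_on_real_norm_diff:
  "continuous_on UNIV z \<Longrightarrow> continuous_on UNIV w \<Longrightarrow>
    continuous_on A (\<lambda>t::real. norm (z t - w t :: 'a::real_normed_vector))"
  by (intro continuous_intros) (auto intro: continuous_on_subset)

lemma caratheodory_integrable:
  assumes "caratheodory F \<Lambda>" "continuous_on UNIV z"
  shows "(\<lambda>s. F s (z s)) integrable_on {a..b}"
  by (rule forcing_integrable[OF caratheodory_forcing[OF assms(1) forcing_continuous[OF assms(2)]]])

lemma is_norm_integral_exp_le:
  fixes r :: "real \<Rightarrow> 'a::euclidean_space"
  assumes S: "is_norm S" and r: "r integrable_on {a..b}" and ab: "a \<le> b" and t: "t = a \<or> t = b"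
    and g: "g > 0" and c: "c \<ge> 0"
    and le: "\<And>s. s \<in> {a..b} \<Longrightarrow> S (r s) \<le> c * exp (- g * \<bar>t - s\<bar>)"
  shows "S (integral {a..b} r) \<le> c / g"
proof -
  have "((\<lambda>s. exp (- g * \<bar>t - s\<bar>)) has_integral (1 - exp (- g * (b - a))) / g) {a..b}"
    using t
  proof
    assume "t = a"
    have "((\<lambda>s. exp (- g * (s - a))) has_integral - exp (- g * (b - a)) / g - (- exp (- g * (a - a)) / g)) {a..b}"
      using g ab by (intro fundamental_theorem_of_calculus)
        (auto intro!: derivative_eq_intros simp: has_real_derivative_iff_has_vector_derivative[symmetric])
    then show ?thesis
      using \<open>t = a\<close> by (subst has_integral_cong) (auto simp: diff_divide_distrib)
  next
    assume "t = b"
    have "((\<lambda>s. exp (- g * (b - s))) has_integral exp (- g * (b - b)) / g - exp (- g * (b - a)) / g) {a..b}"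
      using g ab by (intro fundamental_theorem_of_calculus)
        (auto intro!: derivative_eq_intros simp: has_real_derivative_iff_has_vector_derivative[symmetric])
    then show ?thesis
      using \<open>t = b\<close> by (subst has_integral_cong) (auto simp: diff_divide_distrib)
  qed
  then have int: "((\<lambda>s. c * exp (- g * \<bar>t - s\<bar>)) has_integral c * ((1 - exp (- g * (b - a))) / g)) {a..b}"
    by (rule has_integral_mult_right)
  have "S (integral {a..b} r) \<le> integral {a..b} (\<lambda>s. c * exp (- g * \<bar>t - s\<bar>))"
    using int by (intro is_norm_integral_le[OF S r] le) blast
  also have "\<dots> = c * ((1 - exp (- g * (b - a))) / g)"
    using int by (rule integral_unique)
  also have "\<dots> \<le> c * (1 / g)"
    using g c by (intro mult_left_mono divide_right_mono) auto
  finally show ?thesis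
    by simp
qed

lemma gronwall_forward:
  fixes d :: "real \<Rightarrow> real"
  assumes cont: "continuous_on {a..b} d" and "\<Lambda> > 0" and ab: "a \<le> b"
    and ineq: "\<And>t. a \<le> t \<Longrightarrow> t \<le> b \<Longrightarrow> d t \<le> d a + \<Lambda> * integral {a..t} d"
  shows "d b \<le> exp (\<Lambda> * (b - a)) * d a"
proof -
  define U where "U t = exp (- \<Lambda> * (t - a)) * (d a + \<Lambda> * integral {a..t} d)" for t
  have deriv: "(U has_real_derivative
      exp (- \<Lambda> * (t - a)) * (\<Lambda> * d t - \<Lambda> * (d a + \<Lambda> * integral {a..t} d))) (at t within {a..b})"
    if "t \<in> {a..b}" for t
  proof -
    have I: "((\<lambda>u. integral {a..u} d) has_real_derivative d t) (at t within {a..b})"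
      by (rule integral_has_real_derivative[OF cont that])
    show ?thesis
      unfolding U_def by (auto intro!: derivative_eq_intros I simp: algebra_simps)
  qed
  have "U b \<le> U a"
  proof (rule DERIV_nonpos_imp_decreasing_open[OF ab])
    show "continuous_on {a..b} U"
      using deriv by (rule DERIV_continuous_on)
    fix t assume t: "a < t" "t < b"
    have "(U has_real_derivative
      exp (- \<Lambda> * (t - a)) * (\<Lambda> * d t - \<Lambda> * (d a + \<Lambda> * integral {a..t} d))) (at t)"
      using deriv[of t] t at_within_interior[of t "{a..b}"] by simp
    moreover have "\<Lambda> * d t - \<Lambda> * (d a + \<Lambda> * integral {a..t} d) \<le> 0"
      using ineq[of t] t \<open>\<Lambda> > 0\<close> by simp
    ultimately show "\<exists>y. (U has_real_derivative y) (at t) \<and> y \<le> 0"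
      by (meson exp_ge_zero mult_nonneg_nonpos)
  qed
  then have "exp (- \<Lambda> * (b - a)) * (d a + \<Lambda> * integral {a..b} d) \<le> d a"
    by (simp add: U_def)
  then have "exp (\<Lambda> * (b - a)) * (exp (- \<Lambda> * (b - a)) * (d a + \<Lambda> * integral {a..b} d))
      \<le> exp (\<Lambda> * (b - a)) * d a"
    by (intro mult_left_mono) auto
  then have "d a + \<Lambda> * integral {a..b} d \<le> exp (\<Lambda> * (b - a)) * d a"
    by (simp add: mult.assoc[symmetric] exp_add[symmetric])
  then show ?thesis
    using ineq[of b] ab by linarith
qed

text \<open>
  The backward estimate is the forward one for the reflected function.
\<close>

lemma gronwall:
  fixes d :: "real \<Rightarrow> real"
  assumes cont: "continuous_on {a..b} d" and pos: "\<Lambda> > 0" and ab: "a \<le> b"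
    and ineq: "\<And>s t. a \<le> s \<Longrightarrow> s \<le> t \<Longrightarrow> t \<le> b \<Longrightarrow> \<bar>d t - d s\<bar> \<le> \<Lambda> * integral {s..t} d"
  shows "d b \<le> exp (\<Lambda> * (b - a)) * d a" "d a \<le> exp (\<Lambda> * (b - a)) * d b"
proof -
  show "d b \<le> exp (\<Lambda> * (b - a)) * d a"
    using ineq[of a] by (intro gronwall_forward[OF cont pos ab]) (simp_all add: abs_le_iff, smt (verit))
  have "d (- (- a)) \<le> exp (\<Lambda> * (- a - (- b))) * d (- (- b))"
  proof (rule gronwall_forward[where d = "\<lambda>t. d (- t)"])
    show "continuous_on {- b..- a} (\<lambda>t. d (- t))"
      using continuous_on_compose[where f = uminus and g = d and s = "{- b..- a}"] cont
      by (simp add: o_def continuous_on_minus)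
    fix t assume t: "- b \<le> t" "t \<le> - a"
    have "integral {- b..t} (\<lambda>s. d (- s)) = integral {- t..b} d"
      using Henstock_Kurzweil_Integration.integral_reflect_real[of b "-t" d] by simp
    then show "d (- t) \<le> d (- (- b)) + \<Lambda> * integral {- b..t} (\<lambda>s. d (- s))"
      using ineq[of "- t" b] t by (auto simp: abs_le_iff)
  qed (use ab pos in auto)
  then show "d a \<le> exp (\<Lambda> * (b - a)) * d b"
    by (simp add: algebra_simps)
qed

text \<open>
  Two equations are allowed, so that solutions of different equations can be compared on
  intervals where these agree along one of the solutions.
\<close>

lemma solution_compare:
  assumes G: "caratheodory G \<Lambda>" and z: "solution F z" and w: "solution G w" and ab: "a \<le> b"
    and eq: "\<And>t. a \<le> t \<Longrightarrow> t \<le> b \<Longrightarrow> F t (z t) = G t (z t)"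
  shows "norm (z b - w b) \<le> exp (\<Lambda> * (b - a)) * norm (z a - w a)"
    and "norm (z a - w a) \<le> exp (\<Lambda> * (b - a)) * norm (z b - w b)"
proof -
  have zc: "continuous_on UNIV z" and wc: "continuous_on UNIV w"
    using z w by (auto dest: solution_continuous)
  have pos: "\<Lambda> > 0" and lip: "\<And>t z z'. norm (G t z - G t z') \<le> \<Lambda> * norm (z - z')"
    using G by (auto simp: caratheodory_def)
  have "\<bar>norm (z t - w t) - norm (z s - w s)\<bar> \<le> \<Lambda> * integral {s..t} (\<lambda>r. norm (z r - w r))"
    if st: "a \<le> s" "s \<le> t" "t \<le> b" for s t
  proof -
    have int: "(\<lambda>r. G r (z r)) integrable_on {s..t}" "(\<lambda>r. G r (w r)) integrable_on {s..t}"
      using caratheodory_integrable[OF G zc] caratheodory_integrable[OF G wc] by simp_all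
    have "integral {s..t} (\<lambda>r. F r (z r)) = integral {s..t} (\<lambda>r. G r (z r))"
      using st eq by (intro Henstock_Kurzweil_Integration.integral_cong) auto
    then have "z t = z s + integral {s..t} (\<lambda>r. G r (z r))"
      using z st by (simp add: solution_def)
    moreover have "w t = w s + integral {s..t} (\<lambda>r. G r (w r))"
      using w st by (auto simp: solution_def)
    ultimately have "(z t - w t) - (z s - w s) = integral {s..t} (\<lambda>r. G r (z r) - G r (w r))"
      using int by (simp add: Henstock_Kurzweil_Integration.integral_diff)
    also have "norm \<dots> \<le> integral {s..t} (\<lambda>r. \<Lambda> * norm (z r - w r))"
    proof (rule Henstock_Kurzweil_Integration.integral_norm_bound_integral)
      show "(\<lambda>r. G r (z r) - G r (w r)) integrable_on {s..t}"
        using int by (rule integrable_diff)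
      show "(\<lambda>r. \<Lambda> * norm (z r - w r)) integrable_on {s..t}"
        using continuous_on_real_norm_diff[OF zc wc]
        by (intro integrable_continuous_real continuous_on_mult_left)
    qed (rule lip)
    finally show ?thesis
      using norm_triangle_ineq3[of "z t - w t" "z s - w s"] by simp
  qed
  then show "norm (z b - w b) \<le> exp (\<Lambda> * (b - a)) * norm (z a - w a)"
    "norm (z a - w a) \<le> exp (\<Lambda> * (b - a)) * norm (z b - w b)"
    using gronwall[where d = "\<lambda>t. norm (z t - w t)" and a = a and b = b and \<Lambda> = \<Lambda>]
      continuous_on_real_norm_diff[OF zc wc] pos ab by auto
qed

lemma solution_diff_le:
  assumes "caratheodory F \<Lambda>" "solution F z" "solution F w"
  shows "norm (z t - w t) \<le> exp (\<Lambda> * \<bar>t - s\<bar>) * norm (z s - w s)"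
  using solution_compare[OF assms, of s t] solution_compare[OF assms, of t s]
  by (cases "s \<le> t") auto

lemma solution_unique:
  assumes "caratheodory F \<Lambda>" "solution F z" "solution F w" "z s = w s"
  shows "z = w"
  using solution_diff_le[OF assms(1-3), of _ s] assms(4) by auto

text \<open>
  One of the two integrals is over a null set, so both orders of \<open>\<tau>\<close> and \<open>t\<close> are covered without a case
  distinction.
\<close>

definition oriented_integral :: "real \<Rightarrow> real \<Rightarrow> (real \<Rightarrow> 'a::euclidean_space) \<Rightarrow> 'a" where
  "oriented_integral \<tau> t r = integral {\<tau>..t} r - integral {t..\<tau>} r"

lemma oriented_integral_simps:
  "\<tau> \<le> t \<Longrightarrow> oriented_integral \<tau> t r = integral {\<tau>..t} r"
  "t \<le> \<tau> \<Longrightarrow> oriented_integral \<tau> t r = - integral {t..\<tau>} r"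
  by (cases "\<tau> = t"; simp add: oriented_integral_def)+

lemma oriented_integral_diff:
  assumes int: "\<And>a b. r integrable_on {a..b}" and "a \<le> b"
  shows "oriented_integral \<tau> b r = oriented_integral \<tau> a r + integral {a..b} r"
proof -
  note combine = Henstock_Kurzweil_Integration.integral_combine[OF _ _ int]
  show ?thesis
    using combine[of a \<tau> b] combine[of \<tau> a b] combine[of a b \<tau>] \<open>a \<le> b\<close>
    by (cases "\<tau> \<le> a"; cases "\<tau> \<le> b") (auto simp: oriented_integral_simps algebra_simps)
qed

lemma oriented_integral_exp_bound:
  assumes int: "\<And>a b. r integrable_on {a..b}" and g: "g > 0" and c: "c \<ge> 0"
    and le: "\<And>s. norm (r s) \<le> c * exp (g * \<bar>s - \<tau>\<bar>)"
  shows "norm (oriented_integral \<tau> t r) \<le> c / g * exp (g * \<bar>t - \<tau>\<bar>)"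
proof -
  have norm: "is_norm (norm :: 'a \<Rightarrow> real)"
    by (simp add: is_norm_def norm_triangle_ineq)
  have *: "norm (integral {a..b} r) \<le> c * exp (g * \<bar>t - \<tau>\<bar>) / g"
    if ab: "a \<le> b" "a = t \<and> b = \<tau> \<or> a = \<tau> \<and> b = t" for a b
  proof (rule is_norm_integral_exp_le[OF norm int ab(1) _ g])
    show "t = a \<or> t = b"
      using ab by blast
    fix s assume s: "s \<in> {a..b}"
    have "exp (g * \<bar>s - \<tau>\<bar>) = exp (g * \<bar>t - \<tau>\<bar>) * exp (- g * \<bar>t - s\<bar>)"
      using ab s by (auto simp: exp_add[symmetric] algebra_simps)
    then show "norm (r s) \<le> c * exp (g * \<bar>t - \<tau>\<bar>) * exp (- g * \<bar>t - s\<bar>)"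
      using le[of s] by (simp add: mult.assoc)
  qed (use c in auto)
  show ?thesis
    using *[of \<tau> t] *[of t \<tau>] by (cases "\<tau> \<le> t") (auto simp: oriented_integral_simps)
qed

text \<open>
  After division by the weight \<open>exp (2 * \<Lambda> * \<bar>t - \<tau>\<bar>)\<close> the Picard operator halves distances in the space of
  bounded continuous functions on the whole line, so one application of the contraction principle
  gives a global solution in both time directions.
\<close>

theorem solution_exists:
  assumes F: "caratheodory F \<Lambda>"
  shows "\<exists>z. solution F z \<and> z \<tau> = \<zeta>"
proof -
  have pos: "\<Lambda> > 0" and lip: "\<And>t z z'. norm (F t z - F t z') \<le> \<Lambda> * norm (z - z')"
    using F by (auto simp: caratheodory_def)
  obtain c where c: "\<And>t. norm (F t 0) \<le> c"
    using F unfolding caratheodory_def by blast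
  define \<mu> where "\<mu> = 2 * \<Lambda>"
  have \<mu>: "\<mu> > 0"
    using pos by (simp add: \<mu>_def)
  define e where "e t = exp (\<mu> * \<bar>t - \<tau>\<bar>)" for t
  have e: "e t \<ge> 1" for t
    using \<mu> by (simp add: e_def)
  have ec: "continuous_on A e" for A
    unfolding e_def by (intro continuous_intros)
  define r where "r h s = F s (e s *\<^sub>R apply_bcontfun h s)" for h s
  have r_int: "r h integrable_on {a..b}" for h a b
    unfolding r_def
    by (rule caratheodory_integrable[OF F, of "\<lambda>s. e s *\<^sub>R apply_bcontfun h s"])
      (auto intro!: continuous_intros ec)
  have r_diff: "norm (r h s - r k s) \<le> \<Lambda> * dist h k * e s" for h k s
  proof -
    have "norm (r h s - r k s) \<le> \<Lambda> * norm (e s *\<^sub>R (h s - k s))"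
      using lip unfolding r_def by (simp add: scaleR_diff_right)
    also have "\<dots> = \<Lambda> * dist (h s) (k s) * e s"
      using e[of s] by (simp add: dist_norm)
    also have "\<dots> \<le> \<Lambda> * dist h k * e s"
      using dist_bounded[of h s k] e[of s] pos by (intro mult_right_mono mult_left_mono) auto
    finally show ?thesis .
  qed
  define T where "T h t = (1 / e t) *\<^sub>R (\<zeta> + oriented_integral \<tau> t (r h))" for h t
  have diff: "norm (oriented_integral \<tau> t (r h) - oriented_integral \<tau> t (r k)) \<le> dist h k / 2 * e t" for h k t
  proof -
    have "oriented_integral \<tau> t (r h) - oriented_integral \<tau> t (r k) = oriented_integral \<tau> t (\<lambda>s. r h s - r k s)"
      using r_int by (simp add: oriented_integral_def Henstock_Kurzweil_Integration.integral_diff)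
    also have "norm \<dots> \<le> \<Lambda> * dist h k / \<mu> * exp (\<mu> * \<bar>t - \<tau>\<bar>)"
      using pos \<mu> r_diff[of h _ k] by (intro oriented_integral_exp_bound)
        (auto simp: e_def intro: integrable_diff r_int)
    also have "\<dots> = dist h k / 2 * e t"
      using pos by (simp add: \<mu>_def e_def)
    finally show ?thesis .
  qed
  have T_cont: "T h \<in> bcontfun" for h
  proof (rule bcontfun_normI)
    have "continuous_on UNIV (\<lambda>t. oriented_integral \<tau> t (r h))"
      by (rule integral_equation_continuous[OF r_int oriented_integral_diff[OF r_int]])
    then show "continuous_on UNIV (T h)"
      unfolding T_def using e by (intro continuous_intros ec) (metis not_one_le_zero)+
    fix t
    have "norm (r 0 s) \<le> c * e s" for s
      using c[of s] e[of s] mult_left_mono[of 1 "e s" c] norm_ge_zero[of "F s 0"]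
      unfolding r_def by (simp add: zero_bcontfun.rep_eq)
    then have "norm (oriented_integral \<tau> t (r 0)) \<le> c / \<mu> * e t"
      using \<mu> order_trans[OF norm_ge_zero c[of 0]] unfolding e_def
      by (intro oriented_integral_exp_bound r_int) auto
    then have "norm (\<zeta> + oriented_integral \<tau> t (r h)) \<le> norm \<zeta> + (dist h 0 / 2 * e t + c / \<mu> * e t)"
      using diff[of t h 0] norm_triangle_ineq[of \<zeta> "oriented_integral \<tau> t (r h)"]
        norm_triangle_sub[of "oriented_integral \<tau> t (r h)" "oriented_integral \<tau> t (r 0)"] by linarith
    also have "\<dots> \<le> (norm \<zeta> + (dist h 0 / 2 + c / \<mu>)) * e t"
      using mult_left_mono[OF e[of t], of "norm \<zeta>"] by (simp add: algebra_simps)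
    finally have "norm (\<zeta> + oriented_integral \<tau> t (r h)) / e t \<le> norm \<zeta> + (dist h 0 / 2 + c / \<mu>)"
      using e[of t] by (subst pos_divide_le_eq) linarith+
    moreover have "norm (T h t) = norm (\<zeta> + oriented_integral \<tau> t (r h)) / e t"
      using e[of t] unfolding T_def by (simp del: scaleR_add_right)
    ultimately show "norm (T h t) \<le> norm \<zeta> + (dist h 0 / 2 + c / \<mu>)"
      by simp
  qed
  have "\<exists>!h. Bcontfun (T h) = h"
  proof (rule banach_fix_type[where c = "1 / 2"])
    show "\<forall>h k. dist (Bcontfun (T h)) (Bcontfun (T k)) \<le> 1 / 2 * dist h k"
    proof (intro allI dist_bound)
      fix h k t
      have "T h t - T k t = (1 / e t) *\<^sub>R (oriented_integral \<tau> t (r h) - oriented_integral \<tau> t (r k))"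
        by (simp add: T_def scaleR_diff_right[symmetric] del: scaleR_add_right)
      then have "norm (T h t - T k t) \<le> (1 / e t) * (dist h k / 2 * e t)"
        using e[of t] mult_left_mono[OF diff[of t h k], of "1 / e t"] by simp
      also have "\<dots> = 1 / 2 * dist h k"
        using e[of t] by simp
      finally show "dist (apply_bcontfun (Bcontfun (T h)) t) (apply_bcontfun (Bcontfun (T k)) t) \<le> 1 / 2 * dist h k"
        by (simp add: Bcontfun_inverse T_cont dist_norm)
    qed
  qed auto
  then obtain h where "Bcontfun (T h) = h"
    by blast
  then have h: "apply_bcontfun h t = T h t" for t
    using Bcontfun_inverse[OF T_cont] by metis
  define z where "z t = e t *\<^sub>R apply_bcontfun h t" for t
  have z: "z t = \<zeta> + oriented_integral \<tau> t (r h)" for t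
    unfolding z_def h T_def using e[of t] by simp
  have rz: "r h = (\<lambda>s. F s (z s))"
    by (simp add: r_def z_def fun_eq_iff)
  have "continuous_on UNIV z"
    unfolding z_def by (intro continuous_intros ec) auto
  moreover have "z b = z a + integral {a..b} (\<lambda>s. F s (z s))" if "a \<le> b" for a b
    unfolding rz[symmetric] using oriented_integral_diff[OF r_int that] by (simp only: z add.assoc)
  ultimately have "solution F z"
    by (simp add: caratheodory_solution_iff[OF F])
  moreover have "z \<tau> = \<zeta>"
    by (simp add: z oriented_integral_def)
  ultimately show ?thesis
    by blast
qed

definition flow :: "(real \<Rightarrow> 'a \<Rightarrow> 'a::euclidean_space) \<Rightarrow> real \<Rightarrow> 'a \<Rightarrow> real \<Rightarrow> 'a" where
  "flow F \<tau> \<zeta> = (SOME z. solution F z \<and> z \<tau> = \<zeta>)"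

context
  fixes F :: "real \<Rightarrow> 'a \<Rightarrow> 'a::euclidean_space" and \<Lambda> :: real
  assumes F: "caratheodory F \<Lambda>"
begin

lemma solution_flow: "solution F (flow F \<tau> \<zeta>)"
  and flow_initial [simp]: "flow F \<tau> \<zeta> \<tau> = \<zeta>"
  using someI_ex[OF solution_exists[OF F, of \<tau> \<zeta>]] by (auto simp: flow_def)

lemma flow_eq: "solution F z \<Longrightarrow> z \<tau> = \<zeta> \<Longrightarrow> flow F \<tau> \<zeta> = z"
  using solution_unique[OF F solution_flow] flow_initial by blast

text \<open>
  Joint continuity of the flow in the initial time, the initial value and the final time,
  in a form that speaks of solutions and so needs no flow map.
\<close>

lemma solution_tendsto:
  assumes z: "\<And>n. solution F (z n)" "solution F w"
    and \<tau>: "\<tau> \<longlonglongrightarrow> t" and lim: "(\<lambda>n. z n (\<tau> n)) \<longlonglongrightarrow> w t" and \<sigma>: "\<sigma> \<longlonglongrightarrow> s"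
  shows "(\<lambda>n. z n (\<sigma> n)) \<longlonglongrightarrow> w s"
proof -
  have w: "isCont w x" for x
    using solution_continuous[OF z(2)] by (simp add: continuous_on_eq_continuous_at)
  have "(\<lambda>n. exp (\<Lambda> * \<bar>\<sigma> n - \<tau> n\<bar>) * norm (z n (\<tau> n) - w (\<tau> n)))
      \<longlonglongrightarrow> exp (\<Lambda> * \<bar>s - t\<bar>) * norm (w t - w t)"
    by (intro tendsto_intros \<sigma> \<tau> lim isCont_tendsto_compose[OF w])
  then have "(\<lambda>n. exp (\<Lambda> * \<bar>\<sigma> n - \<tau> n\<bar>) * norm (z n (\<tau> n) - w (\<tau> n))) \<longlonglongrightarrow> 0"
    by simp
  then have "(\<lambda>n. z n (\<sigma> n) - w (\<sigma> n)) \<longlonglongrightarrow> 0"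
    by (rule Lim_null_comparison[rotated])
      (auto intro: solution_diff_le[OF F z(1) z(2)] always_eventually)
  moreover have "(\<lambda>n. w (\<sigma> n)) \<longlonglongrightarrow> w s"
    by (rule isCont_tendsto_compose[OF w \<sigma>])
  ultimately show ?thesis
    using tendsto_add by fastforce
qed

end

section \<open>Variation of constants\<close>

lemma constant_if_quadratic_increments:
  fixes D :: "real \<Rightarrow> 'a::real_normed_vector"
  assumes "\<And>R. \<exists>M. \<forall>s t. - R \<le> s \<and> s \<le> t \<and> t \<le> R \<longrightarrow> norm (D t - D s) \<le> M * (t - s)^2"
  shows "D x = D y"
proof -
  have "(D has_derivative (\<lambda>h. 0)) (at x)" for x
    unfolding has_derivative_at_alt
  proof (intro conjI allI impI)
    fix e :: real assume e: "e > 0"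
    obtain M where M: "\<And>s t. - (\<bar>x\<bar> + 1) \<le> s \<Longrightarrow> s \<le> t \<Longrightarrow> t \<le> \<bar>x\<bar> + 1 \<Longrightarrow> norm (D t - D s) \<le> M * (t - s)^2"
      using assms[of "\<bar>x\<bar> + 1"] by blast
    define d where "d = min 1 (e / (\<bar>M\<bar> + 1))"
    have "norm (D y - D x - 0) \<le> e * norm (y - x)" if y: "norm (y - x) < d" for y
    proof -
      have y1: "\<bar>y - x\<bar> \<le> 1" and y2: "(\<bar>M\<bar> + 1) * \<bar>y - x\<bar> \<le> e"
        using y by (auto simp: d_def field_simps)
      have "norm (D y - D x) \<le> M * (y - x)^2"
        using M[of x y] M[of y x] y1 by (cases "x \<le> y") (auto simp: norm_minus_commute power2_commute)
      also have "\<dots> \<le> (\<bar>M\<bar> + 1) * (y - x)^2"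
        by (intro mult_right_mono) auto
      also have "\<dots> = (\<bar>M\<bar> + 1) * \<bar>y - x\<bar> * \<bar>y - x\<bar>"
        by (metis power2_abs power2_eq_square mult.assoc)
      also have "\<dots> \<le> e * \<bar>y - x\<bar>"
        using y2 by (intro mult_right_mono) auto
      finally show ?thesis by simp
    qed
    moreover have "d > 0"
      using e by (simp add: d_def)
    ultimately show "\<exists>d>0. \<forall>y. norm (y - x) < d \<longrightarrow> norm (D y - D x - 0) \<le> e * norm (y - x)"
      by blast
  qed simp
  then have "\<exists>c. \<forall>x\<in>UNIV. D x = c"
    by (intro has_derivative_zero_constant) auto
  then show ?thesis
    by auto
qed

lemma norm_integral_le_const:
  fixes r :: "real \<Rightarrow> 'a::euclidean_space"
  assumes "r integrable_on {a..b}" "a \<le> b" "\<And>s. s \<in> {a..b} \<Longrightarrow> norm (r s) \<le> M"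
  shows "norm (integral {a..b} r) \<le> M * (b - a)"
  using Henstock_Kurzweil_Integration.integral_norm_bound_integral[OF assms(1) integrable_const_ivl, of M] assms
  by (simp add: mult.commute)

locale linear_equation =
  fixes C :: "real \<Rightarrow> 'a::euclidean_space \<Rightarrow> 'a" and \<Lambda> :: real
  assumes C: "caratheodory C \<Lambda>" and linear_C: "\<And>t. linear (C t)"
begin

text \<open>
  \<open>X(t)\<close> transports a state from time 0 to time \<open>t\<close> along the linear equation, and \<open>Y(t)\<close> transports it back;
  in terms of the transition matrix they are \<open>Z(t,0)\<close> and \<open>Z(0,t)\<close>.
\<close>

definition X where "X t v = flow C 0 v t"
definition Y where "Y t v = flow C t v 0"

lemma \<Lambda>_pos: "\<Lambda> > 0"
  and norm_C_diff: "norm (C t v - C t w) \<le> \<Lambda> * norm (v - w)"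
  using C by (auto simp: caratheodory_def)

lemma norm_C: "norm (C t v) \<le> \<Lambda> * norm v"
  using norm_C_diff[of t v 0] linear_0[OF linear_C] by simp

lemma solution_X: "solution C (\<lambda>t. X t v)"
  unfolding X_def by (rule solution_flow[OF C])

lemma X_Y [simp]: "X t (Y t v) = v"
  unfolding X_def Y_def
  using flow_eq[OF C solution_flow[OF C], of t v 0 "flow C t v 0"] flow_initial[OF C, of t v]
  by metis

lemma Y_X [simp]: "Y t (X t v) = v"
  unfolding X_def Y_def
  using flow_eq[OF C solution_flow[OF C], of 0 v t "flow C 0 v t"] flow_initial[OF C, of 0 v]
  by metis

lemma X_0 [simp]: "X 0 v = v" and Y_0 [simp]: "Y 0 v = v"
  by (simp_all add: X_def Y_def flow_initial[OF C])

lemma solution_linear_combination: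
  assumes z: "solution C z" and w: "solution C w"
  shows "solution C (\<lambda>t. c *\<^sub>R z t + d *\<^sub>R w t)"
proof -
  have cont: "continuous_on UNIV z" "continuous_on UNIV w"
    using z w by (auto dest: solution_continuous)
  note int = caratheodory_integrable[OF C cont(1)] caratheodory_integrable[OF C cont(2)]
  have "c *\<^sub>R z b + d *\<^sub>R w b = c *\<^sub>R z a + d *\<^sub>R w a +
      integral {a..b} (\<lambda>s. C s (c *\<^sub>R z s + d *\<^sub>R w s))" if "a \<le> b" for a b
  proof -
    have "z b = z a + integral {a..b} (\<lambda>s. C s (z s))" "w b = w a + integral {a..b} (\<lambda>s. C s (w s))"
      using z w that by (auto simp: solution_def)
    moreover have "integral {a..b} (\<lambda>s. C s (c *\<^sub>R z s + d *\<^sub>R w s)) =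
        c *\<^sub>R integral {a..b} (\<lambda>s. C s (z s)) + d *\<^sub>R integral {a..b} (\<lambda>s. C s (w s))"
      using int by (simp add: linear_add[OF linear_C] linear_scale[OF linear_C]
          Henstock_Kurzweil_Integration.integral_add integrable_cmul)
    ultimately show ?thesis
      by (simp only: scaleR_add_right) simp
  qed
  then show ?thesis
    using cont by (simp add: caratheodory_solution_iff[OF C] continuous_intros)
qed

lemma flow_C_linear_combination:
  "flow C \<tau> (c *\<^sub>R v + d *\<^sub>R w) t = c *\<^sub>R flow C \<tau> v t + d *\<^sub>R flow C \<tau> w t"
  by (subst flow_eq[OF C solution_linear_combination[OF solution_flow[OF C, of \<tau> v] solution_flow[OF C, of \<tau> w]]])
    (simp_all add: flow_initial[OF C])

lemma linear_X: "linear (X t)" and linear_Y: "linear (Y t)"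
proof -
  show "linear (X t)"
    unfolding X_def using flow_C_linear_combination[of 0 1 _ 1 _ t] flow_C_linear_combination[of 0 _ _ 0 0 t]
    by (intro linearI) auto
  show "linear (Y t)"
    unfolding Y_def using flow_C_linear_combination[of t 1 _ 1 _ 0] flow_C_linear_combination[of t _ _ 0 0 0]
    by (intro linearI) auto
qed

lemmas X_simps = linear_0[OF linear_X] linear_add[OF linear_X] linear_diff[OF linear_X]
  linear_scale[OF linear_X] linear_neg[OF linear_X]
lemmas Y_simps = linear_0[OF linear_Y] linear_add[OF linear_Y] linear_diff[OF linear_Y]
  linear_scale[OF linear_Y] linear_neg[OF linear_Y]

lemma norm_X: "norm (X t v) \<le> exp (\<Lambda> * \<bar>t\<bar>) * norm v"
  using solution_diff_le[OF C solution_X[of v] solution_X[of 0], of t 0] by (simp add: X_simps)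

lemma norm_Y: "norm (Y t v) \<le> exp (\<Lambda> * \<bar>t\<bar>) * norm v"
  using solution_diff_le[OF C solution_X[of "Y t v"] solution_X[of 0], of 0 t] by (simp add: X_simps)

lemma X_tendsto: "\<tau> \<longlonglongrightarrow> t \<Longrightarrow> u \<longlonglongrightarrow> v \<Longrightarrow> (\<lambda>n. X (\<tau> n) (u n)) \<longlonglongrightarrow> X t v"
  by (rule solution_tendsto[OF C solution_X solution_X, where \<tau> = "\<lambda>_. 0" and t = 0]) auto

lemma Y_tendsto:
  assumes "\<tau> \<longlonglongrightarrow> t" "u \<longlonglongrightarrow> v"
  shows "(\<lambda>n. Y (\<tau> n) (u n)) \<longlonglongrightarrow> Y t v"
  using solution_tendsto[OF C solution_X solution_X, of \<tau> t "\<lambda>n. Y (\<tau> n) (u n)" "Y t v" "\<lambda>_. 0" 0] assms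
  by simp

lemma Y_continuous: "continuous_on UNIV (Y t)"
  using linear_Y by (auto intro: linear_continuous_on simp: linear_linear)

lemma forcing_Y:
  assumes r: "forcing r"
  shows "forcing (\<lambda>s. Y s (r s))"
  unfolding forcing_def
proof (intro conjI allI)
  have "continuous_on UNIV (\<lambda>s. Y s z)" for z
    by (auto simp: continuous_on_sequentially o_def intro: Y_tendsto)
  then have "(\<lambda>s. Y s z) \<in> borel_measurable lebesgue" for z
    using forcing_continuous unfolding forcing_def by blast
  then show "(\<lambda>s. Y s (r s)) \<in> borel_measurable lebesgue"
    using r Y_continuous by (intro borel_measurable_Caratheodory[where F = Y and b = r])
      (auto simp: forcing_def)
  fix R
  obtain M where M: "M \<ge> 0" "\<And>s. \<bar>s\<bar> \<le> R \<Longrightarrow> norm (r s) \<le> M"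
    using forcing_bound[OF r] by blast
  have "norm (Y s (r s)) \<le> exp (\<Lambda> * R) * M" if "\<bar>s\<bar> \<le> R" for s
  proof -
    have "exp (\<Lambda> * \<bar>s\<bar>) \<le> exp (\<Lambda> * R)"
      using that \<Lambda>_pos by simp
    then have "exp (\<Lambda> * \<bar>s\<bar>) * norm (r s) \<le> exp (\<Lambda> * R) * M"
      using M(2)[OF that] by (intro mult_mono) auto
    then show ?thesis
      using norm_Y[of s "r s"] by linarith
  qed
  then show "\<exists>M. \<forall>s. \<bar>s\<bar> \<le> R \<longrightarrow> norm (Y s (r s)) \<le> M"
    by blast
qed

lemma Y_integrable: "forcing r \<Longrightarrow> (\<lambda>s. Y s (r s)) integrable_on {a..b}"
  by (rule forcing_integrable[OF forcing_Y])

text \<open>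
  Variation of constants: the substitution \<open>u = Y(t) z\<close> turns \<open>z' = C(t) z + r(t)\<close> into
  \<open>u' = Y(t) r(t)\<close>. In this form \<open>z\<close> does not occur under the integral, and projections that do
  not depend on time can be applied to the equation.
\<close>

definition voc :: "(real \<Rightarrow> 'a) \<Rightarrow> (real \<Rightarrow> 'a) \<Rightarrow> bool" where
  "voc r z \<longleftrightarrow> (\<forall>a b. a \<le> b \<longrightarrow> Y b (z b) = Y a (z a) + integral {a..b} (\<lambda>s. Y s (r s)))"

lemma voc_continuous:
  assumes r: "forcing r" and z: "voc r z"
  shows "continuous_on UNIV z"
proof -
  have "continuous_on UNIV (\<lambda>t. Y t (z t))"
    by (rule integral_equation_continuous[OF Y_integrable[OF r]]) (use z in \<open>auto simp: voc_def\<close>)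
  then have "(\<lambda>n. X (\<tau> n) (Y (\<tau> n) (z (\<tau> n)))) \<longlonglongrightarrow> X t (Y t (z t))" if "\<tau> \<longlonglongrightarrow> t" for \<tau> t
    using that unfolding continuous_on_sequentially o_def by (intro X_tendsto) auto
  then show ?thesis
    by (auto simp: continuous_on_sequentially o_def)
qed

text \<open>
  The error in the product rule for \<open>X(t) u(t)\<close> is quadratic in the length of the interval, as both
  factors are Lipschitz there; this replaces differentiation, which holds only almost everywhere.
\<close>

lemma voc_imp_integral_equation:
  assumes r: "forcing r" and z: "voc r z" and ab: "a \<le> b"
  shows "z b = z a + integral {a..b} (\<lambda>s. C s (z s) + r s)"
proof -
  define u where "u t = Y t (z t)" for t
  have zu: "z t = X t (u t)" for t
    by (simp add: u_def)
  have u: "u t - u s = integral {s..t} (\<lambda>\<sigma>. Y \<sigma> (r \<sigma>))" if "s \<le> t" for s t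
    using z that by (simp add: voc_def u_def)
  have zc: "continuous_on UNIV z"
    by (rule voc_continuous[OF r z])
  define g where "g s = C s (z s) + r s" for s
  have g_int: "g integrable_on {s..t}" for s t
    unfolding g_def by (intro forcing_integrable forcing_add r)
      (rule caratheodory_forcing[OF C forcing_continuous[OF zc]])
  define D where "D t = z t - oriented_integral 0 t g" for t
  have "\<exists>M. \<forall>s t. - R \<le> s \<and> s \<le> t \<and> t \<le> R \<longrightarrow> norm (D t - D s) \<le> M * (t - s)^2" for R
  proof -
    obtain Mr where Mr: "Mr \<ge> 0" "\<And>s. \<bar>s\<bar> \<le> R \<Longrightarrow> norm (r s) \<le> Mr"
      using forcing_bound[OF r] by blast
    define E where "E = exp (\<Lambda> * R)"
    have E: "norm (X s v) \<le> E * norm v" "norm (Y s v) \<le> E * norm v" if "\<bar>s\<bar> \<le> R" for s v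
    proof -
      have "exp (\<Lambda> * \<bar>s\<bar>) * norm v \<le> E * norm v"
        unfolding E_def using that \<Lambda>_pos by (intro mult_right_mono) auto
      then show "norm (X s v) \<le> E * norm v" "norm (Y s v) \<le> E * norm v"
        using norm_X[of s v] norm_Y[of s v] by linarith+
    qed
    have E0: "E \<ge> 0" by (simp add: E_def)
    have Yr: "norm (Y s (r s)) \<le> E * Mr" if "\<bar>s\<bar> \<le> R" for s
      using order_trans[OF E(2)[OF that] mult_left_mono[OF Mr(2)[OF that] E0]] .
    have CX: "norm (C s (X s v)) \<le> \<Lambda> * (E * norm v)" if "\<bar>s\<bar> \<le> R" for s v
      using order_trans[OF norm_C mult_left_mono[OF E(1)[OF that]]] \<Lambda>_pos by simp
    have CX_int: "(\<lambda>\<sigma>. C \<sigma> (X \<sigma> v)) integrable_on {s..t}" for s t v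
      by (rule caratheodory_integrable[OF C solution_continuous[OF solution_X]])
    have X_diff: "X t v - X s v = integral {s..t} (\<lambda>\<sigma>. C \<sigma> (X \<sigma> v))" if "s \<le> t" for s t v
      using solution_X[of v] that by (simp add: solution_def)
    have "norm (D t - D s) \<le> (2 * \<Lambda> * E * (E * Mr)) * (t - s)^2"
      if st: "- R \<le> s" "s \<le> t" "t \<le> R" for s t
    proof -
      let ?e = "\<lambda>\<sigma>. (X t (Y \<sigma> (r \<sigma>)) + C \<sigma> (X \<sigma> (u s))) - g \<sigma>"
      have i1: "(\<lambda>\<sigma>. X t (Y \<sigma> (r \<sigma>))) integrable_on {s..t}"
        using integrable_linear[OF Y_integrable[OF r], of "X t"] linear_X by (simp add: o_def linear_linear)
      have e_int: "?e integrable_on {s..t}"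
        by (intro integrable_diff integrable_add i1 CX_int g_int)
      have "X t (u t - u s) = integral {s..t} (\<lambda>\<sigma>. X t (Y \<sigma> (r \<sigma>)))"
        using integral_linear[OF Y_integrable[OF r], of "X t" s t] linear_X u[OF st(2)]
        by (simp add: o_def linear_linear)
      then have "z t - z s = integral {s..t} (\<lambda>\<sigma>. X t (Y \<sigma> (r \<sigma>))) + integral {s..t} (\<lambda>\<sigma>. C \<sigma> (X \<sigma> (u s)))"
        using X_diff[OF st(2), of "u s"] by (simp add: zu X_simps diff_eq_eq)
      moreover have "D t - D s = z t - z s - integral {s..t} g"
        using oriented_integral_diff[OF g_int st(2), of 0] by (simp add: D_def)
      ultimately have "D t - D s = integral {s..t} ?e"
        using i1 CX_int g_int
        by (simp add: Henstock_Kurzweil_Integration.integral_diff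
            Henstock_Kurzweil_Integration.integral_add integrable_add)
      also have "norm \<dots> \<le> (2 * \<Lambda> * E * (E * Mr) * (t - s)) * (t - s)"
      proof (rule norm_integral_le_const[OF e_int st(2)])
        fix \<sigma> assume \<sigma>: "\<sigma> \<in> {s..t}"
        then have \<sigma>R: "\<bar>\<sigma>\<bar> \<le> R"
          using st by auto
        have "X t (Y \<sigma> (r \<sigma>)) - X \<sigma> (Y \<sigma> (r \<sigma>)) = integral {\<sigma>..t} (\<lambda>x. C x (X x (Y \<sigma> (r \<sigma>))))"
          using \<sigma> by (intro X_diff) auto
        also have "norm \<dots> \<le> (\<Lambda> * (E * (E * Mr))) * (t - \<sigma>)"
        proof (rule norm_integral_le_const[OF CX_int])
          fix x assume "x \<in> {\<sigma>..t}"
          then have "norm (C x (X x (Y \<sigma> (r \<sigma>)))) \<le> \<Lambda> * (E * norm (Y \<sigma> (r \<sigma>)))"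
            using \<sigma> st by (intro CX) auto
          also have "\<dots> \<le> \<Lambda> * (E * (E * Mr))"
            using Yr[OF \<sigma>R] \<Lambda>_pos E0 by (intro mult_left_mono) auto
          finally show "norm (C x (X x (Y \<sigma> (r \<sigma>)))) \<le> \<Lambda> * (E * (E * Mr))" .
        qed (use \<sigma> in auto)
        finally have n1: "norm (X t (Y \<sigma> (r \<sigma>)) - r \<sigma>) \<le> (\<Lambda> * (E * (E * Mr))) * (t - \<sigma>)"
          by simp
        have "norm (u \<sigma> - u s) \<le> (E * Mr) * (\<sigma> - s)"
          unfolding u[of s \<sigma>, OF _] using \<sigma> st u[of s \<sigma>] Yr
          by (auto intro!: norm_integral_le_const Y_integrable r)
        then have "norm (u s - u \<sigma>) \<le> (E * Mr) * (\<sigma> - s)"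
          by (simp add: norm_minus_commute)
        then have n2: "norm (C \<sigma> (X \<sigma> (u s - u \<sigma>))) \<le> \<Lambda> * (E * ((E * Mr) * (\<sigma> - s)))"
          using order_trans[OF CX[OF \<sigma>R] mult_left_mono[OF mult_left_mono]] \<Lambda>_pos E0 by simp
        have e_eq: "?e \<sigma> = (X t (Y \<sigma> (r \<sigma>)) - r \<sigma>) + C \<sigma> (X \<sigma> (u s - u \<sigma>))"
          by (simp add: g_def zu X_simps linear_diff[OF linear_C])
        have "norm (?e \<sigma>) \<le> (\<Lambda> * (E * (E * Mr))) * (t - \<sigma>) + \<Lambda> * (E * ((E * Mr) * (\<sigma> - s)))"
          unfolding e_eq by (rule norm_triangle_mono[OF n1 n2])
        also have "\<dots> = (\<Lambda> * E * (E * Mr)) * (t - s)"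
          by (simp add: algebra_simps)
        also have "\<dots> \<le> 2 * \<Lambda> * E * (E * Mr) * (t - s)"
          using \<Lambda>_pos E0 Mr(1) st by (intro mult_right_mono) auto
        finally show "norm (?e \<sigma>) \<le> 2 * \<Lambda> * E * (E * Mr) * (t - s)" .
      qed
      finally show ?thesis
        by (simp add: power2_eq_square mult.assoc)
    qed
    then show ?thesis by blast
  qed
  then have "D b = D a"
    by (rule constant_if_quadratic_increments)
  then show ?thesis
    using oriented_integral_diff[OF g_int ab, of 0] unfolding D_def g_def[symmetric]
    by (simp add: algebra_simps)
qed

lemma voc_from_initial:
  assumes r: "forcing r" and z: "\<And>t. Y t (z t) = v + oriented_integral 0 t (\<lambda>s. Y s (r s))"
  shows "voc r z"
  unfolding voc_def using oriented_integral_diff[OF Y_integrable[OF r], of _ _ 0] by (simp add: z)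

text \<open>
  The converse needs no second computation: the function that variation of constants produces from
  the same initial value solves the same equation, and solutions are unique.
\<close>

lemma integral_equation_imp_voc:
  assumes r: "forcing r" and zc: "continuous_on UNIV z"
    and z: "\<And>a b. a \<le> b \<Longrightarrow> z b = z a + integral {a..b} (\<lambda>s. C s (z s) + r s)"
  shows "voc r z"
proof -
  define y where "y t = X t (z 0 + oriented_integral 0 t (\<lambda>s. Y s (r s)))" for t
  have y: "voc r y"
    by (rule voc_from_initial[OF r]) (simp add: y_def)
  have yc: "continuous_on UNIV y"
    by (rule voc_continuous[OF r y])
  note int = caratheodory_integrable[OF C zc] caratheodory_integrable[OF C yc] forcing_integrable[OF r]
  have "z b - y b = z a - y a + integral {a..b} (\<lambda>s. C s (z s - y s))" if "a \<le> b" for a b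
    using z[OF that] voc_imp_integral_equation[OF r y that] int
    by (simp add: linear_diff[OF linear_C] Henstock_Kurzweil_Integration.integral_diff
        Henstock_Kurzweil_Integration.integral_add)
  then have sol: "solution C (\<lambda>t. z t - y t)"
    using zc yc by (auto simp: caratheodory_solution_iff[OF C] intro: continuous_intros)
  have "(\<lambda>t. z t - y t) = (\<lambda>t. X t 0)"
    by (rule solution_unique[OF C sol solution_X, of 0]) (simp add: y_def oriented_integral_def)
  then have "z = y"
    by (simp add: fun_eq_iff X_simps)
  then show ?thesis
    using y by simp
qed

end

section \<open>Bounded solutions under an exponential dichotomy\<close>

locale dichotomy = linear_equation +
  fixes S :: "'a \<Rightarrow> real" and P :: "'a \<Rightarrow> 'a" and K \<alpha> :: real
  assumes S: "is_norm S" and linear_P: "linear P"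
    and K: "K \<ge> 1" and \<alpha>: "\<alpha> > 0"
    and stable: "s \<le> t \<Longrightarrow> S (X t (P (Y s v))) \<le> K * exp (- \<alpha> * (t - s)) * S v"
    and unstable_strict: "t < s \<Longrightarrow> S (X t (Y s v - P (Y s v))) \<le> K * exp (- \<alpha> * (s - t)) * S v"
begin

lemmas S_nonneg = is_norm_nonneg[OF S] and S_zero = is_norm_zero[OF S] and S_minus = is_norm_minus[OF S]
  and S_triangle = is_norm_triangle[OF S] and S_diff = is_norm_diff[OF S]
  and S_le_norm = is_norm_le_norm[OF S] and norm_le_S = norm_le_is_norm[OF S]

definition Q where "Q v = v - P v"

lemma linear_Q: "linear Q"
  using linear_P unfolding Q_def by (auto intro!: linearI simp: linear_add linear_scale algebra_simps)

lemma P_Q: "P v + Q v = v"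
  by (simp add: Q_def)

text \<open>
  The kernel of the dichotomy has a jump on the diagonal, where by convention it takes its stable
  value. The unstable bound extends to \<open>s = t\<close> by continuity of \<open>Y\<close>.
\<close>

lemma unstable:
  assumes "t \<le> s"
  shows "S (X t (Q (Y s v))) \<le> K * exp (- \<alpha> * (s - t)) * S v"
proof (rule LIMSEQ_le)
  have \<sigma>: "(\<lambda>n. s + 1 / real (Suc n)) \<longlonglongrightarrow> s + 0"
    by (intro tendsto_intros LIMSEQ_Suc lim_1_over_n)
  have "isCont (\<lambda>w. S (X t (Q w))) w" for w
    using linear_Q linear_X
    by (intro continuous_on_interior[OF continuous_on_compose2[OF is_norm_continuous[OF S, of UNIV],
            of UNIV "\<lambda>w. X t (Q w)"]] linear_continuous_on_compose[of UNIV _ "X t"] linear_continuous_on)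
      (auto simp: linear_linear)
  then show "(\<lambda>n. S (X t (Q (Y (s + 1 / real (Suc n)) v)))) \<longlonglongrightarrow> S (X t (Q (Y s v)))"
    by (rule isCont_tendsto_compose) (use \<sigma> in \<open>auto intro: Y_tendsto\<close>)
  show "(\<lambda>n. K * exp (- \<alpha> * ((s + 1 / real (Suc n)) - t)) * S v) \<longlonglongrightarrow> K * exp (- \<alpha> * (s - t)) * S v"
    using \<sigma> by (intro tendsto_intros) simp
  show "\<exists>N. \<forall>n\<ge>N. S (X t (Q (Y (s + 1 / real (Suc n)) v))) \<le> K * exp (- \<alpha> * ((s + 1 / real (Suc n)) - t)) * S v"
    unfolding Q_def using assms by (intro exI[of _ 0] allI impI unstable_strict)
      (auto intro: le_less_trans)
qed

lemma stable_bounded: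
  assumes "t \<ge> 0"
  shows "S (X t (P w)) \<le> K * S w"
proof -
  have "S (X t (P w)) \<le> K * exp (- \<alpha> * t) * S w"
    using stable[OF assms, of w] by simp
  also have "\<dots> \<le> K * 1 * S w"
    using assms \<alpha> K S_nonneg by (intro mult_right_mono mult_left_mono) auto
  finally show ?thesis by simp
qed

lemma unstable_bounded:
  assumes "t \<le> 0"
  shows "S (X t (Q w)) \<le> K * S w"
proof -
  have "S (X t (Q w)) \<le> K * exp (\<alpha> * t) * S w"
    using unstable[OF assms, of w] by simp
  also have "\<dots> \<le> K * 1 * S w"
    using assms \<alpha> K S_nonneg
    by (intro mult_right_mono mult_left_mono) (auto simp: mult_nonneg_nonpos)
  finally show ?thesis by simp
qed

lemma stable_integral:
  assumes r: "forcing r" and "a \<le> t" and m: "m \<ge> 0" and \<beta>: "\<beta> < \<alpha>"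
    and le: "\<And>s. s \<in> {a..t} \<Longrightarrow> S (r s) \<le> m * exp (\<beta> * (t - s))"
  shows "S (X t (P (integral {a..t} (\<lambda>s. Y s (r s))))) \<le> K * m / (\<alpha> - \<beta>)"
proof -
  have lin: "bounded_linear (\<lambda>w. X t (P w))"
    using linear_compose[OF linear_P linear_X, of t] by (simp add: linear_linear o_def)
  have "X t (P (integral {a..t} (\<lambda>s. Y s (r s)))) = integral {a..t} (\<lambda>s. X t (P (Y s (r s))))"
    using integral_linear[OF Y_integrable[OF r] lin] by (simp add: o_def)
  also have "S \<dots> \<le> K * m / (\<alpha> - \<beta>)"
  proof (rule is_norm_integral_exp_le[OF S, where t = t])
    show "(\<lambda>s. X t (P (Y s (r s)))) integrable_on {a..t}"
      using integrable_linear[OF Y_integrable[OF r] lin] by (simp add: o_def)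
    fix s assume s: "s \<in> {a..t}"
    have "S (X t (P (Y s (r s)))) \<le> K * exp (- \<alpha> * (t - s)) * S (r s)"
      using s by (intro stable) auto
    also have "\<dots> \<le> K * exp (- \<alpha> * (t - s)) * (m * exp (\<beta> * (t - s)))"
      using le[OF s] K by (intro mult_left_mono) auto
    also have "\<dots> = K * m * exp (- (\<alpha> - \<beta>) * \<bar>t - s\<bar>)"
      using s by (simp add: exp_add[symmetric] algebra_simps)
    finally show "S (X t (P (Y s (r s)))) \<le> K * m * exp (- (\<alpha> - \<beta>) * \<bar>t - s\<bar>)" .
  qed (use assms K in auto)
  finally show ?thesis .
qed

lemma unstable_integral:
  assumes r: "forcing r" and "t \<le> b" and m: "m \<ge> 0" and \<beta>: "\<beta> < \<alpha>"
    and le: "\<And>s. s \<in> {t..b} \<Longrightarrow> S (r s) \<le> m * exp (\<beta> * (s - t))"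
  shows "S (X t (Q (integral {t..b} (\<lambda>s. Y s (r s))))) \<le> K * m / (\<alpha> - \<beta>)"
proof -
  have lin: "bounded_linear (\<lambda>w. X t (Q w))"
    using linear_compose[OF linear_Q linear_X, of t] by (simp add: linear_linear o_def)
  have "X t (Q (integral {t..b} (\<lambda>s. Y s (r s)))) = integral {t..b} (\<lambda>s. X t (Q (Y s (r s))))"
    using integral_linear[OF Y_integrable[OF r] lin] by (simp add: o_def)
  also have "S \<dots> \<le> K * m / (\<alpha> - \<beta>)"
  proof (rule is_norm_integral_exp_le[OF S, where t = t])
    show "(\<lambda>s. X t (Q (Y s (r s)))) integrable_on {t..b}"
      using integrable_linear[OF Y_integrable[OF r] lin] by (simp add: o_def)
    fix s assume s: "s \<in> {t..b}"
    have "S (X t (Q (Y s (r s)))) \<le> K * exp (- \<alpha> * (s - t)) * S (r s)"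
      using s by (intro unstable) auto
    also have "\<dots> \<le> K * exp (- \<alpha> * (s - t)) * (m * exp (\<beta> * (s - t)))"
      using le[OF s] K by (intro mult_left_mono) auto
    also have "\<dots> = K * m * exp (- (\<alpha> - \<beta>) * \<bar>t - s\<bar>)"
      using s by (simp add: exp_add[symmetric] algebra_simps)
    finally show "S (X t (Q (Y s (r s)))) \<le> K * m * exp (- (\<alpha> - \<beta>) * \<bar>t - s\<bar>)" .
  qed (use assms K in auto)
  finally show ?thesis .
qed

text \<open>
  Jumps are admitted because solutions will be cut off and glued at a time \<open>\<tau>\<close>. The jump \<open>\<xi>\<close> is the
  value on the right minus the value on the left, and \<open>w\<close> takes the value on the right at \<open>\<tau>\<close>.
\<close>

definition voc_jump :: "real \<Rightarrow> 'a \<Rightarrow> (real \<Rightarrow> 'a) \<Rightarrow> (real \<Rightarrow> 'a) \<Rightarrow> bool" where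
  "voc_jump \<tau> \<xi> r w \<longleftrightarrow> (\<forall>a b. a \<le> b \<longrightarrow>
     Y b (w b) = Y a (w a) + integral {a..b} (\<lambda>s. Y s (r s)) + (if a < \<tau> \<and> \<tau> \<le> b then Y \<tau> \<xi> else 0))"

lemma voc_jump_no_jump: "voc r w \<Longrightarrow> voc_jump \<tau> 0 r w"
  by (simp add: voc_def voc_jump_def Y_simps)

text \<open>
  A bounded solution has no freedom left: its stable part is determined by the past and its unstable
  part by the future. On a window \<open>[t - h, t + h]\<close> the two boundary terms are damped by \<open>exp (- \<alpha> * h)\<close> and
  disappear as \<open>h\<close> grows, which leaves the jump and the forcing. The weights \<open>\<rho>\<close> that are
  admissible vary at an exponential rate \<open>\<beta>\<close> below \<open>\<alpha>\<close>; for them \<open>\<alpha> - \<beta>\<close> takes the place of \<open>\<alpha>\<close>.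
\<close>

lemma a_priori_step:
  assumes r: "forcing r" and w: "voc_jump \<tau> \<xi> r w"
    and \<beta>: "0 \<le> \<beta>" "\<beta> < \<alpha>" and \<rho>: "\<And>t. \<rho> t > 0" "\<And>s t. \<rho> s \<le> \<rho> t * exp (\<beta> * \<bar>t - s\<bar>)"
    and m: "m \<ge> 0" "\<And>s. S (r s) \<le> m * \<rho> s" and B: "\<And>s. S (w s) \<le> B * \<rho> s"
  shows "S (w t) \<le> \<rho> t * (K * S \<xi> / \<rho> \<tau> + 2 * K * m / (\<alpha> - \<beta>))"
proof -
  define g where "g = \<alpha> - \<beta>"
  have g: "g > 0"
    using \<beta> by (simp add: g_def)
  have B0: "B \<ge> 0"
    using order_trans[OF S_nonneg B[of 0]] \<rho>(1)[of 0] by (simp add: zero_le_mult_iff)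
  have exp_g: "exp (- \<alpha> * x) * exp (\<beta> * x) = exp (- g * x)" for x
    by (simp add: g_def exp_add[symmetric] algebra_simps)
  have weight: "K * exp (- \<alpha> * \<bar>t - s\<bar>) * (y * \<rho> s) \<le> \<rho> t * (K * y * exp (- g * \<bar>t - s\<bar>))" if "y \<ge> 0" for s y
  proof -
    have "K * exp (- \<alpha> * \<bar>t - s\<bar>) * (y * \<rho> s) \<le> K * exp (- \<alpha> * \<bar>t - s\<bar>) * (y * (\<rho> t * exp (\<beta> * \<bar>t - s\<bar>)))"
      using \<rho>(2)[of s t] K that by (intro mult_left_mono) auto
    also have "\<dots> = \<rho> t * (K * y * (exp (- \<alpha> * \<bar>t - s\<bar>) * exp (\<beta> * \<bar>t - s\<bar>)))"
      by (simp only: mult_ac)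
    finally show ?thesis
      by (simp only: exp_g)
  qed
  have jump: "K * exp (- \<alpha> * \<bar>t - \<tau>\<bar>) * S \<xi> \<le> \<rho> t * (K * S \<xi> / \<rho> \<tau>)"
  proof -
    have "K * exp (- \<alpha> * \<bar>t - \<tau>\<bar>) * S \<xi> = K * exp (- \<alpha> * \<bar>t - \<tau>\<bar>) * (S \<xi> / \<rho> \<tau> * \<rho> \<tau>)"
      using \<rho>(1)[of \<tau>] by simp
    also have "\<dots> \<le> \<rho> t * (K * (S \<xi> / \<rho> \<tau>) * exp (- g * \<bar>t - \<tau>\<bar>))"
      using \<rho>(1)[of \<tau>] S_nonneg by (intro weight divide_nonneg_pos)
    also have "\<dots> \<le> \<rho> t * (K * (S \<xi> / \<rho> \<tau>) * 1)"
      using \<rho>(1)[of \<tau>] \<rho>(1)[of t] S_nonneg K g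
      by (intro mult_left_mono) (auto intro: mult_nonneg_nonneg)
    finally show ?thesis by simp
  qed
  have int_bound: "S (r s) \<le> m * \<rho> t * exp (\<beta> * \<bar>t - s\<bar>)" for s
    using order_trans[OF m(2) mult_left_mono[OF \<rho>(2)[of s t] m(1)]] by (simp add: mult.assoc)
  have bound_left: "S (r s) \<le> m * \<rho> t * exp (\<beta> * (t - s))" if "s \<le> t" for s
    using int_bound[of s] that by simp
  have bound_right: "S (r s) \<le> m * \<rho> t * exp (\<beta> * (s - t))" if "t \<le> s" for s
    using int_bound[of s] that by simp
  have main: "S (w t) \<le> \<rho> t * (K * S \<xi> / \<rho> \<tau> + 2 * K * m / g + 2 * (K * B * exp (- g * h)))" if h: "h > 0" "h > \<bar>t - \<tau>\<bar>" for h
  proof -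
    define a b where "a = t - h" and "b = t + h"
    have ab: "a \<le> t" "t \<le> b" "a < \<tau>" "\<tau> \<le> b"
      using h by (auto simp: a_def b_def)
    let ?J = "\<lambda>a b. integral {a..b} (\<lambda>s. Y s (r s))"
    have Ya: "Y t (w t) = Y a (w a) + ?J a t + (if \<tau> \<le> t then Y \<tau> \<xi> else 0)"
      using w ab unfolding voc_jump_def by auto
    have Yb: "Y t (w t) = Y b (w b) - ?J t b - (if \<tau> \<le> t then 0 else Y \<tau> \<xi>)"
      using w ab unfolding voc_jump_def by (auto simp: algebra_simps)
    have "w t = X t (P (Y t (w t))) + X t (Q (Y t (w t)))"
      by (simp add: X_simps[symmetric] P_Q)
    also have "X t (P (Y t (w t))) = X t (P (Y a (w a))) + X t (P (?J a t)) + (if \<tau> \<le> t then X t (P (Y \<tau> \<xi>)) else 0)"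
      unfolding Ya by (simp add: linear_add[OF linear_P] linear_0[OF linear_P] X_simps)
    also have "X t (Q (Y t (w t))) = X t (Q (Y b (w b))) - X t (Q (?J t b)) - (if \<tau> \<le> t then 0 else X t (Q (Y \<tau> \<xi>)))"
      unfolding Yb by (simp add: linear_diff[OF linear_Q] linear_0[OF linear_Q] X_simps)
    finally have wt: "w t = (X t (P (Y a (w a))) + X t (Q (Y b (w b)))) + (X t (P (?J a t)) - X t (Q (?J t b)))
        + (if \<tau> \<le> t then X t (P (Y \<tau> \<xi>)) else - X t (Q (Y \<tau> \<xi>)))"
      by auto
    have "S (X t (P (Y a (w a)))) \<le> K * exp (- \<alpha> * \<bar>t - a\<bar>) * (B * \<rho> a)"
      using order_trans[OF stable[OF ab(1)] mult_left_mono[OF B]] K ab by simp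
    then have 1: "S (X t (P (Y a (w a)))) \<le> \<rho> t * (K * B * exp (- g * h))"
      using weight[OF B0, of a] h by (simp add: a_def)
    have "S (X t (Q (Y b (w b)))) \<le> K * exp (- \<alpha> * \<bar>t - b\<bar>) * (B * \<rho> b)"
      using order_trans[OF unstable[OF ab(2)] mult_left_mono[OF B]] K ab by simp
    then have 2: "S (X t (Q (Y b (w b)))) \<le> \<rho> t * (K * B * exp (- g * h))"
      using weight[OF B0, of b] h by (simp add: b_def)
    have 3: "S (X t (P (?J a t))) \<le> K * (m * \<rho> t) / g"
      unfolding g_def using m(1) \<rho>(1)[of t] \<beta> ab bound_left by (intro stable_integral[OF r]) auto
    have 4: "S (X t (Q (?J t b))) \<le> K * (m * \<rho> t) / g"
      unfolding g_def using m(1) \<rho>(1)[of t] \<beta> ab bound_right by (intro unstable_integral[OF r]) auto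
    have 5: "S (if \<tau> \<le> t then X t (P (Y \<tau> \<xi>)) else - X t (Q (Y \<tau> \<xi>))) \<le> \<rho> t * (K * S \<xi> / \<rho> \<tau>)"
      using jump stable[of \<tau> t \<xi>] unstable[of t \<tau> \<xi>]
      by (cases "\<tau> \<le> t") (auto simp: S_minus)
    have "S (w t) \<le> S (X t (P (Y a (w a)))) + S (X t (Q (Y b (w b)))) + (S (X t (P (?J a t))) + S (X t (Q (?J t b))))
        + S (if \<tau> \<le> t then X t (P (Y \<tau> \<xi>)) else - X t (Q (Y \<tau> \<xi>)))"
      unfolding wt
      by (intro order_trans[OF S_triangle] add_mono S_triangle S_diff order_refl)
    also have "\<dots> \<le> \<rho> t * (K * B * exp (- g * h)) + \<rho> t * (K * B * exp (- g * h)) + (K * (m * \<rho> t) / g + K * (m * \<rho> t) / g)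
        + \<rho> t * (K * S \<xi> / \<rho> \<tau>)"
      by (intro add_mono 1 2 3 4 5)
    also have "\<dots> = \<rho> t * (K * S \<xi> / \<rho> \<tau> + 2 * K * m / g + 2 * (K * B * exp (- g * h)))"
      by (simp add: algebra_simps)
    finally show ?thesis .
  qed
  have "(\<lambda>n. \<rho> t * (K * S \<xi> / \<rho> \<tau> + 2 * K * m / g + 2 * (K * B * exp (- g * real n))))
      \<longlonglongrightarrow> \<rho> t * (K * S \<xi> / \<rho> \<tau> + 2 * K * m / g + 2 * (K * B * 0))"
  proof (intro tendsto_intros)
    have "(\<lambda>n. exp (- g) ^ n) \<longlonglongrightarrow> 0"
      using g by (intro LIMSEQ_realpow_zero) auto
    then show "(\<lambda>n. exp (- g * real n)) \<longlonglongrightarrow> 0"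
      by (simp add: exp_of_nat_mult[symmetric] mult.commute)
  qed
  moreover have "\<exists>N. \<forall>n\<ge>N. S (w t) \<le> \<rho> t * (K * S \<xi> / \<rho> \<tau> + 2 * K * m / g + 2 * (K * B * exp (- g * real n)))"
  proof -
    obtain N :: nat where N: "real N > \<bar>t - \<tau>\<bar>"
      using reals_Archimedean2 by blast
    have "real n > \<bar>t - \<tau>\<bar>" "real n > 0" if "n \<ge> N" for n
      using N that by (auto intro: less_le_trans)
    then show ?thesis
      using main by blast
  qed
  ultimately show ?thesis
    unfolding g_def[symmetric] using LIMSEQ_le_const by fastforce
qed

text \<open>
  The bound \<open>B\<close> only matters qualitatively: the least such bound is itself improved by the
  previous lemma, which makes it at most the fixed point of an affine contraction.
\<close>

lemma a_priori:
  assumes r: "forcing r" and w: "voc_jump \<tau> \<xi> r w"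
    and \<beta>: "0 \<le> \<beta>" "\<beta> < \<alpha>" and \<rho>: "\<And>t. \<rho> t > 0" "\<And>s t. \<rho> s \<le> \<rho> t * exp (\<beta> * \<bar>t - s\<bar>)"
    and \<kappa>: "\<kappa> \<ge> 0" "2 * K * \<kappa> < \<alpha> - \<beta>" and c: "c \<ge> 0"
    and le: "\<And>s. S (r s) \<le> \<kappa> * S (w s) + c * \<rho> s" and B: "\<And>s. S (w s) \<le> B * \<rho> s"
  shows "S (w t) \<le> \<rho> t * ((K * (\<alpha> - \<beta>) * (S \<xi> / \<rho> \<tau>) + 2 * K * c) / (\<alpha> - \<beta> - 2 * K * \<kappa>))"
proof -
  define b where "b = (SUP s. S (w s) / \<rho> s)"
  have bdd: "bdd_above (range (\<lambda>s. S (w s) / \<rho> s))"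
    using B \<rho>(1) by (intro bdd_aboveI[of _ B]) (auto simp: divide_le_eq)
  have wb: "S (w s) \<le> b * \<rho> s" for s
    using cSUP_upper[OF _ bdd, of s] \<rho>(1)[of s] by (simp add: b_def divide_le_eq)
  have b0: "b \<ge> 0"
    using order_trans[OF S_nonneg wb[of 0]] \<rho>(1)[of 0] by (simp add: zero_le_mult_iff)
  have "S (r s) \<le> (\<kappa> * b + c) * \<rho> s" for s
    using le[of s] mult_left_mono[OF wb[of s] \<kappa>(1)] by (simp add: algebra_simps)
  then have "S (w s) \<le> \<rho> s * (K * S \<xi> / \<rho> \<tau> + 2 * K * (\<kappa> * b + c) / (\<alpha> - \<beta>))" for s
    using \<kappa> b0 c by (intro a_priori_step[OF r w \<beta> \<rho> _ _ wb]) auto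
  then have "b \<le> K * S \<xi> / \<rho> \<tau> + 2 * K * (\<kappa> * b + c) / (\<alpha> - \<beta>)"
    unfolding b_def using \<rho>(1) by (intro cSUP_least) (auto simp: divide_le_eq mult.commute)
  then have "b * (\<alpha> - \<beta>) \<le> (K * S \<xi> / \<rho> \<tau> + 2 * K * (\<kappa> * b + c) / (\<alpha> - \<beta>)) * (\<alpha> - \<beta>)"
    using \<beta> by (intro mult_right_mono) auto
  also have "\<dots> = K * (\<alpha> - \<beta>) * (S \<xi> / \<rho> \<tau>) + 2 * K * (\<kappa> * b + c)"
    using \<beta> by (simp add: distrib_right)
  finally have "b * (\<alpha> - \<beta> - 2 * K * \<kappa>) \<le> K * (\<alpha> - \<beta>) * (S \<xi> / \<rho> \<tau>) + 2 * K * c"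
    by (simp add: algebra_simps)
  then have "b \<le> (K * (\<alpha> - \<beta>) * (S \<xi> / \<rho> \<tau>) + 2 * K * c) / (\<alpha> - \<beta> - 2 * K * \<kappa>)"
    using \<kappa> by (simp add: le_divide_eq)
  from mult_left_mono[OF this, of "\<rho> t"] show ?thesis
    using wb[of t] \<rho>(1)[of t] by (simp add: mult.commute)
qed

end

context dichotomy
begin

lemma S_tendsto: "u \<longlonglongrightarrow> v \<Longrightarrow> (\<lambda>n. S (u n)) \<longlonglongrightarrow> S v"
  using is_norm_continuous[OF S, of UNIV] by (auto simp: continuous_on_sequentially o_def)

lemma S_tendsto_0_iff: "(\<lambda>n. S (u n - v)) \<longlonglongrightarrow> 0 \<longleftrightarrow> u \<longlonglongrightarrow> v"
proof
  obtain c where c: "\<And>v. norm v \<le> c * S v"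
    using norm_le_S by blast
  assume "(\<lambda>n. S (u n - v)) \<longlonglongrightarrow> 0"
  from tendsto_mult_left[OF this, of c] have "(\<lambda>n. c * S (u n - v)) \<longlonglongrightarrow> 0"
    by simp
  then have "(\<lambda>n. u n - v) \<longlonglongrightarrow> 0"
    by (rule Lim_null_comparison[rotated]) (auto intro: c always_eventually)
  then show "u \<longlonglongrightarrow> v"
    by (simp add: LIM_zero_iff)
next
  assume "u \<longlonglongrightarrow> v"
  then have "(\<lambda>n. u n - v) \<longlonglongrightarrow> 0"
    by (simp add: LIM_zero_iff)
  from S_tendsto[OF this] show "(\<lambda>n. S (u n - v)) \<longlonglongrightarrow> 0"
    by (simp add: S_zero)
qed

lemma S_bounded_subsequence:
  assumes "\<And>n. S (u n) \<le> m"
  obtains v \<phi> where "strict_mono (\<phi> :: nat \<Rightarrow> nat)" "(\<lambda>n. u (\<phi> n)) \<longlonglongrightarrow> v"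
proof -
  obtain c where c: "c > 0" "\<And>v. norm v \<le> c * S v"
    using norm_le_S by blast
  have "norm (u n) \<le> c * m" for n
    using order_trans[OF c(2) mult_left_mono[OF assms]] c(1) by simp
  then have "bounded (range u)"
    by (auto intro: boundedI)
  then show ?thesis
    using that bounded_imp_convergent_subsequence[of u] by (auto simp: o_def)
qed

text \<open>
  The bounded solution is the sum of \<open>\<integral> X(t) P Y(s) r(s) ds\<close> over \<open>s < t\<close> and
  \<open>- \<integral> X(t) Q Y(s) r(s) ds\<close> over \<open>s > t\<close>. Its initial value is a limit point of those of the
  truncated integrals, and the bounds of these are uniform.
\<close>

lemma linear_bounded_exists:
  assumes r: "forcing r" and m: "\<And>s. S (r s) \<le> m"
  shows "\<exists>h. voc r h \<and> (\<exists>B. \<forall>t. S (h t) \<le> B)"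
proof -
  have m0: "m \<ge> 0"
    using order_trans[OF S_nonneg m] .
  let ?J = "\<lambda>a b. integral {a..b} (\<lambda>s. Y s (r s))"
  have stab: "S (X t (P (?J a t))) \<le> K * m / \<alpha>" if "a \<le> t" for a t
    using stable_integral[OF r that m0, of 0] \<alpha> m by simp
  have unst: "S (X t (Q (?J t b))) \<le> K * m / \<alpha>" if "t \<le> b" for b t
    using unstable_integral[OF r that m0, of 0] \<alpha> m by simp
  have "S (P (?J (- real n) 0)) \<le> K * m / \<alpha>" for n
    using stab[of "- real n" 0] by simp
  then obtain p \<phi> where p: "strict_mono \<phi>" "(\<lambda>n. P (?J (- real (\<phi> n)) 0)) \<longlonglongrightarrow> p"
    using S_bounded_subsequence[of "\<lambda>n. P (?J (- real n) 0)"] by blast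
  have "S (Q (?J 0 (real n))) \<le> K * m / \<alpha>" for n
    using unst[of 0 "real n"] by simp
  then obtain q \<psi> where q: "strict_mono \<psi>" "(\<lambda>n. Q (?J 0 (real (\<psi> n)))) \<longlonglongrightarrow> q"
    using S_bounded_subsequence[of "\<lambda>n. Q (?J 0 (real n))"] by blast
  let ?O = "\<lambda>t. oriented_integral 0 t (\<lambda>s. Y s (r s))"
  have O: "?O b = ?O a + ?J a b" if "a \<le> b" for a b
    by (rule oriented_integral_diff[OF Y_integrable[OF r] that])
  have large: "\<forall>\<^sub>F n in sequentially. real (\<theta> n) \<ge> \<bar>t\<bar>" if "strict_mono \<theta>" for \<theta> :: "nat \<Rightarrow> nat" and t
  proof -
    obtain N :: nat where "\<bar>t\<bar> \<le> real N"
      using real_arch_simple by blast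
    then have "\<bar>t\<bar> \<le> real (\<theta> n)" if "n \<ge> N" for n
      using strict_mono_imp_increasing[OF \<open>strict_mono \<theta>\<close>, of n] that by linarith
    then show ?thesis
      unfolding eventually_sequentially by blast
  qed
  define h where "h t = X t ((p - q) + ?O t)" for t
  have "voc r h"
    by (rule voc_from_initial[OF r]) (simp add: h_def)
  moreover have "S (h t) \<le> K * m / \<alpha> + K * m / \<alpha>" for t
  proof -
    have "S (X t (p + P (?O t))) \<le> K * m / \<alpha>"
    proof (rule tendsto_upperbound)
      show "(\<lambda>n. S (X t (P (?J (- real (\<phi> n)) 0) + P (?O t)))) \<longlonglongrightarrow> S (X t (p + P (?O t)))"
        by (intro S_tendsto X_tendsto tendsto_add p(2)) auto
      show "\<forall>\<^sub>F n in sequentially. S (X t (P (?J (- real (\<phi> n)) 0) + P (?O t))) \<le> K * m / \<alpha>"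
        using large[OF p(1), of t]
      proof eventually_elim
        case (elim n)
        have "?J (- real (\<phi> n)) 0 + ?O t = ?J (- real (\<phi> n)) t"
          using O[of "- real (\<phi> n)" 0] O[of "- real (\<phi> n)" t] elim
          by (simp add: oriented_integral_def algebra_simps)
        then show ?case
          using stab[of "- real (\<phi> n)" t] elim by (simp add: linear_add[OF linear_P, symmetric])
      qed
    qed simp
    moreover have "S (X t (q - Q (?O t))) \<le> K * m / \<alpha>"
    proof (rule tendsto_upperbound)
      show "(\<lambda>n. S (X t (Q (?J 0 (real (\<psi> n))) - Q (?O t)))) \<longlonglongrightarrow> S (X t (q - Q (?O t)))"
        by (intro S_tendsto X_tendsto tendsto_diff q(2)) auto
      show "\<forall>\<^sub>F n in sequentially. S (X t (Q (?J 0 (real (\<psi> n))) - Q (?O t))) \<le> K * m / \<alpha>"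
        using large[OF q(1), of t]
      proof eventually_elim
        case (elim n)
        have "?J 0 (real (\<psi> n)) - ?O t = ?J t (real (\<psi> n))"
          using O[of 0 "real (\<psi> n)"] O[of t "real (\<psi> n)"] elim
          by (simp add: oriented_integral_def algebra_simps)
        then show ?case
          using unst[of t "real (\<psi> n)"] elim by (simp add: linear_diff[OF linear_Q, symmetric])
      qed
    qed simp
    moreover have h_eq: "h t = X t (p + P (?O t)) - X t (q - Q (?O t))"
    proof -
      have "(p - q) + ?O t = (p + P (?O t)) - (q - Q (?O t))"
        using P_Q[of "?O t"] by (simp add: algebra_simps)
      then show ?thesis
        by (simp only: h_def X_simps)
    qed
    ultimately show ?thesis
      unfolding h_eq by (intro order_trans[OF S_diff] add_mono)
  qed
  ultimately show ?thesis
    by blast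
qed

lemma voc_diff:
  assumes "forcing r" "forcing r'" "voc r z" "voc r' z'"
  shows "voc (\<lambda>s. r s - r' s) (\<lambda>s. z s - z' s)"
  using assms Y_integrable[OF assms(1)] Y_integrable[OF assms(2)] unfolding voc_def
  by (simp add: Y_simps Henstock_Kurzweil_Integration.integral_diff)

lemma linear_bounded_le:
  assumes r: "forcing r" and z: "voc r z" and m: "\<And>s. S (r s) \<le> m" and B: "\<And>s. S (z s) \<le> B"
  shows "S (z t) \<le> 2 * K * m / \<alpha>"
proof -
  have m0: "m \<ge> 0"
    using order_trans[OF S_nonneg m] .
  show ?thesis
    using a_priori[OF r voc_jump_no_jump[OF z], where \<beta> = 0 and \<rho> = "\<lambda>_. 1" and \<kappa> = 0 and c = m and B = B and t = t]
      \<alpha> K m m0 B by (simp add: S_zero)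
qed

text \<open>
  The Lipschitz condition is for the norm \<open>S\<close> of the dichotomy, since \<open>\<kappa>\<close> enters the smallness
  condition, while the Euclidean Lipschitz constants only need to be finite.
\<close>

definition perturbation :: "real \<Rightarrow> (real \<Rightarrow> 'a \<Rightarrow> 'a) \<Rightarrow> bool" where
  "perturbation \<kappa> G \<longleftrightarrow>
     (\<forall>z. (\<lambda>t. G t z) \<in> borel_measurable lebesgue) \<and>
     (\<forall>t z z'. S (G t z - G t z') \<le> \<kappa> * S (z - z')) \<and>
     (\<exists>c. \<forall>t. S (G t 0) \<le> c)"

lemma perturbation_caratheodory:
  assumes G: "perturbation \<kappa> G" and \<kappa>: "\<kappa> \<ge> 0"
  obtains L where "caratheodory G L"
proof -
  obtain c where c: "c > 0" "\<And>v. norm v \<le> c * S v"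
    using norm_le_S by blast
  obtain d where d: "d > 0" "\<And>v. S v \<le> d * norm v"
    using S_le_norm by blast
  obtain e where e: "\<And>t. S (G t 0) \<le> e"
    using G unfolding perturbation_def by blast
  have "norm (G t z - G t z') \<le> (c * \<kappa> * d + 1) * norm (z - z')" for t z z'
  proof -
    have "norm (G t z - G t z') \<le> c * (\<kappa> * (d * norm (z - z')))"
    proof (rule order_trans[OF c(2)], rule mult_left_mono)
      show "S (G t z - G t z') \<le> \<kappa> * (d * norm (z - z'))"
        using G \<kappa> d(2) unfolding perturbation_def by (meson mult_left_mono order_trans)
    qed (use c in auto)
    then show ?thesis
      by (simp add: distrib_right mult.assoc add_increasing2)
  qed
  moreover have "norm (G t 0) \<le> c * e" for t
    using order_trans[OF c(2) mult_left_mono[OF e]] c(1) by simp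
  moreover have "c * \<kappa> * d + 1 > 0"
    using c d \<kappa> by (simp add: add_nonneg_pos)
  ultimately have "caratheodory G (c * \<kappa> * d + 1)"
    using G unfolding caratheodory_def perturbation_def by blast
  then show ?thesis
    by (rule that)
qed

definition field :: "(real \<Rightarrow> 'a \<Rightarrow> 'a) \<Rightarrow> real \<Rightarrow> 'a \<Rightarrow> 'a" where
  "field G t z = C t z + G t z"

lemma field_caratheodory:
  assumes G: "perturbation \<kappa> G" and \<kappa>: "\<kappa> \<ge> 0"
  obtains L where "caratheodory (field G) L"
proof -
  obtain L where L: "caratheodory G L"
    using perturbation_caratheodory[OF assms] by blast
  obtain c where c: "\<And>t. norm (G t 0) \<le> c"
    using L unfolding caratheodory_def by blast
  have "norm (field G t z - field G t z') \<le> (\<Lambda> + L) * norm (z - z')" for t z z'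
  proof -
    have "norm (G t z - G t z') \<le> L * norm (z - z')"
      using L by (simp add: caratheodory_def)
    from norm_triangle_mono[OF norm_C_diff[of t z z'] this] show ?thesis
      by (simp add: field_def algebra_simps)
  qed
  moreover have "norm (field G t 0) \<le> c" for t
    using c[of t] by (simp add: field_def linear_0[OF linear_C])
  moreover have "(\<lambda>t. field G t z) \<in> borel_measurable lebesgue" for z
    using C L unfolding field_def caratheodory_def by (intro borel_measurable_add) auto
  moreover have "\<Lambda> + L > 0"
    using C L unfolding caratheodory_def by linarith
  ultimately have "caratheodory (field G) (\<Lambda> + L)"
    unfolding caratheodory_def by blast
  then show ?thesis
    by (rule that)
qed

lemma perturbation_forcing:
  assumes G: "perturbation \<kappa> G" and \<kappa>: "\<kappa> \<ge> 0" and z: "continuous_on UNIV z"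
  shows "forcing (\<lambda>s. G s (z s))"
proof -
  obtain L where "caratheodory G L"
    using perturbation_caratheodory[OF G \<kappa>] by blast
  from caratheodory_forcing[OF this forcing_continuous[OF z]] show ?thesis .
qed

lemma solution_field_iff_voc:
  assumes G: "perturbation \<kappa> G" and \<kappa>: "\<kappa> \<ge> 0"
  shows "solution (field G) z \<longleftrightarrow> continuous_on UNIV z \<and> voc (\<lambda>s. G s (z s)) z"
proof -
  obtain L where L: "caratheodory (field G) L"
    using field_caratheodory[OF G \<kappa>] by blast
  have sol: "solution (field G) z \<longleftrightarrow> continuous_on UNIV z \<and>
      (\<forall>a b. a \<le> b \<longrightarrow> z b = z a + integral {a..b} (\<lambda>s. C s (z s) + G s (z s)))"
    unfolding caratheodory_solution_iff[OF L] field_def ..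
  show ?thesis
  proof (cases "continuous_on UNIV z")
    case True
    note r = perturbation_forcing[OF G \<kappa> True]
    show ?thesis
      unfolding sol using True voc_imp_integral_equation[OF r] integral_equation_imp_voc[OF r True]
      by metis
  qed (simp add: sol)
qed

text \<open>
  The right-hand side defines a contraction for the supremum of \<open>S\<close>; for the Euclidean supremum
  only a high power of it is one, as the two norms differ by a factor.
\<close>

lemma nonlinear_bounded_exists:
  assumes G: "perturbation \<kappa> G" and \<kappa>: "\<kappa> \<ge> 0" "2 * K * \<kappa> < \<alpha>"
  shows "\<exists>h. continuous_on UNIV h \<and> voc (\<lambda>s. G s (h s)) h \<and> (\<exists>B. \<forall>t. S (h t) \<le> B)"
proof -
  obtain c where c: "c > 0" "\<And>v. norm v \<le> c * S v"
    using norm_le_S by blast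
  obtain d where d: "d > 0" "\<And>v. S v \<le> d * norm v"
    using S_le_norm by blast
  obtain e where e: "\<And>t. S (G t 0) \<le> e"
    using G unfolding perturbation_def by blast
  have lip: "\<And>t z z'. S (G t z - G t z') \<le> \<kappa> * S (z - z')"
    using G by (simp add: perturbation_def)
  define r where "r h s = G s (apply_bcontfun h s)" for h s
  have r: "forcing (r h)" for h
    unfolding r_def by (rule perturbation_forcing[OF G \<kappa>(1)]) simp
  have r_le: "S (r h s) \<le> \<kappa> * (d * norm h) + e" for h s
  proof -
    have "S (r h s) \<le> S (r h s - G s 0) + S (G s 0)"
      using S_triangle[of "r h s - G s 0" "G s 0"] by simp
    also have "S (r h s - G s 0) \<le> \<kappa> * S (h s)"
      using lip[of s "h s" 0] by (simp add: r_def)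
    also have "\<kappa> * S (h s) \<le> \<kappa> * (d * norm h)"
      using order_trans[OF d(2) mult_left_mono[OF norm_bounded]] d(1) \<kappa>(1) by (intro mult_left_mono) auto
    finally show ?thesis
      using e[of s] by simp
  qed
  have "\<exists>g. voc (r h) (apply_bcontfun g)" for h
  proof -
    obtain g B where g: "voc (r h) g" "\<And>t. S (g t) \<le> B"
      using linear_bounded_exists[OF r r_le] by blast
    have "norm (g t) \<le> c * B" for t
      using order_trans[OF c(2) mult_left_mono[OF g(2)]] c(1) by simp
    then have "g \<in> bcontfun"
      by (intro bcontfun_normI voc_continuous[OF r g(1)])
    then show ?thesis
      using g(1) by (metis bcontfunE)
  qed
  then obtain T :: "(real \<Rightarrow>\<^sub>C 'a) \<Rightarrow> real \<Rightarrow>\<^sub>C 'a" where T: "\<And>h. voc (r h) (apply_bcontfun (T h))"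
    by metis
  define \<theta> where "\<theta> = 2 * K * \<kappa> / \<alpha>"
  have \<theta>: "0 \<le> \<theta>" "\<theta> < 1"
    using \<kappa> K \<alpha> by (auto simp: \<theta>_def)
  have contr: "S (T h t - T g t) \<le> \<theta> * m" if "\<And>s. S (h s - g s) \<le> m"
    for h g :: "real \<Rightarrow>\<^sub>C 'a" and m t
  proof -
    have "S (T h t - T g t) \<le> 2 * K * (\<kappa> * m) / \<alpha>"
    proof (rule linear_bounded_le[OF forcing_diff[OF r r] voc_diff[OF r r T T]])
      show "S (r h s - r g s) \<le> \<kappa> * m" for s
        using order_trans[OF lip mult_left_mono[OF that \<kappa>(1)]] by (simp add: r_def)
      show "S (T h s - T g s) \<le> d * norm (T h - T g)" for s
        using order_trans[OF d(2) mult_left_mono[OF norm_bounded[of "T h - T g" s]]] d(1)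
        by (simp add: minus_bcontfun.rep_eq)
    qed
    then show ?thesis
      by (simp add: \<theta>_def)
  qed
  have iter: "S ((T ^^ n) h t - (T ^^ n) g t) \<le> \<theta> ^ n * (d * dist h g)"
    for n t and h g :: "real \<Rightarrow>\<^sub>C 'a"
  proof (induction n arbitrary: t)
    case 0
    have "S (h t - g t) \<le> d * dist (h t) (g t)"
      using d(2) by (simp add: dist_norm)
    also have "\<dots> \<le> d * dist h g"
      using d(1) by (intro mult_left_mono dist_bounded) simp
    finally show ?case
      by simp
  next
    case (Suc n)
    show ?case
      using contr[OF Suc] by (simp add: mult.assoc)
  qed
  have "(\<lambda>n. (c * d) * \<theta> ^ n) \<longlonglongrightarrow> (c * d) * 0"
    using \<theta> by (intro tendsto_intros LIMSEQ_realpow_zero)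
  then have "\<forall>\<^sub>F n in sequentially. (c * d) * \<theta> ^ n < 1"
    by (rule order_tendstoD(2)) simp
  then obtain n where n: "(c * d) * \<theta> ^ n < 1"
    using eventually_happens by fastforce
  have "\<exists>!h. (T ^^ n) h = h"
  proof (rule banach_fix_type[where c = "c * d * \<theta> ^ n"])
    show "\<forall>h g. dist ((T ^^ n) h) ((T ^^ n) g) \<le> c * d * \<theta> ^ n * dist h g"
    proof (intro allI dist_bound)
      fix h g t
      have "norm ((T ^^ n) h t - (T ^^ n) g t) \<le> c * (\<theta> ^ n * (d * dist h g))"
        using order_trans[OF c(2) mult_left_mono[OF iter]] c(1) by simp
      then show "dist ((T ^^ n) h t) ((T ^^ n) g t) \<le> c * d * \<theta> ^ n * dist h g"
        by (simp add: dist_norm mult_ac)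
    qed
  qed (use n c d \<theta> in auto)
  then obtain h where h: "(T ^^ n) h = h" "\<And>g. (T ^^ n) g = g \<Longrightarrow> g = h"
    by metis
  have "(T ^^ n) (T h) = T h"
    using h(1) by (metis funpow_swap1)
  then have "T h = h"
    by (rule h(2))
  then have "voc (\<lambda>s. G s (h s)) (apply_bcontfun h)"
    using T[of h] by (simp add: r_def[abs_def])
  moreover have "S (h t) \<le> d * norm h" for t
    using order_trans[OF d(2) mult_left_mono[OF norm_bounded]] d(1) by simp
  ultimately show ?thesis
    using continuous_on_apply_bcontfun by blast
qed

end

section \<open>Shadowing\<close>

locale small_perturbations = dichotomy +
  fixes \<kappa> :: real
  assumes \<kappa>: "\<kappa> \<ge> 0" "2 * K * \<kappa> < \<alpha>"
begin

abbreviation pert where "pert \<equiv> perturbation \<kappa>"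

lemma pert_lip: "pert G \<Longrightarrow> S (G t z - G t z') \<le> \<kappa> * S (z - z')"
  by (simp add: perturbation_def)

lemmas pert_field = field_caratheodory[OF _ \<kappa>(1)]
lemmas pert_forcing = perturbation_forcing[OF _ \<kappa>(1)]
lemmas pert_solution_iff = solution_field_iff_voc[OF _ \<kappa>(1)]

lemma pert_forcing': "pert G \<Longrightarrow> forcing z \<Longrightarrow> forcing (\<lambda>s. G s (z s))"
  using perturbation_caratheodory[OF _ \<kappa>(1)] caratheodory_forcing by metis

lemma pert_solution_forcing: "pert G \<Longrightarrow> solution (field G) z \<Longrightarrow> forcing (\<lambda>s. G s (z s))"
  by (rule pert_forcing) (auto dest: solution_continuous)

lemma pert_solution_voc: "pert G \<Longrightarrow> solution (field G) z \<Longrightarrow> voc (\<lambda>s. G s (z s)) z"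
  by (simp add: pert_solution_iff)

lemma zero_solution:
  assumes "pert G" "\<And>t. G t 0 = 0"
  shows "solution (field G) (\<lambda>t. 0)"
  using assms by (simp add: pert_solution_iff voc_def Y_simps)

definition fwd_bdd :: "(real \<Rightarrow> 'a) \<Rightarrow> bool" where
  "fwd_bdd z \<longleftrightarrow> (\<exists>B. \<forall>t\<ge>0. S (z t) \<le> B)"

definition bwd_bdd :: "(real \<Rightarrow> 'a) \<Rightarrow> bool" where
  "bwd_bdd z \<longleftrightarrow> (\<exists>B. \<forall>t\<le>0. S (z t) \<le> B)"

lemma continuous_S_bounded:
  fixes z :: "real \<Rightarrow> 'a"
  assumes "continuous_on UNIV z"
  obtains B where "\<And>t. \<bar>t\<bar> \<le> R \<Longrightarrow> S (z t) \<le> B"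
proof -
  obtain d where d: "d > 0" "\<And>v. S v \<le> d * norm v"
    using S_le_norm by blast
  obtain M where M: "\<And>s. \<bar>s\<bar> \<le> R \<Longrightarrow> norm (z s) \<le> M"
    using forcing_bound[OF forcing_continuous[OF assms]] by blast
  have "S (z t) \<le> d * M" if "\<bar>t\<bar> \<le> R" for t
    using order_trans[OF d(2) mult_left_mono[OF M[OF that]]] d(1) by simp
  then show ?thesis
    by (rule that)
qed

lemma fwd_bdd_from:
  assumes "continuous_on UNIV z" "fwd_bdd z"
  obtains B where "\<And>t. t \<ge> \<tau> \<Longrightarrow> S (z t) \<le> B"
proof -
  obtain B where B: "\<And>t. t \<ge> 0 \<Longrightarrow> S (z t) \<le> B"
    using assms(2) unfolding fwd_bdd_def by blast
  obtain B' where B': "\<And>t. \<bar>t\<bar> \<le> \<bar>\<tau>\<bar> \<Longrightarrow> S (z t) \<le> B'"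
    using continuous_S_bounded[OF assms(1)] by blast
  show ?thesis
  proof (rule that[of "max B B'"])
    fix t assume "t \<ge> \<tau>"
    then show "S (z t) \<le> max B B'"
      using B[of t] B'[of t] by (cases "t \<ge> 0") (auto simp: le_max_iff_disj)
  qed
qed

lemma bwd_bdd_from:
  assumes "continuous_on UNIV z" "bwd_bdd z"
  obtains B where "\<And>t. t \<le> \<tau> \<Longrightarrow> S (z t) \<le> B"
proof -
  obtain B where B: "\<And>t. t \<le> 0 \<Longrightarrow> S (z t) \<le> B"
    using assms(2) unfolding bwd_bdd_def by blast
  obtain B' where B': "\<And>t. \<bar>t\<bar> \<le> \<bar>\<tau>\<bar> \<Longrightarrow> S (z t) \<le> B'"
    using continuous_S_bounded[OF assms(1)] by blast
  show ?thesis
  proof (rule that[of "max B B'"])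
    fix t assume "t \<le> \<tau>"
    then show "S (z t) \<le> max B B'"
      using B[of t] B'[of t] by (cases "t \<le> 0") (auto simp: le_max_iff_disj)
  qed
qed

text \<open>
  The functions \<open>p\<close> and \<open>m\<close> will be solutions of equations at bounded distance from that of \<open>q\<close>. This one
  relation describes the splitting of a solution into half-bounded parts, where one of \<open>p\<close> and \<open>m\<close> is
  zero, as well as the recovery of the solution from its parts.
\<close>

definition shadows where
  "shadows F p m q \<longleftrightarrow> solution (field F) q \<and> fwd_bdd (\<lambda>t. q t - p t) \<and> bwd_bdd (\<lambda>t. q t - m t)"

abbreviation glue :: "real \<Rightarrow> (real \<Rightarrow> 'a) \<Rightarrow> (real \<Rightarrow> 'a) \<Rightarrow> real \<Rightarrow> 'a" where
  "glue \<tau> p m \<equiv> (\<lambda>t. if t \<ge> \<tau> then p t else m t)"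

abbreviation "glue_along \<tau> Gp p Gm m \<equiv> glue \<tau> (\<lambda>s. Gp s (p s)) (\<lambda>s. Gm s (m s))"

lemma voc_jump_glue:
  assumes r: "forcing rp" "forcing rm" "forcing rq" and voc: "voc rp p" "voc rm m" "voc rq q"
  shows "voc_jump \<tau> (m \<tau> - p \<tau>) (\<lambda>s. rq s - glue \<tau> rp rm s) (\<lambda>t. q t - glue \<tau> p m t)"
  unfolding voc_jump_def
proof (intro allI impI)
  fix a b :: real assume ab: "a \<le> b"
  let ?I = "\<lambda>r a b. integral {a..b} (\<lambda>s. Y s (r s))"
  have int: "(\<lambda>s. Y s (rp s)) integrable_on {a..b}" "(\<lambda>s. Y s (rm s)) integrable_on {a..b}"
    "(\<lambda>s. Y s (rq s)) integrable_on {a..b}" "(\<lambda>s. Y s (glue \<tau> rp rm s)) integrable_on {a..b}" for a b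
    using Y_integrable[OF r(1)] Y_integrable[OF r(2)] Y_integrable[OF r(3)]
      Y_integrable[OF forcing_if[OF r(1,2)]] by auto
  have V: "Y b (p b) = Y a (p a) + ?I rp a b" "Y b (m b) = Y a (m a) + ?I rm a b"
    "Y b (q b) = Y a (q a) + ?I rq a b" if "a \<le> b" for a b
    using voc that by (auto simp: voc_def)
  have split: "?I (\<lambda>s. rq s - glue \<tau> rp rm s) a b = ?I rq a b - ?I (glue \<tau> rp rm) a b" for a b
    using int by (simp add: Y_simps Henstock_Kurzweil_Integration.integral_diff)
  have right: "?I (glue \<tau> rp rm) a b = ?I rp a b" if "\<tau> \<le> a" for a b
    using that by (intro Henstock_Kurzweil_Integration.integral_cong) auto
  have left: "?I (glue \<tau> rp rm) a b = ?I rm a b" if "b \<le> \<tau>" for a b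
    using that by (intro integral_spike[of "{\<tau>}"]) auto
  consider "\<tau> \<le> a" | "b < \<tau>" | "a < \<tau>" "\<tau> \<le> b"
    by linarith
  then show "Y b (q b - glue \<tau> p m b) = Y a (q a - glue \<tau> p m a) +
      ?I (\<lambda>s. rq s - glue \<tau> rp rm s) a b + (if a < \<tau> \<and> \<tau> \<le> b then Y \<tau> (m \<tau> - p \<tau>) else 0)"
  proof cases
    case 1
    then show ?thesis
      unfolding split using V[OF ab] ab by (simp add: right Y_simps)
  next
    case 2
    then show ?thesis
      unfolding split using V[OF ab] ab by (simp add: left Y_simps)
  next
    case 3
    have "?I (glue \<tau> rp rm) a b = ?I (glue \<tau> rp rm) a \<tau> + ?I (glue \<tau> rp rm) \<tau> b"
      using 3 by (intro Henstock_Kurzweil_Integration.integral_combine[symmetric] int) auto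
    also have "\<dots> = ?I rm a \<tau> + ?I rp \<tau> b"
      by (simp only: left[OF order_refl] right[OF order_refl])
    finally have "?I (glue \<tau> rp rm) a b = ?I rm a \<tau> + ?I rp \<tau> b" .
    then show ?thesis
      using V(1)[of \<tau> b] V(2)[of a \<tau>] V(3)[OF ab] 3 unfolding split by (simp add: Y_simps)
  qed
qed

lemma glue_nonlinearity_le:
  assumes F: "pert F" and near: "\<And>t z. S (F t z - Gp t z) \<le> c" "\<And>t z. S (F t z - Gm t z) \<le> c"
  shows "S (F s z - glue_along \<tau> Gp p Gm m s) \<le> \<kappa> * S (z - glue \<tau> p m s) + c"
proof -
  let ?w = "glue \<tau> p m s"
  have "S (F s z - glue_along \<tau> Gp p Gm m s)
      \<le> S (F s z - F s ?w) + S (F s ?w - glue_along \<tau> Gp p Gm m s)"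
    using S_triangle[of "F s z - F s ?w" "F s ?w - glue_along \<tau> Gp p Gm m s"]
    by simp
  also have "\<dots> \<le> \<kappa> * S (z - ?w) + c"
    using pert_lip[OF F] near by (intro add_mono) auto
  finally show ?thesis .
qed

context
  fixes F Gp Gm c p m
  assumes pert: "pert F" "pert Gp" "pert Gm"
    and near: "\<And>t z. S (F t z - Gp t z) \<le> c" "\<And>t z. S (F t z - Gm t z) \<le> c"
    and p: "solution (field Gp) p" and m: "solution (field Gm) m"
begin

text \<open>
  The difference between \<open>q\<close> and the glued function should be bounded and have the jump
  \<open>\<xi> = m 0 - p 0\<close>. The bounded linear solution with this jump is \<open>X(t) P \<xi>\<close> for \<open>t \<ge> 0\<close> and \<open>- X(t) Q \<xi>\<close> for
  \<open>t < 0\<close>. Adding it makes the glued function continuous, and what remains is a bounded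
  solution of a nonlinear equation, which the contraction principle provides.
\<close>

lemma shadow_exists: "\<exists>q. shadows F p m q"
proof -
  define \<xi> where "\<xi> = m 0 - p 0"
  define b where "b = glue 0 (\<lambda>t. p t + X t (P \<xi>)) (\<lambda>t. m t - X t (Q \<xi>))"
  have b0: "p 0 + P \<xi> = m 0 - Q \<xi>"
    using P_Q[of \<xi>] by (simp add: \<xi>_def algebra_simps)
  have Xc: "continuous_on UNIV (\<lambda>t. X t v)" for v
    by (rule solution_continuous[OF solution_X])
  have bf: "forcing b"
    unfolding b_def using p m
    by (intro forcing_if forcing_continuous continuous_intros Xc) (auto dest: solution_continuous)
  define r where "r = glue_along 0 Gp p Gm m"
  have rf: "forcing r"
    unfolding r_def using pert p m by (intro forcing_if pert_solution_forcing)
  define k where "k t h = F t (b t + h) - r t" for t h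
  have "pert k"
    unfolding perturbation_def
  proof (intro conjI allI exI)
    fix z
    have "forcing (\<lambda>t. F t (b t + z))"
      by (intro pert_forcing'[OF pert(1)] forcing_add bf forcing_continuous continuous_on_const)
    then show "(\<lambda>t. k t z) \<in> borel_measurable lebesgue"
      using rf unfolding k_def forcing_def by (intro borel_measurable_diff) auto
  next
    fix t z z'
    show "S (k t z - k t z') \<le> \<kappa> * S (z - z')"
      using pert_lip[OF pert(1), of t "b t + z" "b t + z'"] by (simp add: k_def)
  next
    fix t
    have "S (b t - glue 0 p m t) \<le> K * S \<xi>"
      using stable_bounded unstable_bounded by (auto simp: b_def S_minus)
    then have "\<kappa> * S (b t - glue 0 p m t) + c \<le> \<kappa> * (K * S \<xi>) + c"
      using \<kappa>(1) by (intro add_right_mono mult_left_mono)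
    then show "S (k t 0) \<le> \<kappa> * (K * S \<xi>) + c"
      using glue_nonlinearity_le[OF pert(1) near, of t "b t" 0 p m] by (simp add: k_def r_def)
  qed
  then obtain h B where h: "continuous_on UNIV h" "voc (\<lambda>s. k s (h s)) h" "\<And>t. S (h t) \<le> B"
    using nonlinear_bounded_exists[OF _ \<kappa>] by blast
  define q where "q t = b t + h t" for t
  have qf: "forcing q"
    unfolding q_def by (intro forcing_add bf forcing_continuous h)
  have Ff: "forcing (\<lambda>s. F s (q s))"
    by (rule pert_forcing'[OF pert(1) qf])
  have kf: "forcing (\<lambda>s. k s (h s))"
    using forcing_diff[OF Ff rf] by (simp add: k_def q_def)
  have pv: "voc (\<lambda>s. Gp s (p s)) p" and mv: "voc (\<lambda>s. Gm s (m s)) m"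
    using pert p m by (auto intro: pert_solution_voc)
  let ?I = "\<lambda>r a b. integral {a..b} (\<lambda>s. Y s (r s))"
  have Fr: "?I (\<lambda>s. F s (q s)) a b = ?I (\<lambda>s. k s (h s)) a b + ?I r a b" for a b
    unfolding Henstock_Kurzweil_Integration.integral_add[OF Y_integrable[OF kf] Y_integrable[OF rf], symmetric]
    by (simp add: k_def q_def flip: linear_add[OF linear_Y])
  have "Y t (q t) = (p 0 + P \<xi> + h 0) + oriented_integral 0 t (\<lambda>s. Y s (F s (q s)))" for t
  proof (cases "t \<ge> 0")
    case True
    have "?I r 0 t = ?I (\<lambda>s. Gp s (p s)) 0 t"
      unfolding r_def by (intro Henstock_Kurzweil_Integration.integral_cong) auto
    moreover have "Y t (p t) = p 0 + ?I (\<lambda>s. Gp s (p s)) 0 t" "Y t (h t) = h 0 + ?I (\<lambda>s. k s (h s)) 0 t"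
      using pv h(2) True unfolding voc_def by fastforce+
    ultimately show ?thesis
      using True by (simp add: oriented_integral_simps Fr q_def[of t] b_def Y_simps)
  next
    case False
    then have t: "t \<le> 0" by simp
    have "?I r t 0 = ?I (\<lambda>s. Gm s (m s)) t 0"
      unfolding r_def by (intro integral_spike[of "{0}"]) auto
    moreover have "m 0 = Y t (m t) + ?I (\<lambda>s. Gm s (m s)) t 0" "h 0 = Y t (h t) + ?I (\<lambda>s. k s (h s)) t 0"
      using mv h(2) t unfolding voc_def by fastforce+
    ultimately show ?thesis
      using False t by (simp add: oriented_integral_simps Fr q_def[of t] b_def Y_simps b0)
  qed
  then have "voc (\<lambda>s. F s (q s)) q"
    by (rule voc_from_initial[OF Ff])
  then have "solution (field F) q"
    using voc_continuous[OF Ff] by (simp add: pert_solution_iff[OF pert(1)])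
  moreover have "S (q t - p t) \<le> K * S \<xi> + B" if "t \<ge> 0" for t
    using S_triangle[of "X t (P \<xi>)" "h t"] stable_bounded[OF that, of \<xi>] h(3)[of t] that
    by (simp add: q_def b_def)
  moreover have "S (q t - m t) \<le> K * S \<xi> + B" if "t \<le> 0" for t
  proof -
    have "q t - m t = h t - X t (Q \<xi>)"
      using that b0 by (cases "t = 0") (auto simp: q_def b_def)
    then show ?thesis
      using S_diff[of "h t" "X t (Q \<xi>)"] unstable_bounded[OF that, of \<xi>] h(3)[of t] by simp
  qed
  ultimately show ?thesis
    unfolding shadows_def fwd_bdd_def bwd_bdd_def by blast
qed

lemma shadow_bounded:
  assumes q: "shadows F p m q" and cont: "continuous_on UNIV p" "continuous_on UNIV m"
  obtains B where "\<And>t. S (q t - glue \<tau> p m t) \<le> B"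
proof -
  have qc: "continuous_on UNIV q"
    using q unfolding shadows_def by (auto dest: solution_continuous)
  obtain B1 where "\<And>t. t \<ge> \<tau> \<Longrightarrow> S (q t - p t) \<le> B1"
    using q fwd_bdd_from[OF continuous_on_diff[OF qc cont(1)]] unfolding shadows_def by blast
  moreover obtain B2 where "\<And>t. t \<le> \<tau> \<Longrightarrow> S (q t - m t) \<le> B2"
    using q bwd_bdd_from[OF continuous_on_diff[OF qc cont(2)]] unfolding shadows_def by blast
  ultimately show ?thesis
    by (intro that[of "max B1 B2"]) (auto simp: le_max_iff_disj)
qed

text \<open>
  Since the bound holds for every gluing time \<open>\<tau>\<close> with the same constants, it compares the solutions at each
  time \<open>\<tau>\<close> with their own values at \<open>\<tau>\<close>; this is what makes the conjugacy uniformly proper.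
\<close>

lemma shadow_estimate:
  assumes q: "shadows F p m q"
  shows "S (q t - glue \<tau> p m t) \<le> (K * \<alpha> * S (m \<tau> - p \<tau>) + 2 * K * c) / (\<alpha> - 2 * K * \<kappa>)"
proof -
  have qs: "solution (field F) q"
    using q by (simp add: shadows_def)
  obtain B where B: "\<And>t. S (q t - glue \<tau> p m t) \<le> B"
    using shadow_bounded[OF q] p m by (auto dest: solution_continuous)
  have c: "c \<ge> 0"
    using order_trans[OF S_nonneg near(1)] .
  note forc = pert_solution_forcing[OF pert(2) p] pert_solution_forcing[OF pert(3) m] pert_solution_forcing[OF pert(1) qs]
  let ?w = "\<lambda>t. q t - glue \<tau> p m t"
  let ?r = "\<lambda>s. F s (q s) - glue_along \<tau> Gp p Gm m s"
  have "S (?w t) \<le> 1 * ((K * (\<alpha> - 0) * (S (m \<tau> - p \<tau>) / 1) + 2 * K * c) / (\<alpha> - 0 - 2 * K * \<kappa>))"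
  proof (rule a_priori[where w = ?w and r = ?r and \<rho> = "\<lambda>_. 1" and B = B])
    show "voc_jump \<tau> (m \<tau> - p \<tau>) ?r ?w"
      by (intro voc_jump_glue forc pert_solution_voc pert p m qs)
    show "forcing ?r"
      by (intro forcing_diff forcing_if forc)
    show "S (?r s) \<le> \<kappa> * S (?w s) + c * 1" for s
      using glue_nonlinearity_le[OF pert(1) near, of s "q s" \<tau> p m] by simp
    show "S (?w s) \<le> B * 1" for s
      using B[of s] by simp
  qed (use \<alpha> \<kappa> c in auto)
  then show ?thesis
    by simp
qed

end

end

context small_perturbations
begin

text \<open>
  Halfway into the room that the smallness condition leaves: an exponential weight with this rate
  keeps the a priori bound.
\<close>

definition rate :: real where "rate = (\<alpha> - 2 * K * \<kappa>) / 2"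

lemma rate: "0 < rate" "rate < \<alpha>" "2 * K * \<kappa> < \<alpha> - rate"
proof -
  have "K * \<kappa> \<ge> 0"
    using K \<kappa>(1) by simp
  then show "0 < rate" "rate < \<alpha>" "2 * K * \<kappa> < \<alpha> - rate"
    using \<kappa>(2) \<alpha> unfolding rate_def by (simp_all add: field_simps)
qed

text \<open>
  The solutions shadowed may separate exponentially, so the shadows are not close on the
  whole line. In the norm with weight \<open>exp (- rate * \<bar>t\<bar>)\<close> they are: on a large compact interval
  this is continuity of the flow, and outside of it the a priori bounds suffice.
\<close>

lemma shadow_tendsto:
  fixes p' m' q' :: "nat \<Rightarrow> real \<Rightarrow> 'a"
  assumes pert: "pert F" "pert Gp" "pert Gm"
    and near: "\<And>t z. S (F t z - Gp t z) \<le> c" "\<And>t z. S (F t z - Gm t z) \<le> c"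
    and p: "solution (field Gp) p" and m: "solution (field Gm) m" and q: "shadows F p m q"
    and p': "\<And>n. solution (field Gp) (p' n)" and m': "\<And>n. solution (field Gm) (m' n)"
    and q': "\<And>n. shadows F (p' n) (m' n) (q' n)"
    and lim: "(\<lambda>n. p' n 0) \<longlonglongrightarrow> p 0" "(\<lambda>n. m' n 0) \<longlonglongrightarrow> m 0"
  shows "(\<lambda>n. q' n 0) \<longlonglongrightarrow> q 0"
proof -
  have c: "c \<ge> 0"
    using order_trans[OF S_nonneg near(1)] .
  obtain d where d: "d > 0" "\<And>v. S v \<le> d * norm v"
    using S_le_norm by blast
  obtain Lp where Lp: "caratheodory (field Gp) Lp"
    using pert_field[OF pert(2)] by blast
  obtain Lm where Lm: "caratheodory (field Gm) Lm"
    using pert_field[OF pert(3)] by blast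
  define L where "L = max Lp Lm"
  have L: "Lp \<le> L" "Lm \<le> L"
    by (auto simp: L_def)
  define D where "D = \<alpha> - rate - 2 * K * \<kappa>"
  have D: "D > 0"
    using rate by (simp add: D_def)
  define \<xi> where "\<xi> n = (m' n 0 - p' n 0) - (m 0 - p 0)" for n
  have "\<xi> \<longlonglongrightarrow> (m 0 - p 0) - (m 0 - p 0)"
    unfolding \<xi>_def by (intro tendsto_intros lim)
  from S_tendsto[OF this] have S\<xi>: "(\<lambda>n. S (\<xi> n)) \<longlonglongrightarrow> 0"
    by (simp add: S_zero)
  have "convergent (\<lambda>n. m' n 0 - p' n 0)"
    using tendsto_diff[OF lim(2,1)] by (auto simp: convergent_def)
  then have "Bseq (\<lambda>n. m' n 0 - p' n 0)"
    by (rule convergent_imp_Bseq)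
  then obtain e0 where e0: "\<And>n. norm (m' n 0 - p' n 0) \<le> e0"
    by (rule BseqE) blast
  define e where "e = max (d * e0) (S (m 0 - p 0))"
  have "S (m' n 0 - p' n 0) \<le> d * e0" for n
    using order_trans[OF d(2) mult_left_mono[OF e0]] d(1) by simp
  then have e: "S (m' n 0 - p' n 0) \<le> e" "S (m 0 - p 0) \<le> e" for n
    by (simp_all add: e_def le_max_iff_disj)
  define Bd where "Bd = (K * \<alpha> * e + 2 * K * c) / (\<alpha> - 2 * K * \<kappa>)"
  have est: "(K * \<alpha> * x + 2 * K * c) / (\<alpha> - 2 * K * \<kappa>) \<le> Bd" if "x \<le> e" for x
    unfolding Bd_def using that K \<alpha> \<kappa> by (intro divide_right_mono add_right_mono mult_left_mono) auto
  define wq where "wq t = q t - glue 0 p m t" for t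
  define wq' where "wq' n t = q' n t - glue 0 (p' n) (m' n) t" for n t
  have wq: "S (wq t) \<le> Bd" for t
    unfolding wq_def using order_trans[OF shadow_estimate[OF pert near p m q] est[OF e(2)]] .
  have wq': "S (wq' n t) \<le> Bd" for n t
    unfolding wq'_def using order_trans[OF shadow_estimate[OF pert near p' m' q'] est[OF e(1)]] .
  define b where "b n t = glue 0 (p' n) (m' n) t - glue 0 p m t" for n t
  define r where "r s = F s (q s) - glue_along 0 Gp p Gm m s" for s
  define r' where "r' n s = F s (q' n s) - glue_along 0 Gp (p' n) Gm (m' n) s" for n s
  define w where "w n t = wq' n t - wq t" for n t
  have qs: "solution (field F) q" "solution (field F) (q' n)" for n
    using q q' by (auto simp: shadows_def)
  note forc = pert_solution_forcing[OF pert(2) p] pert_solution_forcing[OF pert(3) m] pert_solution_forcing[OF pert(1) qs(1)]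
    pert_solution_forcing[OF pert(2) p'] pert_solution_forcing[OF pert(3) m'] pert_solution_forcing[OF pert(1) qs(2)]
  have rf: "forcing r" "forcing (r' n)" for n
    unfolding r_def r'_def by (intro forcing_diff forcing_if forc)+
  have jump: "voc_jump 0 (m 0 - p 0) r wq" "voc_jump 0 (m' n 0 - p' n 0) (r' n) (wq' n)" for n
    unfolding r_def r'_def wq_def wq'_def
    by (intro voc_jump_glue forc pert_solution_voc pert p m qs p' m')+
  have wjump: "voc_jump 0 (\<xi> n) (\<lambda>s. r' n s - r s) (w n)" for n
    using jump Y_integrable[OF rf(1)] Y_integrable[OF rf(2)]
    unfolding voc_jump_def w_def \<xi>_def
    by (auto simp: Y_simps Henstock_Kurzweil_Integration.integral_diff)
  \<comment> \<open>small on compact intervals, as the glued solutions converge there\<close>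
  have r1: "S (r' n s - r s) \<le> \<kappa> * S (w n s) + 2 * \<kappa> * S (b n s)" for n s
  proof -
    let ?g = "glue_along 0 Gp p Gm m s"
    let ?g' = "glue_along 0 Gp (p' n) Gm (m' n) s"
    have g: "S (?g' - ?g) \<le> \<kappa> * S (b n s)"
      using pert_lip[OF pert(2), of s "p' n s" "p s"] pert_lip[OF pert(3), of s "m' n s" "m s"]
      by (simp add: b_def)
    have q_diff: "q' n s - q s = w n s + b n s"
      by (simp add: w_def wq_def wq'_def b_def)
    have "S (F s (q' n s) - F s (q s)) \<le> \<kappa> * S (w n s + b n s)"
      using pert_lip[OF pert(1), of s "q' n s" "q s"] by (simp only: q_diff)
    also have "\<dots> \<le> \<kappa> * (S (w n s) + S (b n s))"
      by (intro mult_left_mono S_triangle \<kappa>)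
    finally have f: "S (F s (q' n s) - F s (q s)) \<le> \<kappa> * (S (w n s) + S (b n s))" .
    have r_diff: "r' n s - r s = (F s (q' n s) - F s (q s)) - (?g' - ?g)"
      by (simp add: r_def r'_def)
    have "S (r' n s - r s) \<le> S (F s (q' n s) - F s (q s)) + S (?g' - ?g)"
      unfolding r_diff by (rule S_diff)
    then show ?thesis
      using f g by (simp add: distrib_left)
  qed
  \<comment> \<open>bounded everywhere, however far the glued solutions separate\<close>
  have r2: "S (r' n s - r s) \<le> 2 * (\<kappa> * Bd + c)" for n s
  proof -
    have "S (r s) \<le> \<kappa> * S (wq s) + c" "S (r' n s) \<le> \<kappa> * S (wq' n s) + c"
      unfolding r_def r'_def wq_def wq'_def by (rule glue_nonlinearity_le[OF pert(1) near])+
    then have "S (r s) \<le> \<kappa> * Bd + c" "S (r' n s) \<le> \<kappa> * Bd + c"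
      using mult_left_mono[OF wq \<kappa>(1), of s] mult_left_mono[OF wq' \<kappa>(1), of n s] by linarith+
    then show ?thesis
      using S_diff[of "r' n s" "r s"] by simp
  qed
  have w_lim: "(\<lambda>n. S (w n 0)) \<longlonglongrightarrow> 0"
  proof (rule tendstoI)
    fix e' :: real assume e': "e' > 0"
    \<comment> \<open>with this choice the forcing contributes e' / 2 to the bound at time 0; the jump will contribute e' / 4\<close>
    define \<epsilon> where "\<epsilon> = e' * D / (4 * K)"
    have \<epsilon>: "\<epsilon> > 0"
      using e' D K by (simp add: \<epsilon>_def)
    obtain R where R: "R > 0" "2 * (\<kappa> * Bd + c) \<le> \<epsilon> * exp (rate * R)"
    proof -
      define R where "R = max 1 (2 * (\<kappa> * Bd + c) / (\<epsilon> * rate))"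
      have "2 * (\<kappa> * Bd + c) / (\<epsilon> * rate) \<le> R"
        by (simp add: R_def)
      then have "2 * (\<kappa> * Bd + c) \<le> \<epsilon> * (rate * R)"
        using \<epsilon> rate(1) by (simp add: pos_divide_le_eq mult_ac)
      also have "\<dots> \<le> \<epsilon> * exp (rate * R)"
        using \<epsilon> exp_ge_add_one_self[of "rate * R"] by (intro mult_left_mono) linarith+
      finally show ?thesis
        by (intro that[of R]) (auto simp: R_def)
    qed
    have "(\<lambda>n. 2 * \<kappa> * d * exp (L * R) * (norm (p' n 0 - p 0) + norm (m' n 0 - m 0)))
        \<longlonglongrightarrow> 2 * \<kappa> * d * exp (L * R) * (norm (p 0 - p 0) + norm (m 0 - m 0))"
      by (intro tendsto_intros lim)
    then have ev1: "\<forall>\<^sub>F n in sequentially.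
        2 * \<kappa> * d * exp (L * R) * (norm (p' n 0 - p 0) + norm (m' n 0 - m 0)) < \<epsilon>"
      using \<epsilon> by (intro order_tendstoD(2)) auto
    have "(\<lambda>n. K * (\<alpha> - rate) * S (\<xi> n)) \<longlonglongrightarrow> K * (\<alpha> - rate) * 0"
      by (intro tendsto_intros S\<xi>)
    then have ev2: "\<forall>\<^sub>F n in sequentially. K * (\<alpha> - rate) * S (\<xi> n) < e' * D / 4"
      using e' D by (intro order_tendstoD(2)) auto
    show "\<forall>\<^sub>F n in sequentially. dist (S (w n 0)) 0 < e'"
      using ev1 ev2
    proof eventually_elim
      case (elim n)
      have b_le: "2 * \<kappa> * S (b n s) \<le> \<epsilon>" if s: "\<bar>s\<bar> \<le> R" for s
      proof -
        let ?N = "norm (p' n 0 - p 0) + norm (m' n 0 - m 0)"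
        have LR: "exp (Lp * \<bar>s\<bar>) \<le> exp (L * R)" "exp (Lm * \<bar>s\<bar>) \<le> exp (L * R)"
          using L s Lp Lm by (auto simp: caratheodory_def intro!: mult_mono)
        have "norm (p' n s - p s) \<le> exp (L * R) * ?N"
          using solution_diff_le[OF Lp p' p, of n s 0]
          by (rule order_trans) (use LR in \<open>simp add: mult_mono\<close>)
        moreover have "norm (m' n s - m s) \<le> exp (L * R) * ?N"
          using solution_diff_le[OF Lm m' m, of n s 0]
          by (rule order_trans) (use LR in \<open>simp add: mult_mono\<close>)
        ultimately have nb: "norm (b n s) \<le> exp (L * R) * ?N"
          by (simp add: b_def)
        have "S (b n s) \<le> d * (exp (L * R) * ?N)"
          using order_trans[OF d(2) mult_left_mono[OF nb]] d(1) by simp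
        then have "2 * \<kappa> * S (b n s) \<le> 2 * \<kappa> * (d * (exp (L * R) * ?N))"
          using \<kappa>(1) by (intro mult_left_mono) auto
        then show ?thesis
          using elim(1) by (simp add: mult.assoc)
      qed
      have rw: "S (r' n s - r s) \<le> \<kappa> * S (w n s) + \<epsilon> * exp (rate * \<bar>s\<bar>)" for s
      proof (cases "\<bar>s\<bar> \<le> R")
        case True
        have "\<epsilon> * 1 \<le> \<epsilon> * exp (rate * \<bar>s\<bar>)"
          using \<epsilon> rate(1) by (intro mult_left_mono) auto
        then show ?thesis
          using r1[of n s] b_le[OF True] by simp
      next
        case False
        have "\<epsilon> * exp (rate * R) \<le> \<epsilon> * exp (rate * \<bar>s\<bar>)"
          using \<epsilon> rate(1) False by (intro mult_left_mono) auto
        moreover have "\<kappa> * S (w n s) \<ge> 0"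
          using \<kappa>(1) S_nonneg by simp
        ultimately show ?thesis
          using r2[of n s] R(2) by linarith
      qed
      have "S (w n 0) \<le> exp (rate * \<bar>0\<bar>) * ((K * (\<alpha> - rate) * (S (\<xi> n) / exp (rate * \<bar>0\<bar>)) + 2 * K * \<epsilon>) / (\<alpha> - rate - 2 * K * \<kappa>))"
      proof (rule a_priori[where w = "w n" and \<tau> = 0 and \<rho> = "\<lambda>t. exp (rate * \<bar>t\<bar>)" and B = "2 * Bd"])
        show "forcing (\<lambda>s. r' n s - r s)"
          by (intro forcing_diff rf)
        show "S (w n s) \<le> 2 * Bd * exp (rate * \<bar>s\<bar>)" for s
        proof -
          have "S (w n s) \<le> 2 * Bd"
            using S_diff[of "wq' n s" "wq s"] wq[of s] wq'[of n s] by (simp add: w_def)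
          also have "2 * Bd * 1 \<le> 2 * Bd * exp (rate * \<bar>s\<bar>)"
            using rate(1) order_trans[OF S_nonneg wq[of 0]] by (intro mult_left_mono) auto
          finally show ?thesis by simp
        qed
        show "exp (rate * \<bar>s\<bar>) \<le> exp (rate * \<bar>t\<bar>) * exp (rate * \<bar>t - s\<bar>)" for s t
          using rate(1) mult_left_mono[of "\<bar>s\<bar>" "\<bar>t\<bar> + \<bar>t - s\<bar>" rate] by (simp add: exp_add[symmetric] distrib_left)
      qed (use wjump rw rate \<kappa> \<epsilon> in auto)
      then have "S (w n 0) \<le> (K * (\<alpha> - rate) * S (\<xi> n) + 2 * K * \<epsilon>) / D"
        by (simp add: D_def)
      also have "\<dots> < (e' * D / 4 + 2 * K * \<epsilon>) / D"
        using elim(2) D by (intro divide_strict_right_mono) auto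
      also have "\<dots> = e' * 3 / 4"
        using D K by (simp add: \<epsilon>_def field_simps)
      finally show ?case
        using e' S_nonneg[of "w n 0"] by simp
    qed
  qed
  then have "(\<lambda>n. w n 0) \<longlonglongrightarrow> 0"
    using S_tendsto_0_iff[of "\<lambda>n. w n 0" 0] by simp
  then have "(\<lambda>n. w n 0 + (p' n 0 - p 0)) \<longlonglongrightarrow> 0 + (p 0 - p 0)"
    by (intro tendsto_intros lim)
  then have "(\<lambda>n. q' n 0 - q 0) \<longlonglongrightarrow> 0"
    by (simp add: w_def wq_def wq'_def)
  then show ?thesis
    by (simp add: LIM_zero_iff)
qed

end

section \<open>Splitting into a forward bounded and a backward bounded solution\<close>

context small_perturbations
begin

text \<open>
  The roles of \<open>F\<close> and \<open>G\<close>: solutions of the equation with \<open>F\<close> are split into half-bounded solutions of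
  the equation with \<open>G\<close>, for which zero is an equilibrium. It is their distance
  that is bounded, while both may grow linearly.
\<close>

definition comparison where
  "comparison c F G \<longleftrightarrow> pert F \<and> pert G \<and> (\<forall>t z. S (F t z - G t z) \<le> c) \<and> (\<forall>t. G t 0 = 0)"

text \<open>
  In the linear autonomous case, \<open>zs\<close> and \<open>zu\<close> are the components of \<open>z\<close> in the stable and the unstable
  subspace.
\<close>

definition split where
  "split F G z zs zu \<longleftrightarrow>
     solution (field F) z \<and> solution (field G) zs \<and> solution (field G) zu \<and>
     fwd_bdd zs \<and> bwd_bdd zu \<and> fwd_bdd (\<lambda>t. z t - zu t) \<and> bwd_bdd (\<lambda>t. z t - zs t)"

lemma fwd_bdd_commute: "fwd_bdd (\<lambda>t. z t - w t) \<longleftrightarrow> fwd_bdd (\<lambda>t. w t - z t)"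
  unfolding fwd_bdd_def by (simp only: is_norm_commute[OF S, of "z _"])

lemma bwd_bdd_commute: "bwd_bdd (\<lambda>t. z t - w t) \<longleftrightarrow> bwd_bdd (\<lambda>t. w t - z t)"
  unfolding bwd_bdd_def by (simp only: is_norm_commute[OF S, of "z _"])

lemma split_shadows:
  assumes "split F G z zs zu"
  shows "shadows G (\<lambda>t. 0) z zs" "shadows G z (\<lambda>t. 0) zu" "shadows F zu zs z"
  using assms fwd_bdd_commute[of z zu] bwd_bdd_commute[of z zs]
  unfolding split_def shadows_def by simp_all

lemma split_solutions:
  assumes "split F G z zs zu"
  shows "solution (field F) z" "solution (field G) zs" "solution (field G) zu"
  using assms by (auto simp: split_def)

context
  fixes F G c
  assumes FG: "comparison c F G"
begin

lemma near: "S (F t z - G t z) \<le> c"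
  using FG by (simp add: comparison_def)

lemma FG_facts:
  shows "pert F" "pert G" "S (G t z - F t z) \<le> c" "S (G t z - G t z) \<le> c" "solution (field G) (\<lambda>t. 0)"
proof -
  show "pert F" "pert G"
    using FG by (auto simp: comparison_def)
  show "S (G t z - F t z) \<le> c"
    using near[of t z] by (simp add: is_norm_commute[OF S, of "G t z"])
  show "S (G t z - G t z) \<le> c"
    using order_trans[OF S_nonneg near] by (simp add: S_zero)
  show "solution (field G) (\<lambda>t. 0)"
    using FG by (intro zero_solution) (auto simp: comparison_def)
qed

lemma split_exists_parts:
  assumes z: "solution (field F) z"
  shows "\<exists>zs zu. split F G z zs zu"
proof -
  obtain zs where zs: "shadows G (\<lambda>t. 0) z zs"
    using shadow_exists[OF FG_facts(2,2,1,4,3,5) z] by blast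
  obtain zu where zu: "shadows G z (\<lambda>t. 0) zu"
    using shadow_exists[OF FG_facts(2,1,2,3,4) z FG_facts(5)] by blast
  have "split F G z zs zu"
    using zs zu z fwd_bdd_commute[of z zu] bwd_bdd_commute[of z zs]
    unfolding split_def shadows_def by simp
  then show ?thesis by blast
qed

lemma split_exists_whole:
  assumes zs: "solution (field G) zs" "fwd_bdd zs" and zu: "solution (field G) zu" "bwd_bdd zu"
  shows "\<exists>z. split F G z zs zu"
  using shadow_exists[OF FG_facts(1,2,2) near near zu(1) zs(1)] zs zu
  unfolding split_def shadows_def by blast

lemma split_estimate:
  "\<exists>a\<ge>0. \<forall>z zs zu t. split F G z zs zu \<longrightarrow>
     S (zs t) \<le> a * (S (z t) + 1) \<and> S (zu t) \<le> a * (S (z t) + 1) \<and>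
     S (z t) \<le> a * (S (zs t) + S (zu t) + 1)"
proof -
  define a b where "a = K * \<alpha> / (\<alpha> - 2 * K * \<kappa>)" and "b = 2 * K * c / (\<alpha> - 2 * K * \<kappa>)"
  have c: "c \<ge> 0"
    using order_trans[OF S_nonneg near] .
  have ab: "a \<ge> 0" "b \<ge> 0"
    using \<kappa> K \<alpha> c by (auto simp: a_def b_def)
  have est: "(K * \<alpha> * x + 2 * K * c) / (\<alpha> - 2 * K * \<kappa>) = a * x + b" for x
    by (simp add: a_def b_def add_divide_distrib)
  have "S (zs t) \<le> (a + 1 + b) * (S (z t) + 1) \<and> S (zu t) \<le> (a + 1 + b) * (S (z t) + 1) \<and>
     S (z t) \<le> (a + 1 + b) * (S (zs t) + S (zu t) + 1)" if sp: "split F G z zs zu" for z zs zu t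
  proof -
    note sol = split_solutions[OF sp] and sh = split_shadows[OF sp]
    have 1: "S (zs t) \<le> a * S (z t) + b"
      using shadow_estimate[OF FG_facts(2,2,1,4,3,5) sol(1) sh(1), of t t] unfolding est by simp
    have 2: "S (zu t - z t) \<le> a * S (z t) + b"
      using shadow_estimate[OF FG_facts(2,1,2,3,4) sol(1) FG_facts(5) sh(2), of t t] unfolding est
      by (simp add: S_minus)
    have 3: "S (z t - zu t) \<le> a * S (zs t - zu t) + b"
      using shadow_estimate[OF FG_facts(1,2,2) near near sol(3,2) sh(3), of t t] unfolding est by simp
    have 4: "S (zu t) \<le> S (zu t - z t) + S (z t)" "S (z t) \<le> S (z t - zu t) + S (zu t)"
      using S_triangle[of "zu t - z t" "z t"] S_triangle[of "z t - zu t" "zu t"]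
      by simp_all
    have 5: "a * S (zs t - zu t) \<le> a * (S (zs t) + S (zu t))"
      by (intro mult_left_mono S_diff ab)
    have nn: "S (z t) \<ge> 0" "S (zs t) \<ge> 0" "S (zu t) \<ge> 0" "b * S (z t) \<ge> 0" "b * S (zs t) \<ge> 0" "b * S (zu t) \<ge> 0"
      using ab by (auto intro: S_nonneg mult_nonneg_nonneg)
    have nna: "a * S (z t) \<ge> 0" "a * S (zs t) \<ge> 0" "a * S (zu t) \<ge> 0"
      using ab nn by (auto intro: mult_nonneg_nonneg)
    have "S (zs t) \<le> (a + 1 + b) * (S (z t) + 1)"
      using 1 nn ab nna unfolding distrib_left distrib_right mult_1_right mult_1 by linarith
    moreover have "S (zu t) \<le> (a + 1 + b) * (S (z t) + 1)"
      using 2 4(1) nn ab nna unfolding distrib_left distrib_right mult_1_right mult_1 by linarith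
    moreover have "S (z t) \<le> (a + 1 + b) * (S (zs t) + S (zu t) + 1)"
      using 3 4(2) 5 nn ab nna unfolding distrib_left distrib_right mult_1_right mult_1 by linarith
    ultimately show ?thesis
      by blast
  qed
  then show ?thesis
    using ab by (intro exI[of _ "a + 1 + b"]) auto
qed

lemma split_tendsto_parts:
  assumes "split F G z zs zu" "\<And>n. split F G (z' n) (zs' n) (zu' n)"
    and "(\<lambda>n. z' n 0) \<longlonglongrightarrow> z 0"
  shows "(\<lambda>n. zs' n 0) \<longlonglongrightarrow> zs 0" "(\<lambda>n. zu' n 0) \<longlonglongrightarrow> zu 0"
proof -
  note sol = split_solutions[OF assms(1)] and sol' = split_solutions[OF assms(2)]
  note sh = split_shadows[OF assms(1)] and sh' = split_shadows[OF assms(2)]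
  show "(\<lambda>n. zs' n 0) \<longlonglongrightarrow> zs 0"
    by (rule shadow_tendsto[OF FG_facts(2,2,1,4,3,5) sol(1) sh(1) FG_facts(5) sol'(1) sh'(1) tendsto_const assms(3)])
  show "(\<lambda>n. zu' n 0) \<longlonglongrightarrow> zu 0"
    by (rule shadow_tendsto[OF FG_facts(2,1,2,3,4) sol(1) FG_facts(5) sh(2) sol'(1) FG_facts(5) sh'(2) assms(3) tendsto_const])
qed

lemma split_tendsto_whole:
  assumes "split F G z zs zu" "\<And>n. split F G (z' n) (zs' n) (zu' n)"
    and "(\<lambda>n. zs' n 0) \<longlonglongrightarrow> zs 0" "(\<lambda>n. zu' n 0) \<longlonglongrightarrow> zu 0"
  shows "(\<lambda>n. z' n 0) \<longlonglongrightarrow> z 0"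
proof -
  note sol = split_solutions[OF assms(1)] and sol' = split_solutions[OF assms(2)]
  show ?thesis
    by (rule shadow_tendsto[OF FG_facts(1,2,2) near near sol(3,2) split_shadows(3)[OF assms(1)]
          sol'(3,2) split_shadows(3)[OF assms(2)] assms(4,3)])
qed

end

section \<open>Decay of half-bounded solutions and eventual equality\<close>

definition decay_constant :: real where
  "decay_constant = K * (\<alpha> - rate) / (\<alpha> - rate - 2 * K * \<kappa>)"

lemma decay_constant: "decay_constant > 0"
  using K rate by (simp add: decay_constant_def)

text \<open>
  The a priori bound for the weight \<open>max (exp (- rate * \<bar>s - \<tau>\<bar>)) \<epsilon>\<close>, which is bounded below, as it
  must be before decay is known; the choice of \<open>\<epsilon>\<close> makes the two terms equal at time \<open>t\<close>.
\<close>

lemma glue_decay: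
  assumes G: "pert G" "\<And>t. G t 0 = 0" and p: "solution (field G) p" and m: "solution (field G) m"
    and B: "\<And>s. S (glue \<tau> p m s) \<le> B"
  shows "S (glue \<tau> p m t) \<le> decay_constant * exp (- rate * \<bar>t - \<tau>\<bar>) * S (m \<tau> - p \<tau>)"
proof -
  define \<epsilon> where "\<epsilon> = exp (- rate * \<bar>t - \<tau>\<bar>)"
  have \<epsilon>: "0 < \<epsilon>" "\<epsilon> \<le> 1"
    using rate(1) by (auto simp: \<epsilon>_def)
  define \<rho> where "\<rho> s = max (exp (- rate * \<bar>s - \<tau>\<bar>)) \<epsilon>" for s
  have \<rho>t: "\<rho> t = \<epsilon>" and \<rho>\<tau>: "\<rho> \<tau> = 1"
    using \<epsilon> by (auto simp: \<rho>_def \<epsilon>_def)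
  have B0: "B \<ge> 0"
    using order_trans[OF S_nonneg B] .
  let ?w = "\<lambda>s. 0 - glue \<tau> p m s"
  let ?r = "\<lambda>s. 0 - glue_along \<tau> G p G m s"
  have zero: "forcing (\<lambda>s::real. 0::'a)" "voc (\<lambda>s. 0) (\<lambda>s. 0)"
    by (auto simp: voc_def Y_simps intro: forcing_continuous)
  note forc = pert_solution_forcing[OF G(1) p] pert_solution_forcing[OF G(1) m]
  have "S (?w t) \<le> \<rho> t * ((K * (\<alpha> - rate) * (S (m \<tau> - p \<tau>) / \<rho> \<tau>) + 2 * K * 0) / (\<alpha> - rate - 2 * K * \<kappa>))"
  proof (rule a_priori[where w = ?w and r = ?r and \<rho> = \<rho> and B = "B / \<epsilon>"])
    show "voc_jump \<tau> (m \<tau> - p \<tau>) ?r ?w"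
      by (intro voc_jump_glue forc zero pert_solution_voc G p m)
    show "forcing ?r"
      by (intro forcing_diff forcing_if forc zero)
    show "S (?r s) \<le> \<kappa> * S (?w s) + 0 * \<rho> s" for s
      using pert_lip[OF G(1), of s "p s" 0] pert_lip[OF G(1), of s "m s" 0]
      by (simp add: G(2) S_minus)
    show "S (?w s) \<le> B / \<epsilon> * \<rho> s" for s
    proof -
      have "B / \<epsilon> * \<epsilon> \<le> B / \<epsilon> * \<rho> s"
        using B0 \<epsilon> by (intro mult_left_mono) (auto simp: \<rho>_def)
      then show ?thesis
        using B[of s] \<epsilon> by (auto simp: S_minus split: if_splits)
    qed
    show "\<rho> s > 0" for s
      using \<epsilon> by (simp add: \<rho>_def less_max_iff_disj)
    show "\<rho> s \<le> \<rho> t * exp (rate * \<bar>t - s\<bar>)" for s t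
    proof -
      have "exp (- rate * \<bar>s - \<tau>\<bar>) \<le> exp (- rate * \<bar>t - \<tau>\<bar>) * exp (rate * \<bar>t - s\<bar>)"
      proof -
        have "\<bar>t - \<tau>\<bar> \<le> \<bar>s - \<tau>\<bar> + \<bar>t - s\<bar>"
          by linarith
        then have "rate * \<bar>t - \<tau>\<bar> \<le> rate * (\<bar>s - \<tau>\<bar> + \<bar>t - s\<bar>)"
          using rate(1) by (intro mult_left_mono) auto
        then show ?thesis
          by (simp add: exp_add[symmetric] distrib_left)
      qed
      also have "\<dots> \<le> \<rho> t * exp (rate * \<bar>t - s\<bar>)"
        by (intro mult_right_mono) (auto simp: \<rho>_def)
      finally have 1: "exp (- rate * \<bar>s - \<tau>\<bar>) \<le> \<rho> t * exp (rate * \<bar>t - s\<bar>)" .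
      have "\<epsilon> * 1 \<le> \<rho> t * exp (rate * \<bar>t - s\<bar>)"
        using \<epsilon> rate(1) by (intro mult_mono) (auto simp: \<rho>_def)
      with 1 show ?thesis
        by (simp add: \<rho>_def[of s])
    qed
  qed (use rate \<kappa> in auto)
  then show ?thesis
    unfolding \<rho>t \<rho>\<tau> \<epsilon>_def decay_constant_def
    by (simp add: S_minus mult_ac if_distrib split: if_splits)
qed

text \<open>Both time directions are treated together: \<open>\<sigma> = 1\<close> is the future and \<open>\<sigma> = - 1\<close> the past.\<close>

definition decays :: "real \<Rightarrow> (real \<Rightarrow> 'a) \<Rightarrow> bool" where
  "decays \<sigma> z \<longleftrightarrow>
     (\<forall>\<tau> h. h > 0 \<longrightarrow> S (z (\<tau> + \<sigma> * h)) \<le> decay_constant * exp (- rate * h) * S (z \<tau>))"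

definition eventually_equal :: "real \<Rightarrow> (real \<Rightarrow> 'a) \<Rightarrow> (real \<Rightarrow> 'a) \<Rightarrow> bool" where
  "eventually_equal \<sigma> z w \<longleftrightarrow> (\<exists>T. \<forall>h\<ge>T. z (\<sigma> * h) = w (\<sigma> * h))"

lemma fwd_decays:
  assumes G: "pert G" "\<And>t. G t 0 = 0" and z: "solution (field G) z" "fwd_bdd z"
  shows "decays 1 z"
  unfolding decays_def
proof (intro allI impI)
  fix \<tau> h :: real assume h: "h > 0"
  obtain B where B: "\<And>t. t \<ge> \<tau> \<Longrightarrow> S (z t) \<le> B"
    using fwd_bdd_from[OF solution_continuous[OF z(1)] z(2)] by blast
  have "S (glue \<tau> z (\<lambda>t. 0) (\<tau> + h)) \<le> decay_constant * exp (- rate * \<bar>(\<tau> + h) - \<tau>\<bar>) * S (0 - z \<tau>)"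
  proof (rule glue_decay[OF G z(1) zero_solution[OF G]])
    show "S (glue \<tau> z (\<lambda>t. 0) s) \<le> max B 0" for s
      using B by (auto simp: S_zero le_max_iff_disj)
  qed
  then show "S (z (\<tau> + 1 * h)) \<le> decay_constant * exp (- rate * h) * S (z \<tau>)"
    using h by (simp add: S_minus)
qed

lemma bwd_decays:
  assumes G: "pert G" "\<And>t. G t 0 = 0" and z: "solution (field G) z" "bwd_bdd z"
  shows "decays (- 1) z"
  unfolding decays_def
proof (intro allI impI)
  fix \<tau> h :: real assume h: "h > 0"
  obtain B where B: "\<And>t. t \<le> \<tau> \<Longrightarrow> S (z t) \<le> B"
    using bwd_bdd_from[OF solution_continuous[OF z(1)] z(2)] by blast
  have "S (glue \<tau> (\<lambda>t. 0) z (\<tau> - h)) \<le> decay_constant * exp (- rate * \<bar>(\<tau> - h) - \<tau>\<bar>) * S (z \<tau> - 0)"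
  proof (rule glue_decay[OF G zero_solution[OF G] z(1)])
    show "S (glue \<tau> (\<lambda>t. 0) z s) \<le> max B 0" for s
      using B by (auto simp: S_zero le_max_iff_disj)
  qed
  then show "S (z (\<tau> + - 1 * h)) \<le> decay_constant * exp (- rate * h) * S (z \<tau>)"
    using h by simp
qed

lemma decays_into_unit_ball:
  obtains T where "T > 0" "\<And>\<sigma> z \<tau> h. decays \<sigma> z \<Longrightarrow> S (z \<tau>) \<le> R \<Longrightarrow> h \<ge> T \<Longrightarrow> S (z (\<tau> + \<sigma> * h)) \<le> 1"
proof -
  \<comment> \<open>the exponential is bounded below by its linear part, which suffices for an entrance time\<close>
  define T where "T = max 1 (decay_constant * R / rate)"
  have T: "T > 0" "decay_constant * R \<le> rate * T"
  proof -
    have "decay_constant * R / rate \<le> T"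
      by (simp add: T_def)
    then show "decay_constant * R \<le> rate * T"
      using rate(1) by (simp add: pos_divide_le_eq mult.commute)
  qed (simp add: T_def)
  have "S (z (\<tau> + \<sigma> * h)) \<le> 1" if z: "decays \<sigma> z" "S (z \<tau>) \<le> R" "h \<ge> T" for \<sigma> z \<tau> h
  proof -
    have "rate * T \<le> rate * h"
      using that(3) rate(1) by simp
    then have "decay_constant * R \<le> exp (rate * h)"
      using T(2) exp_ge_add_one_self[of "rate * h"] by linarith
    then have "exp (- rate * h) * (decay_constant * R) \<le> exp (- rate * h) * exp (rate * h)"
      by (intro mult_left_mono) auto
    then have le: "decay_constant * exp (- rate * h) * R \<le> 1"
      by (simp add: exp_add[symmetric] mult_ac)
    have "S (z (\<tau> + \<sigma> * h)) \<le> decay_constant * exp (- rate * h) * S (z \<tau>)"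
      using z T(1) by (simp add: decays_def)
    also have "\<dots> \<le> decay_constant * exp (- rate * h) * R"
      using z(2) decay_constant by (intro mult_left_mono) auto
    finally show ?thesis
      using le by linarith
  qed
  then show ?thesis
    using that T(1) by blast
qed

text \<open>
  Half-bounded solutions decay at a uniform rate, so they stay in the unit ball from some time on.
  There the two equations agree, and half-bounded solutions of one correspond to those of the
  other that eventually coincide with them. The entrance time depends only on a bound for the
  initial value, so the correspondence distorts bounded sets in a controlled way and is
  continuous.
\<close>

context
  fixes G1 G2
  assumes G1: "pert G1" "\<And>t. G1 t 0 = 0" and G2: "pert G2" "\<And>t. G2 t 0 = 0"
    and agree: "\<And>t z. S z \<le> 1 \<Longrightarrow> G1 t z = G2 t z"
begin

lemma equal_in_unit_ball:
  assumes \<sigma>: "\<bar>\<sigma>\<bar> = 1" and z: "solution (field G1) z" and w: "solution (field G2) w"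
    and ball: "\<And>h. h \<ge> T \<Longrightarrow> S (z (\<sigma> * h)) \<le> 1"
    and eq: "z (\<sigma> * k) = w (\<sigma> * k)" and h: "k \<ge> T" "h \<ge> T"
  shows "z (\<sigma> * h) = w (\<sigma> * h)"
proof -
  obtain L where L: "caratheodory (field G2) L"
    using pert_field[OF G2(1)] by blast
  have ag: "field G1 t (z t) = field G2 t (z t)"
    if "min (\<sigma> * k) (\<sigma> * h) \<le> t" "t \<le> max (\<sigma> * k) (\<sigma> * h)" for t
  proof -
    have "\<sigma> = 1 \<or> \<sigma> = - 1"
      using \<sigma> by (auto simp: abs_if split: if_splits)
    then have t: "\<sigma> * t \<ge> T" "\<sigma> * (\<sigma> * t) = t"
      using that h by (auto simp: min_def max_def split: if_splits)
    have "S (z t) \<le> 1"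
      using ball[OF t(1)] by (simp only: t(2))
    then show ?thesis
      by (simp add: field_def agree)
  qed
  show ?thesis
  proof (cases "\<sigma> * k \<le> \<sigma> * h")
    case True
    then show ?thesis
      using solution_compare(1)[OF L z w True] ag eq by (simp add: min_def max_def)
  next
    case False
    then have le: "\<sigma> * h \<le> \<sigma> * k"
      by simp
    then show ?thesis
      using solution_compare(2)[OF L z w le] ag eq False by (simp add: min_def max_def)
  qed
qed

lemma eventually_equal_exists:
  assumes \<sigma>: "\<bar>\<sigma>\<bar> = 1" and z: "solution (field G1) z" "decays \<sigma> z"
  shows "\<exists>w. solution (field G2) w \<and> eventually_equal \<sigma> z w"
proof -
  obtain L where L: "caratheodory (field G2) L"
    using pert_field[OF G2(1)] by blast
  obtain T where T: "T > 0" "\<And>h. h \<ge> T \<Longrightarrow> S (z (0 + \<sigma> * h)) \<le> 1"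
    using decays_into_unit_ball[of "S (z 0)"] z(2) by (metis order_refl)
  obtain w where w: "solution (field G2) w" "w (\<sigma> * T) = z (\<sigma> * T)"
    using solution_exists[OF L] by blast
  have "z (\<sigma> * h) = w (\<sigma> * h)" if "h \<ge> T" for h
  proof (rule equal_in_unit_ball[OF \<sigma> z(1) w(1), where T = T and k = T])
    show "S (z (\<sigma> * x)) \<le> 1" if "x \<ge> T" for x
      using T(2)[OF that] by simp
  qed (simp_all add: w(2) that)
  then show ?thesis
    using w(1) unfolding eventually_equal_def by blast
qed

lemma eventually_equal_from:
  assumes \<sigma>: "\<bar>\<sigma>\<bar> = 1" and z: "solution (field G1) z" and w: "solution (field G2) w"
    and eq: "eventually_equal \<sigma> z w" and ball: "\<And>h. h \<ge> T \<Longrightarrow> S (z (\<tau> + \<sigma> * h)) \<le> 1"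
  shows "z (\<tau> + \<sigma> * T) = w (\<tau> + \<sigma> * T)"
proof -
  have \<sigma>\<sigma>: "\<sigma> * (\<sigma> * x) = x" for x
    using \<sigma> by (auto simp: abs_if split: if_splits)
  have shift: "\<tau> + \<sigma> * h = \<sigma> * (\<sigma> * \<tau> + h)" for h
    by (simp add: distrib_left \<sigma>\<sigma>)
  obtain T' where T': "\<And>h. h \<ge> T' \<Longrightarrow> z (\<sigma> * h) = w (\<sigma> * h)"
    using eq unfolding eventually_equal_def by blast
  have ball': "S (z (\<sigma> * h)) \<le> 1" if "h \<ge> \<sigma> * \<tau> + T" for h
    using ball[of "h - \<sigma> * \<tau>"] that by (simp add: shift)
  show ?thesis
    unfolding shift
    by (rule equal_in_unit_ball[OF \<sigma> z w, where T = "\<sigma> * \<tau> + T" and k = "max T' (\<sigma> * \<tau> + T)"])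
      (auto intro: T' ball')
qed

lemma eventually_equal_estimate:
  assumes \<sigma>: "\<bar>\<sigma>\<bar> = 1"
  shows "\<exists>R'. \<forall>z w t. solution (field G1) z \<longrightarrow> decays \<sigma> z \<longrightarrow> solution (field G2) w \<longrightarrow>
    eventually_equal \<sigma> z w \<longrightarrow> S (z t) \<le> R \<longrightarrow> S (w t) \<le> R'"
proof -
  obtain L where L: "caratheodory (field G2) L"
    using pert_field[OF G2(1)] by blast
  obtain c where c: "c > 0" "\<And>v. norm v \<le> c * S v"
    using norm_le_S by blast
  obtain d where d: "d > 0" "\<And>v. S v \<le> d * norm v"
    using S_le_norm by blast
  obtain T where T: "T > 0" "\<And>\<sigma> z \<tau> h. decays \<sigma> z \<Longrightarrow> S (z \<tau>) \<le> R \<Longrightarrow> h \<ge> T \<Longrightarrow> S (z (\<tau> + \<sigma> * h)) \<le> 1"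
    using decays_into_unit_ball[of R] by blast
  have "S (w t) \<le> d * (exp (L * T) * (c * 1))"
    if z: "solution (field G1) z" "decays \<sigma> z" and w: "solution (field G2) w"
      and eq: "eventually_equal \<sigma> z w" and R: "S (z t) \<le> R" for z w t
  proof -
    have ball: "S (z (t + \<sigma> * h)) \<le> 1" if "h \<ge> T" for h
      using T(2)[OF z(2) R that] .
    have zw: "z (t + \<sigma> * T) = w (t + \<sigma> * T)"
      by (rule eventually_equal_from[OF \<sigma> z(1) w eq ball])
    have abs: "\<bar>t - (t + \<sigma> * T)\<bar> = T"
      using \<sigma> T(1) by (simp add: abs_mult)
    have "norm (w t) \<le> exp (L * T) * norm (w (t + \<sigma> * T))"
      using solution_diff_le[OF L w zero_solution[OF G2], of t "t + \<sigma> * T"] by (simp only: abs diff_zero)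
    also have "\<dots> \<le> exp (L * T) * (c * 1)"
      using order_trans[OF c(2) mult_left_mono[OF ball[OF order_refl]]] c(1)
      by (intro mult_left_mono) (auto simp: zw[symmetric])
    finally have "norm (w t) \<le> exp (L * T) * (c * 1)" .
    from order_trans[OF d(2) mult_left_mono[OF this]] show ?thesis
      using d(1) by simp
  qed
  then show ?thesis by blast
qed

lemma eventually_equal_tendsto:
  assumes \<sigma>: "\<bar>\<sigma>\<bar> = 1"
    and z: "solution (field G1) z" "decays \<sigma> z" "solution (field G2) w" "eventually_equal \<sigma> z w"
    and z': "\<And>n. solution (field G1) (z' n)" "\<And>n. decays \<sigma> (z' n)" "\<And>n. solution (field G2) (w' n)"
      "\<And>n. eventually_equal \<sigma> (z' n) (w' n)"
    and lim: "(\<lambda>n. z' n 0) \<longlonglongrightarrow> z 0"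
  shows "(\<lambda>n. w' n 0) \<longlonglongrightarrow> w 0"
proof -
  obtain L1 where L1: "caratheodory (field G1) L1"
    using pert_field[OF G1(1)] by blast
  obtain L2 where L2: "caratheodory (field G2) L2"
    using pert_field[OF G2(1)] by blast
  have "Bseq (\<lambda>n. S (z' n 0))"
    by (rule convergent_imp_Bseq) (use S_tendsto[OF lim] in \<open>auto simp: convergent_def\<close>)
  then obtain R0 where R0: "\<And>n. S (z' n 0) \<le> R0"
    by (rule BseqE) (metis abs_le_D1 real_norm_def)
  define R where "R = max R0 (S (z 0))"
  have R: "S (z 0) \<le> R" "S (z' n 0) \<le> R" for n
    using R0 by (auto simp: R_def le_max_iff_disj)
  obtain T where T: "T > 0" "\<And>\<sigma> z \<tau> h. decays \<sigma> z \<Longrightarrow> S (z \<tau>) \<le> R \<Longrightarrow> h \<ge> T \<Longrightarrow> S (z (\<tau> + \<sigma> * h)) \<le> 1"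
    using decays_into_unit_ball[of R] by blast
  have zw: "z (0 + \<sigma> * T) = w (0 + \<sigma> * T)"
    by (rule eventually_equal_from[OF \<sigma> z(1,3,4) T(2)[OF z(2) R(1)]])
  have zw': "z' n (0 + \<sigma> * T) = w' n (0 + \<sigma> * T)" for n
    by (rule eventually_equal_from[OF \<sigma> z'(1,3,4) T(2)[OF z'(2) R(2)]])
  have "(\<lambda>n. z' n (0 + \<sigma> * T)) \<longlonglongrightarrow> z (0 + \<sigma> * T)"
    by (rule solution_tendsto[OF L1 z'(1) z(1) tendsto_const lim tendsto_const])
  then have "(\<lambda>n. w' n (0 + \<sigma> * T)) \<longlonglongrightarrow> w (0 + \<sigma> * T)"
    by (simp only: zw zw')
  then show ?thesis
    by (rule solution_tendsto[OF L2 z'(3) z(3) tendsto_const _ tendsto_const])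
qed

end

end

section \<open>The conjugacy\<close>

context small_perturbations
begin

lemma eventually_equal_commute: "eventually_equal \<sigma> z w \<longleftrightarrow> eventually_equal \<sigma> w z"
  unfolding eventually_equal_def by metis

lemma eventually_equal_bdd:
  assumes eq: "eventually_equal \<sigma> z w" and w: "continuous_on UNIV w" and z: "\<And>h. h \<ge> 0 \<Longrightarrow> S (z (\<sigma> * h)) \<le> B"
  shows "\<exists>B. \<forall>h\<ge>0. S (w (\<sigma> * h)) \<le> B"
proof -
  obtain T where T: "\<And>h. h \<ge> T \<Longrightarrow> z (\<sigma> * h) = w (\<sigma> * h)"
    using eq unfolding eventually_equal_def by blast
  have "continuous_on UNIV (\<lambda>h. w (\<sigma> * h))"
    by (rule continuous_on_compose2[OF w]) (auto intro: continuous_intros)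
  then obtain B' where B': "\<And>h. \<bar>h\<bar> \<le> \<bar>T\<bar> \<Longrightarrow> S (w (\<sigma> * h)) \<le> B'"
    using continuous_S_bounded by blast
  have "S (w (\<sigma> * h)) \<le> max B B'" if "h \<ge> 0" for h
    using z[OF that] B'[of h] T[of h] that by (cases "h \<ge> T") (auto simp: le_max_iff_disj)
  then show ?thesis by blast
qed

lemma eventually_equal_fwd_bdd:
  assumes "eventually_equal 1 z w" "continuous_on UNIV w" "fwd_bdd z"
  shows "fwd_bdd w"
  using assms(3) eventually_equal_bdd[OF assms(1,2)] unfolding fwd_bdd_def by auto

lemma bwd_bdd_reflect: "bwd_bdd z \<longleftrightarrow> (\<exists>B. \<forall>h\<ge>0. S (z (- 1 * h)) \<le> B)"
  unfolding bwd_bdd_def by (metis add.inverse_inverse mult_minus1 neg_0_le_iff_le neg_le_0_iff_le)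

lemma eventually_equal_bwd_bdd:
  assumes "eventually_equal (- 1) z w" "continuous_on UNIV w" "bwd_bdd z"
  shows "bwd_bdd w"
  using assms(3) eventually_equal_bdd[OF assms(1,2)] unfolding bwd_bdd_reflect by blast

text \<open>
  \<open>z\<close> is split, the parts are exchanged for eventually equal parts, and these are put together again.
  The relation is symmetric in the two systems, so each property of the conjugacy
  holds for its inverse too.
\<close>

definition corresponds where
  "corresponds F1 G1 F2 G2 z u \<longleftrightarrow> (\<exists>zs zu ws wu.
     split F1 G1 z zs zu \<and> eventually_equal 1 zs ws \<and> eventually_equal (- 1) zu wu \<and>
     split F2 G2 u ws wu)"

lemma corresponds_commute: "corresponds F1 G1 F2 G2 z u \<longleftrightarrow> corresponds F2 G2 F1 G1 u z"
  unfolding corresponds_def using eventually_equal_commute by blast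

text \<open>
  The relation is between whole solutions, so that a conjugacy maps solutions to solutions by
  construction; only properness and continuity have content.
\<close>

definition conjugacy where
  "conjugacy F1 G1 F2 G2 t \<zeta> = (SOME u. corresponds F1 G1 F2 G2 (flow (field F1) t \<zeta>) u) t"

lemma split_decays:
  assumes "comparison c F G" "split F G z zs zu"
  shows "decays 1 zs" "decays (- 1) zu"
  using assms fwd_decays bwd_decays by (auto simp: comparison_def split_def)

context
  fixes c1 F1 G1 c2 F2 G2
  assumes cmp1: "comparison c1 F1 G1" and cmp2: "comparison c2 F2 G2"
    and agree: "\<And>t z. S z \<le> 1 \<Longrightarrow> G1 t z = G2 t z"
begin

abbreviation "rel \<equiv> corresponds F1 G1 F2 G2"

lemma perts:
  shows "pert F1" "pert G1" "pert F2" "pert G2" "G1 t 0 = 0" "G2 t 0 = 0"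
  using cmp1 cmp2 by (auto simp: comparison_def)

lemma corresponds_solutions: "rel z u \<Longrightarrow> solution (field F1) z" "rel z u \<Longrightarrow> solution (field F2) u"
  unfolding corresponds_def split_def by auto

lemma corresponds_exists:
  assumes z: "solution (field F1) z"
  shows "\<exists>u. rel z u"
proof -
  obtain zs zu where sp: "split F1 G1 z zs zu"
    using split_exists_parts[OF cmp1 z] by blast
  note dec = split_decays[OF cmp1 sp] and sol = split_solutions[OF sp]
  note ex = eventually_equal_exists[OF perts(2,5,4,6) agree]
  obtain ws where ws: "solution (field G2) ws" "eventually_equal 1 zs ws"
    using ex[OF _ _ sol(2) dec(1)] by auto
  obtain wu where wu: "solution (field G2) wu" "eventually_equal (- 1) zu wu"
    using ex[OF _ _ sol(3) dec(2)] by auto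
  have "fwd_bdd ws"
    using eventually_equal_fwd_bdd[OF ws(2) solution_continuous[OF ws(1)]] sp by (simp add: split_def)
  moreover have "bwd_bdd wu"
    using eventually_equal_bwd_bdd[OF wu(2) solution_continuous[OF wu(1)]] sp by (simp add: split_def)
  ultimately obtain u where "split F2 G2 u ws wu"
    using split_exists_whole[OF cmp2 ws(1) _ wu(1)] by blast
  then show ?thesis
    using sp ws(2) wu(2) unfolding corresponds_def by blast
qed

lemma corresponds_tendsto:
  assumes rel: "rel z u" "\<And>n. rel (z' n) (u' n)" and lim: "(\<lambda>n. z' n 0) \<longlonglongrightarrow> z 0"
  shows "(\<lambda>n. u' n 0) \<longlonglongrightarrow> u 0"
proof -
  obtain zs zu ws wu where sp: "split F1 G1 z zs zu" "split F2 G2 u ws wu"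
    and eq: "eventually_equal 1 zs ws" "eventually_equal (- 1) zu wu"
    using rel(1) unfolding corresponds_def by blast
  have "\<forall>n. \<exists>zs zu ws wu. split F1 G1 (z' n) zs zu \<and> eventually_equal 1 zs ws \<and> eventually_equal (- 1) zu wu \<and>
     split F2 G2 (u' n) ws wu"
    using rel(2) unfolding corresponds_def by blast
  then obtain zs' zu' ws' wu' where sp': "\<And>n. split F1 G1 (z' n) (zs' n) (zu' n)" "\<And>n. split F2 G2 (u' n) (ws' n) (wu' n)"
    and eq': "\<And>n. eventually_equal 1 (zs' n) (ws' n)" "\<And>n. eventually_equal (- 1) (zu' n) (wu' n)"
    by metis
  note dec = split_decays[OF cmp1 sp(1)] and sol = split_solutions[OF sp(1)] split_solutions[OF sp(2)]
  note dec' = split_decays[OF cmp1 sp'(1)] and sol' = split_solutions[OF sp'(1)] split_solutions[OF sp'(2)]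
  have zs: "(\<lambda>n. zs' n 0) \<longlonglongrightarrow> zs 0" and zu: "(\<lambda>n. zu' n 0) \<longlonglongrightarrow> zu 0"
    by (rule split_tendsto_parts[OF cmp1 sp(1) sp'(1) lim])+
  have one: "\<bar>1::real\<bar> = 1" "\<bar>- 1::real\<bar> = 1"
    by simp_all
  note ten = eventually_equal_tendsto[OF perts(2,5,4,6) agree]
  have ws: "(\<lambda>n. ws' n 0) \<longlonglongrightarrow> ws 0"
    by (rule ten[OF _ one(1) sol(2) dec(1) sol(5) eq(1) sol'(2) dec'(1) sol'(5) eq'(1) zs])
  have wu: "(\<lambda>n. wu' n 0) \<longlonglongrightarrow> wu 0"
    by (rule ten[OF _ one(2) sol(3) dec(2) sol(6) eq(2) sol'(3) dec'(2) sol'(6) eq'(2) zu])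
  show ?thesis
    by (rule split_tendsto_whole[OF cmp2 sp(2) sp'(2) ws wu])
qed

text \<open>
  Uniqueness is continuity for a constant sequence.
\<close>

lemma corresponds_unique:
  assumes "rel z u" "rel z u'"
  shows "u = u'"
proof -
  obtain L where L: "caratheodory (field F2) L"
    using pert_field[OF perts(3)] by blast
  have "(\<lambda>n::nat. u' 0) \<longlonglongrightarrow> u 0"
    by (rule corresponds_tendsto[OF assms(1), where z' = "\<lambda>_. z" and u' = "\<lambda>_. u'"]) (use assms in auto)
  then have "u 0 = u' 0"
    by (simp add: LIMSEQ_const_iff)
  then show ?thesis
    using solution_unique[OF L] corresponds_solutions(2) assms by blast
qed

lemma corresponds_estimate: "\<exists>R'. \<forall>z u t. rel z u \<longrightarrow> S (z t) \<le> R \<longrightarrow> S (u t) \<le> R'"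
proof -
  obtain a1 where a1: "a1 \<ge> 0" "\<And>z zs zu t. split F1 G1 z zs zu \<Longrightarrow> S (zs t) \<le> a1 * (S (z t) + 1)"
    "\<And>z zs zu t. split F1 G1 z zs zu \<Longrightarrow> S (zu t) \<le> a1 * (S (z t) + 1)"
    using split_estimate[OF cmp1] by blast
  obtain a2 where a2: "a2 \<ge> 0" "\<And>z zs zu t. split F2 G2 z zs zu \<Longrightarrow> S (z t) \<le> a2 * (S (zs t) + S (zu t) + 1)"
    using split_estimate[OF cmp2] by blast
  define R1 where "R1 = a1 * (R + 1)"
  note est = eventually_equal_estimate[OF perts(2,5,4,6) agree]
  obtain Rs where Rs: "\<And>z w t. solution (field G1) z \<Longrightarrow> decays 1 z \<Longrightarrow> solution (field G2) w \<Longrightarrow>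
      eventually_equal 1 z w \<Longrightarrow> S (z t) \<le> R1 \<Longrightarrow> S (w t) \<le> Rs"
    using est[of 1 R1] by auto
  obtain Ru where Ru: "\<And>z w t. solution (field G1) z \<Longrightarrow> decays (- 1) z \<Longrightarrow> solution (field G2) w \<Longrightarrow>
      eventually_equal (- 1) z w \<Longrightarrow> S (z t) \<le> R1 \<Longrightarrow> S (w t) \<le> Ru"
    using est[of "- 1" R1] by auto
  have "S (u t) \<le> a2 * (Rs + Ru + 1)" if "rel z u" and R: "S (z t) \<le> R" for z u t
  proof -
    obtain zs zu ws wu where sp: "split F1 G1 z zs zu" "split F2 G2 u ws wu"
      and eq: "eventually_equal 1 zs ws" "eventually_equal (- 1) zu wu"
      using \<open>rel z u\<close> unfolding corresponds_def by blast
    note dec = split_decays[OF cmp1 sp(1)] and sol = split_solutions[OF sp(1)] split_solutions[OF sp(2)]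
    have "a1 * (S (z t) + 1) \<le> R1"
      unfolding R1_def using R a1(1) by (intro mult_left_mono) auto
    then have "S (zs t) \<le> R1" "S (zu t) \<le> R1"
      using a1(2,3)[OF sp(1), of t] by linarith+
    then have "S (ws t) \<le> Rs" "S (wu t) \<le> Ru"
      using Rs[OF sol(2) dec(1) sol(5) eq(1)] Ru[OF sol(3) dec(2) sol(6) eq(2)] by blast+
    then have "a2 * (S (ws t) + S (wu t) + 1) \<le> a2 * (Rs + Ru + 1)"
      using a2(1) by (intro mult_left_mono) auto
    then show ?thesis
      using a2(2)[OF sp(2), of t] by linarith
  qed
  then show ?thesis by blast
qed

lemma conjugacy_along:
  assumes "rel z u"
  shows "conjugacy F1 G1 F2 G2 t (z t) = u t"
proof -
  obtain L where L: "caratheodory (field F1) L"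
    using pert_field[OF perts(1)] by blast
  have "flow (field F1) t (z t) = z"
    by (rule flow_eq[OF L corresponds_solutions(1)[OF assms] refl])
  moreover have "(SOME u. rel z u) = u"
    using assms corresponds_unique by (metis someI)
  ultimately show ?thesis
    by (simp add: conjugacy_def)
qed

lemma corresponds_through: "\<exists>z u. z t = \<zeta> \<and> rel z u \<and> conjugacy F1 G1 F2 G2 t \<zeta> = u t"
proof -
  obtain L where L: "caratheodory (field F1) L"
    using pert_field[OF perts(1)] by blast
  obtain z where z: "solution (field F1) z" "z t = \<zeta>"
    using solution_exists[OF L] by blast
  obtain u where "rel z u"
    using corresponds_exists[OF z(1)] by blast
  then show ?thesis
    using z(2) conjugacy_along[of z u t] by blast
qed

lemma conjugacy_maps_solutions: "maps_solutions (field F1) (field F2) (conjugacy F1 G1 F2 G2)"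
  unfolding maps_solutions_def
proof (intro allI impI)
  fix z assume "solution (field F1) z"
  then obtain u where u: "rel z u"
    using corresponds_exists by blast
  then show "solution (field F2) (\<lambda>t. conjugacy F1 G1 F2 G2 t (z t))"
    using corresponds_solutions(2)[OF u] by (simp add: conjugacy_along[OF u])
qed

lemma conjugacy_bounded:
  "\<exists>R'. \<forall>t \<zeta>. norm \<zeta> \<le> R \<longrightarrow> norm (conjugacy F1 G1 F2 G2 t \<zeta>) \<le> R'"
proof -
  obtain c where c: "c > 0" "\<And>v. norm v \<le> c * S v"
    using norm_le_S by blast
  obtain d where d: "d > 0" "\<And>v. S v \<le> d * norm v"
    using S_le_norm by blast
  obtain R' where R': "\<And>z u t. rel z u \<Longrightarrow> S (z t) \<le> d * R \<Longrightarrow> S (u t) \<le> R'"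
    using corresponds_estimate[of "d * R"] by blast
  have "norm (conjugacy F1 G1 F2 G2 t \<zeta>) \<le> c * R'" if \<zeta>: "norm \<zeta> \<le> R" for t \<zeta>
  proof -
    obtain z u where zu: "z t = \<zeta>" "rel z u" "conjugacy F1 G1 F2 G2 t \<zeta> = u t"
      using corresponds_through by blast
    have "S (z t) \<le> d * R"
      using order_trans[OF d(2) mult_left_mono[OF \<zeta>]] d(1) zu(1) by simp
    from mult_left_mono[OF R'[OF zu(2) this], of c] show ?thesis
      using order_trans[OF c(2)] c(1) zu(3) by simp
  qed
  then show ?thesis by blast
qed

lemma conjugacy_tendsto:
  assumes \<tau>: "\<tau> \<longlonglongrightarrow> t" and \<zeta>: "\<zeta> \<longlonglongrightarrow> \<zeta>0"
  shows "(\<lambda>n. conjugacy F1 G1 F2 G2 (\<tau> n) (\<zeta> n)) \<longlonglongrightarrow> conjugacy F1 G1 F2 G2 t \<zeta>0"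
proof -
  obtain L1 where L1: "caratheodory (field F1) L1"
    using pert_field[OF perts(1)] by blast
  obtain L2 where L2: "caratheodory (field F2) L2"
    using pert_field[OF perts(3)] by blast
  obtain z u where zu: "z t = \<zeta>0" "rel z u" "conjugacy F1 G1 F2 G2 t \<zeta>0 = u t"
    using corresponds_through by blast
  have "\<forall>n. \<exists>z u. z (\<tau> n) = \<zeta> n \<and> rel z u \<and> conjugacy F1 G1 F2 G2 (\<tau> n) (\<zeta> n) = u (\<tau> n)"
    using corresponds_through by blast
  then obtain z' u' where zu': "\<And>n. z' n (\<tau> n) = \<zeta> n" "\<And>n. rel (z' n) (u' n)"
    "\<And>n. conjugacy F1 G1 F2 G2 (\<tau> n) (\<zeta> n) = u' n (\<tau> n)"
    by metis
  note sol = corresponds_solutions[OF zu(2)] and sol' = corresponds_solutions[OF zu'(2)]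
  have "(\<lambda>n. z' n (\<tau> n)) \<longlonglongrightarrow> z t"
    using \<zeta> by (simp add: zu(1) zu'(1))
  then have "(\<lambda>n. z' n 0) \<longlonglongrightarrow> z 0"
    by (rule solution_tendsto[OF L1 sol'(1) sol(1) \<tau> _ tendsto_const])
  then have "(\<lambda>n. u' n 0) \<longlonglongrightarrow> u 0"
    by (rule corresponds_tendsto[OF zu(2) zu'(2)])
  then have "(\<lambda>n. u' n (\<tau> n)) \<longlonglongrightarrow> u t"
    by (rule solution_tendsto[OF L2 sol'(2) sol(2) tendsto_const _ \<tau>])
  then show ?thesis
    by (simp add: zu(3) zu'(3))
qed

end

lemma conjugacy_inverse:
  assumes "comparison c1 F1 G1" "comparison c2 F2 G2" "\<And>t z. S z \<le> 1 \<Longrightarrow> G1 t z = G2 t z"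
  shows "conjugacy F2 G2 F1 G1 t (conjugacy F1 G1 F2 G2 t \<zeta>) = \<zeta>"
proof -
  obtain z u where zu: "z t = \<zeta>" "corresponds F1 G1 F2 G2 z u" "conjugacy F1 G1 F2 G2 t \<zeta> = u t"
    using corresponds_through[OF assms] by blast
  have "conjugacy F2 G2 F1 G1 t (u t) = z t"
    by (rule conjugacy_along[OF assms(2,1) assms(3)[symmetric] iffD1[OF corresponds_commute zu(2)]])
  then show ?thesis
    using zu by simp
qed

lemma conjugacy_uniformly_proper:
  assumes "comparison c1 F1 G1" "comparison c2 F2 G2" "\<And>t z. S z \<le> 1 \<Longrightarrow> G1 t z = G2 t z"
  shows "uniformly_proper (conjugacy F1 G1 F2 G2)"
  unfolding uniformly_proper_def
proof
  fix R
  obtain R' where R': "\<And>t \<zeta>. norm \<zeta> \<le> R \<Longrightarrow> norm (conjugacy F2 G2 F1 G1 t \<zeta>) \<le> R'"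
    using conjugacy_bounded[OF assms(2,1), of R] assms(3) by metis
  have "norm (conjugacy F1 G1 F2 G2 t z) \<ge> R" if "norm z \<ge> R' + 1" for t z
  proof (rule ccontr)
    assume "\<not> ?thesis"
    then have "norm (conjugacy F2 G2 F1 G1 t (conjugacy F1 G1 F2 G2 t z)) \<le> R'"
      by (intro R') simp
    then show False
      using that by (simp add: conjugacy_inverse[OF assms])
  qed
  then show "\<exists>r. \<forall>t z. norm z \<ge> r \<longrightarrow> norm (conjugacy F1 G1 F2 G2 t z) \<ge> R"
    by blast
qed

theorem topologically_conjugate_fields:
  assumes cmp: "comparison c1 F1 G1" "comparison c2 F2 G2" and agree: "\<And>t z. S z \<le> 1 \<Longrightarrow> G1 t z = G2 t z"
  shows "topologically_conjugate (field F1) (field F2)"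
  unfolding topologically_conjugate_def
proof (intro exI conjI allI)
  have agree': "\<And>t z. S z \<le> 1 \<Longrightarrow> G2 t z = G1 t z"
    using agree by simp
  let ?H = "conjugacy F1 G1 F2 G2" and ?L = "conjugacy F2 G2 F1 G1"
  show "continuous_on UNIV (\<lambda>(t, z). ?H t z)"
    unfolding continuous_on_sequentially o_def case_prod_beta
  proof (intro allI ballI impI, elim conjE)
    fix x and a :: "real \<times> 'a" assume x: "x \<longlonglongrightarrow> a"
    show "(\<lambda>n. ?H (fst (x n)) (snd (x n))) \<longlonglongrightarrow> ?H (fst a) (snd a)"
      by (rule conjugacy_tendsto[OF cmp agree tendsto_fst[OF x] tendsto_snd[OF x]])
  qed
  show "homeomorphism UNIV UNIV (?H t) (?L t)" for t
  proof (rule homeomorphismI)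
    show "continuous_on UNIV (?H t)"
      unfolding continuous_on_sequentially o_def
      by (auto intro!: conjugacy_tendsto[OF cmp agree])
    show "continuous_on UNIV (?L t)"
      unfolding continuous_on_sequentially o_def
      by (auto intro!: conjugacy_tendsto[OF cmp(2,1) agree'])
  qed (simp_all add: conjugacy_inverse[OF cmp agree] conjugacy_inverse[OF cmp(2,1) agree'])
  show "uniformly_proper ?H"
    by (rule conjugacy_uniformly_proper[OF cmp agree])
  show "uniformly_proper ?L"
    by (rule conjugacy_uniformly_proper[OF cmp(2,1) agree'])
  show "maps_solutions (field F1) (field F2) ?H"
    by (rule conjugacy_maps_solutions[OF cmp agree])
  show "maps_solutions (field F2) (field F1) ?L"
    by (rule conjugacy_maps_solutions[OF cmp(2,1) agree'])
qed

end

section \<open>Block diagonal systems\<close>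

lemma xpart_0 [simp]: "xpart 0 = 0" and ypart_0 [simp]: "ypart 0 = 0" and join_0 [simp]: "join 0 0 = 0"
  by (simp_all add: xpart_def ypart_def join_def vec_eq_iff split: sum.split)

lemma xpart_add: "xpart (z + w) = xpart z + xpart w" and ypart_add: "ypart (z + w) = ypart z + ypart w"
  and xpart_diff: "xpart (z - w) = xpart z - xpart w" and ypart_diff: "ypart (z - w) = ypart z - ypart w"
  and xpart_scaleR: "xpart (c *\<^sub>R z) = c *\<^sub>R xpart z" and ypart_scaleR: "ypart (c *\<^sub>R z) = c *\<^sub>R ypart z"
  by (simp_all add: xpart_def ypart_def vec_eq_iff)

lemma join_add: "join (x + x') (y + y') = join x y + join x' y'"
  and join_diff: "join (x - x') (y - y') = join x y - join x' y'"
  and join_scaleR: "join (c *\<^sub>R x) (c *\<^sub>R y) = c *\<^sub>R join x y"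
  by (simp_all add: join_def vec_eq_iff split: sum.split)

lemma join_split: "join x y = join x 0 + join 0 y"
  using join_add[of x 0 0 y] by simp

lemma bounded_linear_join_left: "bounded_linear (\<lambda>x. join x 0)"
  and bounded_linear_join_right: "bounded_linear (\<lambda>y. join 0 y)"
  and bounded_linear_xpart: "bounded_linear xpart"
  and bounded_linear_ypart: "bounded_linear ypart"
proof -
  have "linear (\<lambda>x. join x 0)" "linear (\<lambda>y. join 0 y)" "linear xpart" "linear ypart"
    using join_add[of _ _ 0 0] join_add[of 0 0] join_scaleR[of _ _ 0] join_scaleR[of _ 0]
    by (auto intro!: linearI simp: xpart_add ypart_add xpart_scaleR ypart_scaleR)
  then show "bounded_linear (\<lambda>x. join x 0)" "bounded_linear (\<lambda>y. join 0 y)"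
    "bounded_linear xpart" "bounded_linear ypart"
    by (simp_all add: linear_linear)
qed

lemma borel_measurable_bounded_linear:
  assumes "bounded_linear h" "u \<in> borel_measurable M"
  shows "(\<lambda>t. h (u t)) \<in> borel_measurable M"
  by (rule borel_measurable_continuous_on[OF linear_continuous_on[OF assms(1)] assms(2)])

lemma borel_measurable_join:
  assumes "u \<in> borel_measurable M" "v \<in> borel_measurable M"
  shows "(\<lambda>t. join (u t) (v t)) \<in> borel_measurable M"
  by (subst join_split, rule borel_measurable_add[OF borel_measurable_bounded_linear[OF bounded_linear_join_left assms(1)]
        borel_measurable_bounded_linear[OF bounded_linear_join_right assms(2)]])

lemma bounded_matrix_operator:
  fixes A :: "real \<Rightarrow> real^'n^'m"
  assumes "bounded (range A)"
  obtains c where "c \<ge> 0" "\<And>t x. norm (A t *v x) \<le> c * norm x"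
proof -
  obtain B where B: "\<And>t. norm (A t) \<le> B"
    using assms by (auto simp: bounded_iff)
  have B0: "B \<ge> 0"
    using order_trans[OF norm_ge_zero B] .
  have comp: "\<bar>A t $ i $ j\<bar> \<le> B" for t i j
    using order_trans[OF component_le_norm_cart[of "A t $ i" j]
        order_trans[OF Finite_Cartesian_Product.norm_nth_le B]] .
  let ?c = "real (CARD('m)) * real (CARD('n)) * B"
  have "norm (A t *v x) \<le> ?c * norm x" for t x
    using order_trans[OF onorm[OF matrix_vector_mul_bounded_linear]
        mult_right_mono[OF onorm_le_matrix_component[OF comp] norm_ge_zero]] .
  then show ?thesis
    using that[of ?c] B0 by simp
qed

lemma bounded_linear_matrix_vector: "bounded_linear (\<lambda>A::real^'n^'m. A *v x)"
proof -
  have "linear (\<lambda>A::real^'n^'m. A *v x)"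
    by (intro linearI) (auto simp: matrix_vector_mult_add_rdistrib scaleR_matrix_vector_assoc)
  then show ?thesis
    by (simp add: linear_linear)
qed

lemma linear_system_caratheodory:
  assumes "bounded (range A)" "bounded (range B)" "locally_integrable A" "locally_integrable B"
  obtains L where "caratheodory (linear_system A B) L"
proof -
  obtain a where a: "a \<ge> 0" "\<And>t x. norm (A t *v x) \<le> a * norm x"
    using bounded_matrix_operator[OF assms(1)] by blast
  obtain b where b: "b \<ge> 0" "\<And>t x. norm (B t *v x) \<le> b * norm x"
    using bounded_matrix_operator[OF assms(2)] by blast
  obtain l r p q where pos: "l > 0" "r > 0" "p > 0" "q > 0"
    and l: "\<And>x. norm (join x 0 :: real^('a + 'b)) \<le> norm (x :: real^'a) * l"
    and r: "\<And>y. norm (join 0 y :: real^('a + 'b)) \<le> norm (y :: real^'b) * r"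
    and p: "\<And>z. norm (xpart z :: real^'a) \<le> norm (z :: real^('a + 'b)) * p"
    and q: "\<And>z. norm (ypart z :: real^'b) \<le> norm (z :: real^('a + 'b)) * q"
    using bounded_linear.pos_bounded[OF bounded_linear_join_left] bounded_linear.pos_bounded[OF bounded_linear_join_right]
      bounded_linear.pos_bounded[OF bounded_linear_xpart] bounded_linear.pos_bounded[OF bounded_linear_ypart]
    by metis
  let ?L = "a * p * l + b * q * r + 1"
  have "norm (linear_system A B t z - linear_system A B t w) \<le> ?L * norm (z - w)" for t z w
  proof -
    have "linear_system A B t z - linear_system A B t w =
        join (A t *v xpart (z - w)) 0 + join 0 (B t *v ypart (z - w))"
      unfolding join_split[symmetric]
      by (simp add: linear_system_def join_diff xpart_diff ypart_diff matrix_vector_mult_diff_distrib)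
    also have "norm \<dots> \<le> norm (A t *v xpart (z - w)) * l + norm (B t *v ypart (z - w)) * r"
      by (intro order_trans[OF norm_triangle_ineq] add_mono l r)
    also have "\<dots> \<le> (a * (norm (z - w) * p)) * l + (b * (norm (z - w) * q)) * r"
      using a b pos p q by (intro add_mono mult_right_mono order_trans[OF a(2)] order_trans[OF b(2)] mult_left_mono) auto
    finally show ?thesis
      by (simp add: algebra_simps add_increasing)
  qed
  moreover have "(\<lambda>t. linear_system A B t z) \<in> borel_measurable lebesgue" for z
    unfolding linear_system_def
    by (rule borel_measurable_join[OF borel_measurable_bounded_linear[OF bounded_linear_matrix_vector]
          borel_measurable_bounded_linear[OF bounded_linear_matrix_vector]])
      (rule locally_integrable_imp_borel_measurable[OF assms(3)] locally_integrable_imp_borel_measurable[OF assms(4)])+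
  moreover have "linear_system A B t 0 = 0" for t
    by (simp add: linear_system_def)
  moreover have "?L > 0"
    using a b pos by (simp add: add_nonneg_pos)
  ultimately have "caratheodory (linear_system A B) ?L"
    unfolding caratheodory_def by auto
  then show ?thesis
    by (rule that)
qed

lemma linear_linear_system: "linear (linear_system A B t)"
proof (rule linearI)
  show "linear_system A B t (z + w) = linear_system A B t z + linear_system A B t w" for z w
    unfolding linear_system_def xpart_add ypart_add matrix_vector_right_distrib join_add ..
  show "linear_system A B t (c *\<^sub>R z) = c *\<^sub>R linear_system A B t z" for c z
    unfolding linear_system_def xpart_scaleR ypart_scaleR matrix_vector_mult_scaleR join_scaleR ..
qed

definition retract_to_ball :: "('a \<Rightarrow> real) \<Rightarrow> 'a \<Rightarrow> 'a::real_vector" where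
  "retract_to_ball N x = (if N x \<le> 1 then x else (1 / N x) *\<^sub>R x)"

context
  fixes N :: "'a::euclidean_space \<Rightarrow> real"
  assumes N: "is_norm N"
begin

lemma retract_to_ball_le: "N (retract_to_ball N x) \<le> 1"
  using is_norm_scaleR[OF N, of "1 / N x" x] by (simp add: retract_to_ball_def)

text \<open>
  For a Euclidean norm the constant would be 1. In general both the rescaling and
  the difference of the radii contribute \<open>N (x - y)\<close>.
\<close>

lemma retract_to_ball_lipschitz: "N (retract_to_ball N x - retract_to_ball N y) \<le> 2 * N (x - y)"
proof -
  note nn = is_norm_nonneg[OF N]
  have diff: "N x - N y \<le> N (x - y)" for x y
    using is_norm_triangle[OF N, of "x - y" y] by simp
  have one: "N (retract_to_ball N x - retract_to_ball N y) \<le> 2 * N (x - y)" if le: "N y \<le> N x" for x y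
  proof (cases "N x \<le> 1")
    case True
    then show ?thesis
      using le nn[of "x - y"] by (simp add: retract_to_ball_def)
  next
    case False
    define m where "m = max 1 (N y)"
    have ry: "retract_to_ball N y = (1 / m) *\<^sub>R y"
      by (auto simp: retract_to_ball_def m_def max_def)
    have m: "1 \<le> m" "m \<le> N x" "N y \<le> m"
      using False le by (auto simp: m_def)
    have rx: "retract_to_ball N x = (1 / N x) *\<^sub>R x"
      using False by (simp add: retract_to_ball_def)
    have eq: "retract_to_ball N x - retract_to_ball N y = (1 / m) *\<^sub>R (x - y) - (1 / m - 1 / N x) *\<^sub>R x"
      by (simp add: rx ry algebra_simps)
    have k: "1 / m - 1 / N x \<ge> 0"
      using m by (simp add: frac_le)
    have "N (retract_to_ball N x - retract_to_ball N y) \<le> 1 / m * N (x - y) + (1 / m - 1 / N x) * N x"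
      unfolding eq using is_norm_diff[OF N, of "(1 / m) *\<^sub>R (x - y)" "(1 / m - 1 / N x) *\<^sub>R x"] m k
      by (simp add: is_norm_scaleR[OF N])
    also have "(1 / m - 1 / N x) * N x = (N x - m) / m"
      using m False by (simp add: field_simps)
    also have "\<dots> \<le> N (x - y)"
    proof -
      have "(N x - m) / m \<le> (N x - m) / 1"
        using m by (intro divide_left_mono) auto
      then show ?thesis
        using diff[of x y] m(3) by simp
    qed
    also have "1 / m * N (x - y) \<le> 1 * N (x - y)"
      using m nn by (intro mult_right_mono) auto
    finally show ?thesis by simp
  qed
  show ?thesis
    using one[of x y] one[of y x] by (cases "N y \<le> N x") (auto simp: is_norm_commute[OF N, of x y]
        is_norm_commute[OF N, of "retract_to_ball N x"])
qed

end

text \<open>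
  The ranges of \<open>P\<close> and \<open>Q\<close> are thereby characterized in terms of the equation: they consist of the initial
  values of the solutions bounded in the future and in the past.
\<close>

lemma (in dichotomy) bounded_solution_zero:
  assumes "\<And>t. S (X t v) \<le> B"
  shows "v = 0"
proof -
  have "S (X 0 v) \<le> 2 * K * 0 / \<alpha>"
  proof (rule linear_bounded_le)
    show "forcing (\<lambda>s::real. 0::'a)"
      by (rule forcing_continuous) simp
    show "voc (\<lambda>s. 0) (\<lambda>t. X t v)"
      by (simp add: voc_def Y_simps)
  qed (use assms in \<open>auto simp: S_zero\<close>)
  then show ?thesis
    using S_nonneg[of v] is_norm_eq_0[OF S, of v] by simp
qed

lemma (in dichotomy) Q_zero_if_bounded:
  assumes B: "\<And>t. t \<ge> 0 \<Longrightarrow> S (X t v) \<le> B"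
  shows "Q v = 0"
proof (rule bounded_solution_zero)
  show "S (X t (Q v)) \<le> max (K * S v) (B + K * S v)" for t
  proof (cases "t \<le> 0")
    case False
    have "S (X t (Q v)) \<le> S (X t v) + S (X t (P v))"
      unfolding Q_def X_simps by (rule S_diff)
    then show ?thesis
      using B[of t] stable_bounded[of t v] False by (simp add: le_max_iff_disj)
  qed (simp add: le_max_iff_disj unstable_bounded)
qed

lemma (in dichotomy) P_zero_if_bounded:
  assumes B: "\<And>t. t \<le> 0 \<Longrightarrow> S (X t v) \<le> B"
  shows "P v = 0"
proof (rule bounded_solution_zero)
  have P: "P v = v - Q v"
    by (simp add: Q_def)
  show "S (X t (P v)) \<le> max (K * S v) (B + K * S v)" for t
  proof (cases "t \<ge> 0")
    case False
    have "S (X t (P v)) \<le> S (X t v) + S (X t (Q v))"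
      unfolding P X_simps by (rule S_diff)
    then show ?thesis
      using B[of t] unstable_bounded[of t v] False by (simp add: le_max_iff_disj)
  qed (simp add: le_max_iff_disj stable_bounded)
qed

lemma (in linear_equation) flow_commutes:
  assumes J: "linear J" and JC: "\<And>t z. C t (J z) = J (C t z)"
  shows "J (X t v) = X t (J v)" "J (Y t v) = Y t (J v)"
proof -
  have J': "bounded_linear J"
    using J by (simp add: linear_linear)
  have sol: "solution C (\<lambda>t. J (X t v))" for v
  proof -
    have Xc: "continuous_on UNIV (\<lambda>t. X t v)"
      by (rule solution_continuous[OF solution_X])
    have "J (X b v) = J (X a v) + integral {a..b} (\<lambda>s. C s (J (X s v)))" if "a \<le> b" for a b
    proof -
      have "X b v = X a v + integral {a..b} (\<lambda>s. C s (X s v))"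
        using solution_X[of v] that by (simp add: solution_def)
      then have "J (X b v) = J (X a v) + J (integral {a..b} (\<lambda>s. C s (X s v)))"
        by (metis linear_add[OF J])
      also have "J (integral {a..b} (\<lambda>s. C s (X s v))) = integral {a..b} (\<lambda>s. J (C s (X s v)))"
        using integral_linear[OF caratheodory_integrable[OF C Xc] J'] by (simp add: o_def)
      finally show ?thesis
        by (simp only: JC)
    qed
    moreover have "continuous_on UNIV (\<lambda>t. J (X t v))"
      using linear_continuous_on_compose[OF Xc J] .
    ultimately show ?thesis
      by (simp add: caratheodory_solution_iff[OF C])
  qed
  have X: "J (X t v) = X t (J v)" for t v
    using solution_unique[OF C sol[of v] solution_X[of "J v"], of 0] by (metis X_0)
  then show "J (X t v) = X t (J v)" .
  show "J (Y t v) = Y t (J v)"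
    using X[of t "Y t v"] by (metis X_Y Y_X)
qed

text \<open>
  \<open>J\<close> maps solutions to solutions and preserves boundedness, so it leaves the ranges of \<open>P\<close> and \<open>Q\<close>
  invariant. Applied to the coordinate projections, this shows that the dichotomy of a block
  diagonal system is block diagonal.
\<close>

lemma (in dichotomy) projection_commutes:
  assumes J: "linear J" and JC: "\<And>t z. C t (J z) = J (C t z)"
  shows "J (P v) = P (J v)"
proof -
  obtain c where c: "c > 0" "\<And>v. norm v \<le> c * S v"
    using norm_le_S by blast
  obtain d where d: "d > 0" "\<And>v. S v \<le> d * norm v"
    using S_le_norm by blast
  obtain j where j: "j > 0" "\<And>v. norm (J v) \<le> norm v * j"
    using bounded_linear.pos_bounded[of J] J by (auto simp: linear_linear)
  have SJ: "S (J v) \<le> d * j * c * S v" for v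
  proof -
    have "S (J v) \<le> d * (norm v * j)"
      using order_trans[OF d(2) mult_left_mono[OF j(2)]] d(1) by simp
    also have "\<dots> \<le> d * ((c * S v) * j)"
      using c(2)[of v] d(1) j(1) by (intro mult_left_mono mult_right_mono) auto
    finally show ?thesis
      by (simp add: mult_ac)
  qed
  have bound: "S (X t (J w)) \<le> d * j * c * (K * S v')" if "S (X t w) \<le> K * S v'" for t w v'
    using order_trans[OF SJ mult_left_mono[OF that]] c d j by (simp flip: flow_commutes(1)[OF J JC])
  have QJP: "Q (J (P w)) = 0" for w
    by (rule Q_zero_if_bounded[OF bound[OF stable_bounded]])
  have PJQ: "P (J (Q w)) = 0" for w
    by (rule P_zero_if_bounded[OF bound[OF unstable_bounded]])
  have "P (J v) = P (J (P v + Q v))"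
    by (simp add: P_Q)
  also have "\<dots> = P (J (P v))"
    by (simp add: linear_add[OF J] linear_add[OF linear_P] PJQ)
  also have "\<dots> = J (P v)"
    using QJP[of v] by (simp add: Q_def)
  finally show ?thesis by simp
qed

section \<open>Linearization of the perturbed system\<close>

theorem corollary1:
  fixes A :: "real \<Rightarrow> real^'n1^'n1" and B :: "real \<Rightarrow> real^'n2^'n2"
    and f :: "real \<Rightarrow> real^'n1 \<Rightarrow> real^'n1" and g :: "real \<Rightarrow> real^'n1 \<Rightarrow> real^'n2"
    and \<phi> :: "real \<Rightarrow> real^'n2 \<Rightarrow> real^'n1" and \<psi> :: "real \<Rightarrow> real^'n2 \<Rightarrow> real^'n2"
    and Nx :: "real^'n1 \<Rightarrow> real" and Ny :: "real^'n2 \<Rightarrow> real"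
    and N :: "real^('n1::finite + 'n2::finite) \<Rightarrow> real"
    and M :: "real^('n1 + 'n2)^('n1 + 'n2) \<Rightarrow> real"
    and K \<alpha> \<omega> lam \<delta> :: real
  assumes norms: "compatible_norms Nx Ny N M"
    and bounded_coeffs: "bounded (range A)" "bounded (range B)"
    and integrable_coeffs: "locally_integrable A" "locally_integrable B"
    and integrable_terms:
      "\<And>x. locally_integrable (\<lambda>t. f t x)" "\<And>x. locally_integrable (\<lambda>t. g t x)"
      "\<And>y. locally_integrable (\<lambda>t. \<phi> t y)" "\<And>y. locally_integrable (\<lambda>t. \<psi> t y)"
    and positive: "\<omega> > 0" "lam > 0" "\<delta> > 0"
    and lipschitz:
      "\<And>t x x'. Nx (f t x - f t x') \<le> \<omega> * Nx (x - x')"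
      "\<And>t x x'. Ny (g t x - g t x') \<le> \<omega> * Nx (x - x')"
      "\<And>t y y'. Nx (\<phi> t y - \<phi> t y') \<le> \<omega> * Ny (y - y')"
      "\<And>t y y'. Ny (\<psi> t y - \<psi> t y') \<le> \<omega> * Ny (y - y')"
    and dichotomy: "exponential_dichotomy M (linear_system A B) K \<alpha>"
    and growth: "\<And>t x. Nx (f t x) \<le> lam * Nx x" "\<And>t x. Ny (g t x) \<le> lam * Nx x"
    and bounds: "\<And>t y. Nx (\<phi> t y) \<le> \<delta>" "\<And>t y. Ny (\<psi> t y) \<le> \<delta>"
    and small: "8 * K * \<omega> / \<alpha> < 1" "8 * K * lam / \<alpha> < 1"
  shows "topologically_conjugate (perturbed_system A B f g \<phi> \<psi>) (linear_system A B)"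
proof -
  let ?C = "linear_system A B"
  have nx: "is_norm Nx" and ny: "is_norm Ny" and n: "is_norm N"
    and N_left: "\<And>x. N (join x 0) = Nx x" and N_right: "\<And>y. N (join 0 y) = Ny y"
    and M_N: "\<And>T z. N (T *v z) \<le> M T * N z"
    using norms by (auto simp: compatible_norms_def)
  obtain \<Lambda> where \<Lambda>: "caratheodory ?C \<Lambda>"
    using linear_system_caratheodory[OF bounded_coeffs integrable_coeffs] by blast
  obtain Z P where K: "K \<ge> 1" and \<alpha>: "\<alpha> > 0" and Z: "transition_matrix ?C Z"
    and kernel: "\<And>t s. M (dichotomy_kernel Z P t s) \<le> K * exp (- \<alpha> * \<bar>t - s\<bar>)"
    using dichotomy unfolding exponential_dichotomy_def by blast
  interpret eq: linear_equation ?C \<Lambda>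
    by (rule linear_equation.intro[OF \<Lambda> linear_linear_system])
  have flow: "flow ?C s v = (\<lambda>t. Z t s *v v)" for s v
    using Z by (intro flow_eq[OF \<Lambda>]) (auto simp: transition_matrix_def)
  have XZ: "eq.X t v = Z t 0 *v v" and YZ: "eq.Y t v = Z 0 t *v v" for t v
    by (simp_all add: eq.X_def eq.Y_def flow)
  have N_kernel: "N (dichotomy_kernel Z P t s *v v) \<le> K * exp (- \<alpha> * \<bar>t - s\<bar>) * N v" for t s v
    using order_trans[OF M_N mult_right_mono[OF kernel is_norm_nonneg[OF n]]] .
  \<comment> \<open>a first interpretation in the given norm, to see that P and Z are block diagonal\<close>
  interpret dN: dichotomy ?C \<Lambda> N "(*v) P" K \<alpha>
  proof unfold_locales
    show "N (eq.X t (P *v eq.Y s v)) \<le> K * exp (- \<alpha> * (t - s)) * N v" if "s \<le> t" for s t v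
      using N_kernel[of t s v] that
      by (simp add: dichotomy_kernel_def XZ YZ matrix_vector_mul_assoc[symmetric])
    show "N (eq.X t (eq.Y s v - P *v eq.Y s v)) \<le> K * exp (- \<alpha> * (s - t)) * N v" if "t < s" for s t v
    proof -
      have "(Z t 0 ** (mat 1 - P) ** Z 0 s) *v v = eq.X t (eq.Y s v - P *v eq.Y s v)"
        by (simp add: XZ YZ matrix_vector_mul_assoc[symmetric] matrix_vector_mult_diff_rdistrib)
      moreover have "(- D) *v v = - (D *v v)" for D :: "real^('n1 + 'n2)^('n1 + 'n2)"
        by (rule linear_neg[OF bounded_linear.linear[OF bounded_linear_matrix_vector]])
      ultimately have "dichotomy_kernel Z P t s *v v = - eq.X t (eq.Y s v - P *v eq.Y s v)"
        using that by (simp add: dichotomy_kernel_def)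
      then show ?thesis
        using N_kernel[of t s v] that by (simp add: is_norm_minus[OF n])
    qed
  qed (use n K \<alpha> in \<open>simp_all add: matrix_vector_right_distrib matrix_vector_mult_scaleR\<close>)

  define J J' :: "real^('n1 + 'n2) \<Rightarrow> real^('n1 + 'n2)" where "J z = join (xpart z) 0" and "J' z = join 0 (ypart z)" for z
  have J: "linear J" "linear J'"
    using join_add[of _ _ 0 0] join_add[of 0 0] join_scaleR[of _ _ 0] join_scaleR[of _ 0]
    by (auto intro!: linearI simp: J_def J'_def xpart_add ypart_add xpart_scaleR ypart_scaleR)
  have JC: "?C t (J z) = J (?C t z)" "?C t (J' z) = J' (?C t z)" for t z
    by (simp_all add: J_def J'_def linear_system_def)
  \<comment> \<open>in this norm the Lipschitz constants of the blocks add up, whereas N need not control its components\<close>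
  define S where "S z = Nx (xpart z) + Ny (ypart z)" for z
  have S_eq: "S z = N (J z) + N (J' z)" for z
    by (simp add: S_def J_def J'_def N_left N_right)
  have S_norm: "is_norm S"
    unfolding is_norm_def
  proof (intro conjI allI)
    fix v w :: "real^('n1 + 'n2)" and c :: real
    show "S v \<ge> 0"
      using is_norm_nonneg[OF nx] is_norm_nonneg[OF ny] by (simp add: S_def)
    have "v = 0" if "xpart v = 0" "ypart v = 0"
      using join_parts[of v] that by simp
    then show "S v = 0 \<longleftrightarrow> v = 0"
      using is_norm_nonneg[OF nx, of "xpart v"] is_norm_nonneg[OF ny, of "ypart v"]
      by (auto simp: S_def add_nonneg_eq_0_iff is_norm_eq_0[OF nx] is_norm_eq_0[OF ny])
    show "S (c *\<^sub>R v) = \<bar>c\<bar> * S v"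
      by (simp add: S_def xpart_scaleR ypart_scaleR is_norm_scaleR[OF nx] is_norm_scaleR[OF ny] distrib_left)
    show "S (v + w) \<le> S v + S w"
      using is_norm_triangle[OF nx, of "xpart v" "xpart w"] is_norm_triangle[OF ny, of "ypart v" "ypart w"]
      by (simp add: S_def xpart_add ypart_add)
  qed
  have J_P: "J (P *v z) = P *v J z" "J' (P *v z) = P *v J' z" for z
    using dN.projection_commutes[OF J(1) JC(1)] dN.projection_commutes[OF J(2) JC(2)] by auto
  have J_XY: "J (eq.X t v) = eq.X t (J v)" "J (eq.Y t v) = eq.Y t (J v)"
    "J' (eq.X t v) = eq.X t (J' v)" "J' (eq.Y t v) = eq.Y t (J' v)" for t v
    using eq.flow_commutes[OF J(1) JC(1)] eq.flow_commutes[OF J(2) JC(2)] by auto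
  \<comment> \<open>the factor 8 in the hypothesis: two half-lines, two components, and the Lipschitz constant 2 of the retraction\<close>
  have \<kappa>: "4 * \<omega> \<ge> 0" "2 * K * (4 * \<omega>) < \<alpha>"
    using positive(1) small(1) \<alpha> by (auto simp: pos_divide_less_eq)
  interpret small_perturbations ?C \<Lambda> S "(*v) P" K \<alpha> "4 * \<omega>"
  proof unfold_locales
    show "S (eq.X t (P *v eq.Y s v)) \<le> K * exp (- \<alpha> * (t - s)) * S v" if "s \<le> t" for s t v
      unfolding S_eq J_XY J_P distrib_left using that by (intro add_mono dN.stable)
    show "S (eq.X t (eq.Y s v - P *v eq.Y s v)) \<le> K * exp (- \<alpha> * (s - t)) * S v" if "t < s" for s t v
      unfolding S_eq J_XY J_P distrib_left linear_diff[OF J(1)] linear_diff[OF J(2)]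
      using that by (intro add_mono dN.unstable_strict)
  qed (use S_norm K \<alpha> \<kappa> in \<open>simp_all add: matrix_vector_right_distrib matrix_vector_mult_scaleR\<close>)

  have S_join: "S (join x y) = Nx x + Ny y" for x y
    by (simp add: S_def)
  have fg0: "f t 0 = 0" "g t 0 = 0" for t
    using growth(1)[of t 0] growth(2)[of t 0] is_norm_nonneg[OF nx, of "f t 0"] is_norm_nonneg[OF ny, of "g t 0"]
    by (simp_all add: is_norm_zero[OF nx] is_norm_eq_0[OF nx] is_norm_eq_0[OF ny])
  \<comment> \<open>G2 is bounded, like 0, and agrees with G1 on the unit ball: the two pairs (F1, G1) and (0, G2) are comparable\<close>
  define F1 G1 G2 :: "real \<Rightarrow> real^('n1 + 'n2) \<Rightarrow> real^('n1 + 'n2)" where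
    "F1 t z = join (f t (xpart z) + \<phi> t (ypart z)) (g t (xpart z) + \<psi> t (ypart z))"
    and "G1 t z = join (f t (xpart z)) (g t (xpart z))"
    and "G2 t z = join (f t (retract_to_ball Nx (xpart z))) (g t (retract_to_ball Nx (xpart z)))" for t z
  have meas: "(\<lambda>t. f t x) \<in> borel_measurable lebesgue" "(\<lambda>t. g t x) \<in> borel_measurable lebesgue"
    "(\<lambda>t. \<phi> t y) \<in> borel_measurable lebesgue" "(\<lambda>t. \<psi> t y) \<in> borel_measurable lebesgue" for x y
    by (intro locally_integrable_imp_borel_measurable integrable_terms)+
  have F1_G1: "F1 t z = G1 t z + join (\<phi> t (ypart z)) (\<psi> t (ypart z))" for t z
    by (simp add: F1_def G1_def join_add)
  have pertI: "pert (\<lambda>t z. join (u t z) (v t z))"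
    if meas: "\<And>z. (\<lambda>t. u t z) \<in> borel_measurable lebesgue" "\<And>z. (\<lambda>t. v t z) \<in> borel_measurable lebesgue"
      and lip: "\<And>t z z'. Nx (u t z - u t z') \<le> \<omega> * (2 * S (z - z'))" "\<And>t z z'. Ny (v t z - v t z') \<le> \<omega> * (2 * S (z - z'))"
      and zero: "\<And>t. Nx (u t 0) \<le> \<delta>" "\<And>t. Ny (v t 0) \<le> \<delta>" for u v
    unfolding perturbation_def
  proof (intro conjI allI exI)
    show "(\<lambda>t. join (u t z) (v t z)) \<in> borel_measurable lebesgue" for z
      by (intro borel_measurable_join meas)
    show "S (join (u t 0) (v t 0)) \<le> \<delta> + \<delta>" for t
      unfolding S_join by (intro add_mono zero)
    show "S (join (u t z) (v t z) - join (u t z') (v t z')) \<le> 4 * \<omega> * S (z - z')" for t z z'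
      unfolding join_diff[symmetric] S_join using lip(1)[of t z z'] lip(2)[of t z z'] by simp
  qed
  have parts: "Nx (xpart z - xpart z') \<le> S (z - z')" "Nx (xpart z - xpart z') + Ny (ypart z - ypart z') = S (z - z')" for z z'
    using is_norm_nonneg[OF ny, of "ypart (z - z')"] by (simp_all add: S_def xpart_diff ypart_diff)
  note nn = is_norm_nonneg[OF nx] is_norm_nonneg[OF ny] is_norm_nonneg[OF S_norm]
  have lip1: "\<omega> * Nx (xpart z - xpart z') \<le> \<omega> * (2 * S (z - z'))" for z z'
    using positive(1) parts(1)[of z z'] nn(3)[of "z - z'"] by (intro mult_left_mono) auto
  have lip2: "\<omega> * Nx (xpart z - xpart z') + \<omega> * Ny (ypart z - ypart z') \<le> \<omega> * (2 * S (z - z'))" for z z'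
    using positive(1) parts(2)[of z z'] nn(3)[of "z - z'"] by (simp flip: distrib_left)
  have pert_G1: "pert G1"
    unfolding G1_def
  proof (rule pertI[OF meas(1,2)])
    show "Nx (f t (xpart z) - f t (xpart z')) \<le> \<omega> * (2 * S (z - z'))"
      "Ny (g t (xpart z) - g t (xpart z')) \<le> \<omega> * (2 * S (z - z'))" for t z z'
      by (rule order_trans[OF lipschitz(1) lip1] order_trans[OF lipschitz(2) lip1])+
  qed (use positive(3) in \<open>simp_all add: fg0 is_norm_zero[OF nx] is_norm_zero[OF ny]\<close>)
  have pert_F1: "pert F1"
    unfolding F1_def
  proof (rule pertI[OF borel_measurable_add[OF meas(1,3)] borel_measurable_add[OF meas(2,4)]])
    fix t and z z' :: "real^('n1 + 'n2)"
    show "Nx (f t (xpart z) + \<phi> t (ypart z) - (f t (xpart z') + \<phi> t (ypart z'))) \<le> \<omega> * (2 * S (z - z'))"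
      unfolding add_diff_add
      by (rule order_trans[OF order_trans[OF is_norm_triangle[OF nx] add_mono[OF lipschitz(1,3)]] lip2])
    show "Ny (g t (xpart z) + \<psi> t (ypart z) - (g t (xpart z') + \<psi> t (ypart z'))) \<le> \<omega> * (2 * S (z - z'))"
      unfolding add_diff_add
      by (rule order_trans[OF order_trans[OF is_norm_triangle[OF ny] add_mono[OF lipschitz(2,4)]] lip2])
  qed (use bounds in \<open>simp_all add: fg0\<close>)
  have lip3: "\<omega> * Nx (retract_to_ball Nx (xpart z) - retract_to_ball Nx (xpart z')) \<le> \<omega> * (2 * S (z - z'))" for z z'
    using positive(1) parts(1)[of z z'] retract_to_ball_lipschitz[OF nx, of "xpart z" "xpart z'"]
    by (intro mult_left_mono) auto
  have pert_G2: "pert G2"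
    unfolding G2_def
  proof (rule pertI[OF meas(1,2)])
    show "Nx (f t (retract_to_ball Nx (xpart z)) - f t (retract_to_ball Nx (xpart z'))) \<le> \<omega> * (2 * S (z - z'))"
      "Ny (g t (retract_to_ball Nx (xpart z)) - g t (retract_to_ball Nx (xpart z'))) \<le> \<omega> * (2 * S (z - z'))" for t z z'
      by (rule order_trans[OF lipschitz(1) lip3] order_trans[OF lipschitz(2) lip3])+
  qed (use positive(3) in \<open>simp_all add: fg0 is_norm_zero[OF nx] is_norm_zero[OF ny] retract_to_ball_def\<close>)
  have pert_0: "pert (\<lambda>t z. 0)"
    using positive(1) is_norm_nonneg[OF S_norm] by (auto simp: perturbation_def is_norm_zero[OF S_norm])
  have cmp1: "comparison (\<delta> + \<delta>) F1 G1"
    unfolding comparison_def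
  proof (intro conjI allI pert_F1 pert_G1)
    show "S (F1 t z - G1 t z) \<le> \<delta> + \<delta>" for t z
      unfolding F1_G1 add_diff_cancel_left' S_join by (intro add_mono bounds)
    show "G1 t 0 = 0" for t
      by (simp add: G1_def fg0)
  qed
  have cmp2: "comparison (\<omega> * 1 + \<omega> * 1) (\<lambda>t z. 0) G2"
    unfolding comparison_def
  proof (intro conjI allI pert_0 pert_G2)
    show "S (0 - G2 t z) \<le> \<omega> * 1 + \<omega> * 1" for t z
    proof -
      let ?x = "retract_to_ball Nx (xpart z)"
      have "Nx (f t ?x) \<le> \<omega> * Nx ?x" "Ny (g t ?x) \<le> \<omega> * Nx ?x"
        using lipschitz(1)[of t ?x 0] lipschitz(2)[of t ?x 0] by (simp_all add: fg0)
      moreover have "\<omega> * Nx ?x \<le> \<omega> * 1"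
        using positive(1) by (intro mult_left_mono retract_to_ball_le[OF nx]) auto
      ultimately show ?thesis
        by (simp add: is_norm_minus[OF S_norm] G2_def S_join)
    qed
    show "G2 t 0 = 0" for t
      by (simp add: G2_def fg0 retract_to_ball_def is_norm_zero[OF nx])
  qed
  have agree: "G1 t z = G2 t z" if "S z \<le> 1" for t z
    using that is_norm_nonneg[OF ny, of "ypart z"] by (simp add: G1_def G2_def S_def retract_to_ball_def)
  have "topologically_conjugate (field F1) (field (\<lambda>t z. 0))"
    by (rule topologically_conjugate_fields[OF cmp1 cmp2 agree])
  moreover have "field F1 = perturbed_system A B f g \<phi> \<psi>"
    by (simp add: fun_eq_iff field_def F1_def linear_system_def perturbed_system_def add.assoc flip: join_add)
  moreover have "field (\<lambda>t z. 0) = linear_system A B"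
    by (simp add: fun_eq_iff field_def)
  ultimately show ?thesis
    by simp
qed
end
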